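(* For each $z\in I_\mathbb{Z}$, the map $a\mapsto (P^{\mathrm{O}}_{\mathrm{EG}}(a),Q^{\mathrm{O}}_{\mathrm{EG}}(a))$ is a bijection from the set $\mathcal{R}^+_{\mathrm{inv}}(z)$ of primed involution words for $z$ to the set of pairs $(P,Q)$ of shifted tableaux of the same shape such that $P$ is increasing with no primed entries on the main diagonal, $Q$ is standard, and $\mathrm{row}(P)\in\mathcal{R}^+_{\mathrm{inv}}(z)$.
   Context: Primed letters: for $i\in\mathbb{Z}$ put $i':=i-\tfrac12$ and $\mathbb{Z}':=\{i':i\in\mathbb{Z}\}$, so $\mathbb{Z}\sqcup\mathbb{Z}'=\tfrac12\mathbb{Z}$ with the order $\cdots<0'<0<1'<1<2'<2<\cdots$; note $(i+1)'=i'+1$. For $x\in\tfrac12\mathbb{Z}$, $\lceil x\rceil$ is $x$ with its prime removed. A primed word is a finite sequence of elements of $\tfrac12\mathbb{Z}$. Reversing the prime on $x$ replaces $\lceil x\rceil$ by $\lceil x\rceil'$ and vice versa; switching the primes of two letters $x,y$ means reversing the primes on both if exactly one of them is unprimed, and doing nothing otherwise. Involution words: $S_\mathbb{Z}$ is the group of finitely supported permutations of $\mathbb{Z}$, $s_i=(i,i+1)$, and the Demazure product $\circ$ is the unique associative product on $S_\mathbb{Z}$ with $\sigma\circ s_i=\sigma$ if $\sigma(i)>\sigma(i+1)$ and $\sigma\circ s_i=\sigma s_i$ if $\sigma(i)<\sigma(i+1)$. Let $I_\mathbb{Z}=\{z\in S_\mathbb{Z}:z=z^{-1}\}$. For $z\in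 I_\mathbb{Z}$, an involution word for $z$ is an integer word $a_1\cdots a_n$ of minimal length with $z=s_{a_n}\circ\cdots\circ s_{a_2}\circ s_{a_1}\circ s_{a_2}\circ\cdots\circ s_{a_n}$; $\mathcal{R}_{\mathrm{inv}}(z)$ is the set of these. An index $i$ is a commutation of such a word if $s_{a_i}$ commutes with $s_{a_{i-1}}\circ\cdots\circ s_{a_1}\circ\cdots\circ s_{a_{i-1}}$. $\mathcal{R}^+_{\mathrm{inv}}(z)$ is the set of primed words obtained from some $a\in\mathcal{R}_{\mathrm{inv}}(z)$ by priming the letters at some subset of the commutation indices of $a$. A primed involution word is an element of $\mathcal{R}^+_{\mathrm{inv}}(z)$ for some $z\in I_\mathbb{Z}$. Shifted tableaux: for a strict partition $\lambda=(\lambda_1>\cdots>\lambda_k>0)$, $\mathrm{SD}_\lambda=\{(i,i+j-1):1\le i\le k,\ 1\le j\le\lambda_i\}$; a shifted tableau of shape $\lambda$ is a map $T:\mathrm{SD}_\lambda\to\tfrac12\mathbb{Z}$ with entry $T_{ij}$ in box $(i,j)$ (row $i$, column $j$); boxes $(i,i)$ form the main diagonal. French notation: row $1$ at the bottom. $T$ is increasing if entries strictly increase along each row (as $j$ increases) and up each column (as $i$ increases). $\mathrm{row}(T)$ concatenates the rows, each read left to right, starting with the row of largest index and ending with row $1$. A shifted tableau with $n$ boxes is standard if it is increasing and contains an entry equal to $k$ or $k'$ for each $k\in\{1,\dots,n\}$. Orthogonal Edelman–Greene insertion: let $T$ be an increasing shifted tableau with no primed diagonal entries and $u\in\tfrac12\mathbb{Z}$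 with $\mathrm{row}(T)u$ a primed involution word. $T\xleftarrow{\mathrm{O}}u$ is computed iteratively: at each iteration a letter $w$ is inserted into a current segment (a row or column); initially $w=u$ and the segment is row $1$. If the segment is row $r$, "next row" means row $r+1$ and "next column" means column $r+1$; if it is column $c$, "next column" means column $c+1$. (1) If $\lceil w\rceil<\lceil e\rceil$ for some entry $e$ of the segment, let $m\le M$ be the smallest entries of the segment with $\lceil w\rceil\le\lceil m\rceil$, respectively $\lceil w\rceil<\lceil M\rceil$. (a) If $m=M$ is off the diagonal, replace $m$ by $w$ and insert $m$ into the next row if the segment is a row, or the next column if it is a column. (b) If $m=M$ is on the diagonal, replace $m$ by $\lceil w\rceil$ and insert $m+1$ (if $w\in\mathbb{Z}$) or $(m+1)'$ (if $w\in\mathbb{Z}'$) into the next column. (c) If $m\ne M$, switch the primes of $m$ and $M$ (leaving them in place) and insert $w+1$ into the next column if $m$ is on the diagonal or the segment is a column, and into the next row otherwise. (2) Otherwise place $w$ in the first unoccupied box $(x,y)$ of the segment with $x\le y$ (the end of that row/column), finishing the process. If $x=y$ and $w\in\mathbb{Z}'$, change this entry to $\lceil w\rceil$; the insertion ends in column insertion in this case and when $x<y$ and the segment is a column, and ends in row insertion otherwise. For a primed involution word $a=a_1\cdots a_n$, $P^{\mathrm{O}}_{\mathrm{EG}}(a)=(\cdots(\emptyset\xleftarrow{\mathrm{O}}a_1)\cdots)\xleftarrow{\mathrm{O}}a_n$, and $Q^{\mathrm{O}}_{\mathrm{EG}}(a)$ is the shifted tableau of the same shape with entry $i$ (resp.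 $i'$) in the box added when $a_i$ is inserted into $P^{\mathrm{O}}_{\mathrm{EG}}(a_1\cdots a_{i-1})$, when this insertion ends in row (resp. column) insertion.
   Formalization: In step (1)(b) the letter inserted into the next column is m (if w is unprimed) or m' (if w is primed), not m+1 or (m+1)'; with the printed rule z=(1 3), a=21 gives P=[1 3], whose row word 13 belongs to (1 2)(3 4), so the claim fails. *)

theory Defs
  imports Complex_Main "HOL-Combinatorics.Perm"
begin

section \<open>Primed letters and words\<close>

text \<open>
  The elements of \<open>\<int> \<union> \<int>'\<close> are kept as the half-integers that they are, inside the rationals.
  The integer obtained by removing the prime of \<open>x\<close> is then literally \<open>\<lceil>x\<rceil>\<close>, and \<open>x\<close> is unprimed
  iff \<open>x \<in> \<int>\<close>.
\<close>

definition primed :: "int \<Rightarrow> rat" where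
  "primed i = of_int i - 1 / 2"

definition half_ints :: "rat set" where
  "half_ints = \<int> \<union> range primed"

definition reverse_prime :: "rat \<Rightarrow> rat" where
  "reverse_prime x = (if x \<in> \<int> then primed \<lceil>x\<rceil> else of_int \<lceil>x\<rceil>)"

definition switch_primes :: "rat \<Rightarrow> rat \<Rightarrow> rat \<times> rat" where
  "switch_primes x y =
     (if (x \<in> \<int>) \<noteq> (y \<in> \<int>) then (reverse_prime x, reverse_prime y) else (x, y))"


section \<open>Involution words\<close>

text \<open>
  The group of finitely supported permutations of the integers is the type \<^typ>\<open>int perm\<close>;
  its product is composition of functions.
\<close>

definition sgen :: "int \<Rightarrow> int perm" where
  "sgen i = Perm.swap i (i + 1)"

definition is_demazure_product :: "(int perm \<Rightarrow> int perm \<Rightarrow> int perm) \<Rightarrow> bool" where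
  "is_demazure_product f \<longleftrightarrow>
     (\<forall>\<rho> \<sigma> \<tau>. f (f \<rho> \<sigma>) \<tau> = f \<rho> (f \<sigma> \<tau>)) \<and>
     (\<forall>\<sigma> i. Perm.apply \<sigma> i > Perm.apply \<sigma> (i + 1) \<longrightarrow> f \<sigma> (sgen i) = \<sigma>) \<and>
     (\<forall>\<sigma> i. Perm.apply \<sigma> i < Perm.apply \<sigma> (i + 1) \<longrightarrow> f \<sigma> (sgen i) = \<sigma> * sgen i)"

text \<open>
  Existence comes from the commuting left and right actions of the generators, so that the right
  action of a word depends only on its value at \<open>1\<close>; the values on generators and associativity
  also force \<open>f \<sigma> 1 = \<sigma>\<close>.
\<close>

definition ract :: "int perm \<Rightarrow> int \<Rightarrow> int perm" where
  "ract \<sigma> i = (if Perm.apply \<sigma> i > Perm.apply \<sigma> (i + 1) then \<sigma> else \<sigma> * sgen i)"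

definition lact :: "int perm \<Rightarrow> int \<Rightarrow> int perm" where
  "lact \<sigma> i = inverse (ract (inverse \<sigma>) i)"

lemma apply_sgen:
  "Perm.apply (sgen i) x = (if x = i then i + 1 else if x = i + 1 then i else x)"
  by (simp add: sgen_def)

lemma sgen_sgen [simp]: "sgen i * sgen i = 1"
  by (simp add: sgen_def)

lemma inverse_sgen [simp]: "inverse (sgen i) = sgen i"
  by (simp add: sgen_def)

lemma apply_inverse_apply [simp]:
  "Perm.apply (inverse \<sigma>) (Perm.apply \<sigma> x) = x"
  "Perm.apply \<sigma> (Perm.apply (inverse \<sigma>) x) = x"
  by (simp_all add: apply_sequence)

lemma apply_eq_iff: "Perm.apply \<sigma> x = y \<longleftrightarrow> x = Perm.apply (inverse \<sigma>) y"
  by auto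

lemma lact_eq:
  "lact \<sigma> i = (if Perm.apply (inverse \<sigma>) i > Perm.apply (inverse \<sigma>) (i + 1) then \<sigma> else sgen i * \<sigma>)"
  by (simp add: lact_def ract_def)

lemma ract_lact: "ract (lact \<sigma> i) j = lact (ract \<sigma> j) i"
proof -
  define p where "p = Perm.apply (inverse \<sigma>) i"
  define q where "q = Perm.apply (inverse \<sigma>) (i + 1)"
  define x where "x = Perm.apply \<sigma> j"
  define y where "y = Perm.apply \<sigma> (j + 1)"
  have pq: "p \<noteq> q" and xy: "x \<noteq> y"
    by (simp_all add: p_def q_def x_def y_def apply_inj)
  have eqs: "p = j \<longleftrightarrow> x = i" "p = j + 1 \<longleftrightarrow> y = i" "q = j \<longleftrightarrow> x = i + 1" "q = j + 1 \<longleftrightarrow> y = i + 1"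
    unfolding p_def q_def x_def y_def apply_eq_iff[of \<sigma>] by auto
  have key: "sgen i * \<sigma> = \<sigma> * sgen j" if "(x = i \<and> y = i + 1) \<or> (x = i + 1 \<and> y = i)"
  proof (rule perm_eqI)
    fix u
    consider "u = j" | "u = j + 1" | "u \<noteq> j" "u \<noteq> j + 1" by blast
    then show "Perm.apply (sgen i * \<sigma>) u = Perm.apply (\<sigma> * sgen j) u"
    proof cases
      case 3
      then have "Perm.apply \<sigma> u \<noteq> x" "Perm.apply \<sigma> u \<noteq> y"
        by (simp_all add: x_def y_def apply_inj)
      with 3 that show ?thesis by (auto simp: apply_times apply_sgen)
    qed (use that in \<open>auto simp: apply_times apply_sgen simp flip: x_def y_def\<close>)
  qed
  have l: "lact \<sigma> i = (if p > q then \<sigma> else sgen i * \<sigma>)"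
    by (simp add: lact_eq p_def q_def)
  have r: "ract \<sigma> j = (if x > y then \<sigma> else \<sigma> * sgen j)"
    by (simp add: ract_def x_def y_def)
  have rl: "ract (sgen i * \<sigma>) j = (if Perm.apply (sgen i) x > Perm.apply (sgen i) y
      then sgen i * \<sigma> else sgen i * \<sigma> * sgen j)"
    by (simp add: ract_def x_def y_def apply_times)
  have lr: "lact (\<sigma> * sgen j) i = (if Perm.apply (sgen j) p > Perm.apply (sgen j) q
      then \<sigma> * sgen j else sgen i * \<sigma> * sgen j)"
    by (simp add: lact_eq p_def q_def apply_times perm.inverse_distrib_swap mult.assoc)
  show ?thesis
  proof (cases "(x = i \<and> y = i + 1) \<or> (x = i + 1 \<and> y = i)")
    case True
    have "sgen i * \<sigma> * sgen j = \<sigma>"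
      by (simp add: key[OF True] mult.assoc)
    moreover from True have "p > q \<longleftrightarrow> x > y"
      "Perm.apply (sgen i) x > Perm.apply (sgen i) y \<longleftrightarrow> \<not> x > y"
      "Perm.apply (sgen j) p > Perm.apply (sgen j) q \<longleftrightarrow> \<not> p > q"
      using eqs by (auto simp: apply_sgen)
    ultimately show ?thesis
      unfolding l r by (auto simp: rl lr l r intro: key[OF True])
  next
    case False
    have a: "Perm.apply (sgen i) x > Perm.apply (sgen i) y \<longleftrightarrow> x > y"
      using False xy by (auto simp: apply_sgen)
    have b: "Perm.apply (sgen j) p > Perm.apply (sgen j) q \<longleftrightarrow> p > q"
      using False pq eqs by (auto simp: apply_sgen)
    show ?thesis
      unfolding l r by (auto simp: rl lr a b l r)
  qed
qed

lemma descent_exists: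
  fixes \<sigma> :: "int perm"
  assumes "\<sigma> \<noteq> 1"
  shows "\<exists>i. Perm.apply \<sigma> i > Perm.apply \<sigma> (i + 1)"
proof (rule ccontr)
  assume "\<not> ?thesis"
  then have less: "Perm.apply \<sigma> i < Perm.apply \<sigma> (i + 1)" for i
  proof -
    have "Perm.apply \<sigma> i \<noteq> Perm.apply \<sigma> (i + 1)" by (simp add: apply_inj)
    moreover have "\<not> Perm.apply \<sigma> i > Perm.apply \<sigma> (i + 1)"
      using \<open>\<not> (\<exists>i. Perm.apply \<sigma> i > Perm.apply \<sigma> (i + 1))\<close> by blast
    ultimately show ?thesis by linarith
  qed
  define B where "B = affected \<sigma>"
  have fin: "finite B" and ne: "B \<noteq> {}"
    using assms by (simp_all add: B_def)
  define k where "k = Min B"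
  have kB: "k \<in> B" using fin ne by (simp add: k_def)
  have fix_below: "Perm.apply \<sigma> x = x" if "x < k" for x
    using that fin Min_le[of B x] unfolding k_def B_def in_affected by fastforce
  have 1: "Perm.apply \<sigma> k > k - 1"
    using less[of "k - 1"] fix_below[of "k - 1"] by simp
  with kB have gt: "Perm.apply \<sigma> k > k"
    by (simp add: B_def in_affected)
  have up: "Perm.apply \<sigma> (k + int n) > k + int n" for n
  proof (induction n)
    case 0 then show ?case using gt by simp
  next
    case (Suc n)
    then show ?case using less[of "k + int n"] by (simp add: algebra_simps)
  qed
  have "(\<lambda>n. k + int n) ` UNIV \<subseteq> B"
    using up by (auto simp: B_def in_affected less_imp_neq[THEN not_sym])
  moreover have "infinite ((\<lambda>n. k + int n) ` UNIV)"
    by (auto dest: finite_imageD simp: inj_def)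
  ultimately show False
    using fin finite_subset by blast
qed

definition displacement :: "int perm \<Rightarrow> nat" where
  "displacement \<sigma> = nat (\<Sum>x\<in>affected \<sigma>. (Perm.apply \<sigma> x - x)\<^sup>2)"

lemma displacement_less:
  assumes "Perm.apply \<sigma> i > Perm.apply \<sigma> (i + 1)"
  shows "displacement (\<sigma> * sgen i) < displacement \<sigma>"
proof -
  define A where "A = affected \<sigma> \<union> affected (\<sigma> * sgen i) \<union> {i, i + 1}"
  have fA: "finite A" by (simp add: A_def)
  have ext: "(\<Sum>x\<in>affected \<tau>. (Perm.apply \<tau> x - x)\<^sup>2) = (\<Sum>x\<in>A. (Perm.apply \<tau> x - x)\<^sup>2)"
    if "affected \<tau> \<subseteq> A" for \<tau>
    using that fA by (intro sum.mono_neutral_left) (auto simp: in_affected)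
  define A' where "A' = A - {i, i + 1}"
  have A: "A = insert i (insert (i + 1) A')" and fA': "finite A'" and n: "i \<notin> A'" "i + 1 \<notin> A'"
    using fA by (auto simp: A'_def A_def)
  have s1: "(\<Sum>x\<in>A. (Perm.apply \<tau> x - x)\<^sup>2) =
      (Perm.apply \<tau> i - i)\<^sup>2 + (Perm.apply \<tau> (i + 1) - (i + 1))\<^sup>2 +
      (\<Sum>x\<in>A'. (Perm.apply \<tau> x - x)\<^sup>2)" for \<tau>
    using fA' n by (simp add: A)
  have s2: "(\<Sum>x\<in>A'. (Perm.apply (\<sigma> * sgen i) x - x)\<^sup>2) = (\<Sum>x\<in>A'. (Perm.apply \<sigma> x - x)\<^sup>2)"
    by (intro sum.cong) (use n in \<open>auto simp: apply_times apply_sgen\<close>)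
  define a where "a = Perm.apply \<sigma> i"
  define b where "b = Perm.apply \<sigma> (i + 1)"
  have v: "Perm.apply (\<sigma> * sgen i) i = b" "Perm.apply (\<sigma> * sgen i) (i + 1) = a"
    by (simp_all add: apply_times apply_sgen a_def b_def)
  have "(b - i)\<^sup>2 + (a - (i + 1))\<^sup>2 < (a - i)\<^sup>2 + (b - (i + 1))\<^sup>2"
    using assms unfolding a_def[symmetric] b_def[symmetric]
    by (simp add: power2_eq_square algebra_simps)
  then have lt: "(\<Sum>x\<in>A. (Perm.apply (\<sigma> * sgen i) x - x)\<^sup>2) < (\<Sum>x\<in>A. (Perm.apply \<sigma> x - x)\<^sup>2)"
    using s2 v by (simp add: s1 a_def b_def)
  have "0 \<le> (\<Sum>x\<in>A. (Perm.apply (\<sigma> * sgen i) x - x)\<^sup>2)"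
    by (intro sum_nonneg) simp
  with lt show ?thesis
    unfolding displacement_def by (subst ext, force simp: A_def, subst ext, force simp: A_def) linarith
qed

lemma reduced_word: "\<exists>a. foldl ract 1 a = \<sigma>"
proof (induction \<sigma> rule: measure_induct_rule[where f = displacement])
  case (less \<sigma>)
  show ?case
  proof (cases "\<sigma> = 1")
    case True
    then show ?thesis by (metis foldl_Nil)
  next
    case False
    then obtain i where i: "Perm.apply \<sigma> i > Perm.apply \<sigma> (i + 1)"
      using descent_exists by blast
    obtain a where a: "foldl ract 1 a = \<sigma> * sgen i"
      using less[OF displacement_less[OF i]] by blast
    have "ract (\<sigma> * sgen i) i = \<sigma>"
      using i by (simp add: ract_def apply_times apply_sgen mult.assoc)
    with a have "foldl ract 1 (a @ [i]) = \<sigma>" by simp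
    then show ?thesis by blast
  qed
qed

lemma foldl_ract_lact: "foldl ract (lact \<sigma> i) a = lact (foldl ract \<sigma> a) i"
  by (induction a arbitrary: \<sigma>) (simp_all add: ract_lact)

lemma foldl_ract_foldl_lact:
  "foldl ract (foldl lact \<sigma> c) a = foldl lact (foldl ract \<sigma> a) c"
  by (induction c arbitrary: \<sigma>) (simp_all add: foldl_ract_lact)

lemma inverse_foldl_lact: "inverse (foldl lact \<sigma> c) = foldl ract (inverse \<sigma>) c"
  by (induction c arbitrary: \<sigma>) (simp_all add: lact_def)

lemma left_word: "\<exists>c. foldl lact 1 c = \<sigma>"
  by (metis inverse_foldl_lact perm.inverse_inverse perm.inverse_neutral reduced_word)

lemma foldl_ract_cong:
  assumes "foldl ract 1 a = foldl ract 1 b"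
  shows "foldl ract \<sigma> a = foldl ract \<sigma> b"
  by (metis assms foldl_ract_foldl_lact left_word)

lemma ex1_demazure_product: "\<exists>!f. is_demazure_product f"
proof (rule ex_ex1I)
  define w where "w \<tau> = (SOME a. foldl ract 1 a = \<tau>)" for \<tau>
  have w: "foldl ract 1 (w \<tau>) = \<tau>" for \<tau>
    unfolding w_def using reduced_word by (rule someI_ex)
  define f where "f \<sigma> \<tau> = foldl ract \<sigma> (w \<tau>)" for \<sigma> \<tau>
  have assoc: "f (f \<rho> \<sigma>) \<tau> = f \<rho> (f \<sigma> \<tau>)" for \<rho> \<sigma> \<tau>
  proof -
    have "foldl ract 1 (w \<sigma> @ w \<tau>) = foldl ract 1 (w (f \<sigma> \<tau>))"
      by (simp add: w f_def)
    from foldl_ract_cong[OF this] show ?thesis by (simp add: f_def)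
  qed
  have "f \<sigma> (sgen i) = ract \<sigma> i" for \<sigma> i
  proof -
    have "foldl ract 1 (w (sgen i)) = foldl ract 1 [i]"
      by (simp add: w) (simp add: ract_def)
    from foldl_ract_cong[OF this] show ?thesis by (simp add: f_def)
  qed
  with assoc have "is_demazure_product f"
    by (auto simp: is_demazure_product_def ract_def)
  then show "\<exists>f. is_demazure_product f" by blast
next
  fix f g assume f: "is_demazure_product f" and g: "is_demazure_product g"
  have step: "h \<sigma> (sgen i) = ract \<sigma> i" if "is_demazure_product h" for h \<sigma> i
  proof (cases "Perm.apply \<sigma> i > Perm.apply \<sigma> (i + 1)")
    case False
    then have "Perm.apply \<sigma> i < Perm.apply \<sigma> (i + 1)"
      using apply_inj[of \<sigma> i "i + 1"] by auto
    with that show ?thesis by (simp add: is_demazure_product_def ract_def)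
  qed (use that in \<open>simp add: is_demazure_product_def ract_def\<close>)
  have unit: "h \<sigma> 1 = \<sigma>" if h: "is_demazure_product h" for h \<sigma>
  proof -
    define \<tau> where "\<tau> = h \<sigma> 1"
    have eq: "ract \<tau> i = ract \<sigma> i" for i
    proof -
      have "ract \<tau> i = h (h \<sigma> 1) (sgen i)"
        using step[OF h] by (simp add: \<tau>_def)
      also have "\<dots> = h \<sigma> (h 1 (sgen i))"
        using h by (simp add: is_demazure_product_def)
      also have "h 1 (sgen i) = sgen i"
        by (simp add: step[OF h]) (simp add: ract_def)
      finally show ?thesis by (simp add: step[OF h])
    qed
    have "finite (affected \<sigma> \<union> affected \<tau>)" by simp
    then obtain i where i: "\<And>x. x \<in> affected \<sigma> \<union> affected \<tau> \<Longrightarrow> x < i"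
      by (meson bdd_above.unfold bdd_above_finite gt_ex le_less_trans)
    have "Perm.apply \<sigma> x = x" "Perm.apply \<tau> x = x" if "x \<ge> i" for x
      using i[of x] that by (auto simp: in_affected)
    then have "\<tau> * sgen i = \<sigma> * sgen i"
      using eq[of i] by (simp add: ract_def)
    then have "\<tau> * (sgen i * sgen i) = \<sigma> * (sgen i * sgen i)"
      by (metis mult.assoc)
    then show ?thesis by (simp add: \<tau>_def)
  qed
  have word: "h \<sigma> (foldl ract 1 a) = foldl ract \<sigma> a" if h: "is_demazure_product h" for h \<sigma> a
  proof (induction a rule: rev_induct)
    case Nil
    then show ?case by (simp add: unit[OF h])
  next
    case (snoc i a)
    have "h \<sigma> (foldl ract 1 (a @ [i])) = h \<sigma> (h (foldl ract 1 a) (sgen i))"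
      by (simp add: step[OF h])
    also have "\<dots> = h (h \<sigma> (foldl ract 1 a)) (sgen i)"
      using h by (simp add: is_demazure_product_def)
    finally show ?case by (simp add: step[OF h] snoc)
  qed
  show "f = g"
  proof (intro ext)
    fix \<sigma> \<tau>
    obtain a where "foldl ract 1 a = \<tau>" using reduced_word by blast
    with word[OF f, of \<sigma> a] word[OF g, of \<sigma> a] show "f \<sigma> \<tau> = g \<sigma> \<tau>" by simp
  qed
qed

definition demazure :: "int perm \<Rightarrow> int perm \<Rightarrow> int perm"  (infixl \<open>\<circ>\<^sub>D\<close> 70) where
  "demazure = (THE f. is_demazure_product f)"

definition I_Z :: "int perm set" where
  "I_Z = {z. z = inverse z}"

text \<open>
  The element \<open>s a\<^sub>n \<circ> \<dots> \<circ> s a\<^sub>2 \<circ> s a\<^sub>1 \<circ> s a\<^sub>2 \<circ> \<dots> \<circ> s a\<^sub>n\<close>, writing \<open>s\<close> for \<^const>\<open>sgen\<close>. Starting at \<open>1\<close>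
  gives the single central factor, because \<open>s i \<circ> 1 \<circ> s i = s i\<close>.
\<close>

definition inv_product :: "int list \<Rightarrow> int perm" where
  "inv_product a = foldl (\<lambda>y i. sgen i \<circ>\<^sub>D y \<circ>\<^sub>D sgen i) 1 a"

definition R_inv :: "int perm \<Rightarrow> int list set" where
  "R_inv z = {a. inv_product a = z \<and> (\<forall>b. inv_product b = z \<longrightarrow> length a \<le> length b)}"

text \<open>List positions are counted from \<open>0\<close>.\<close>

definition commutations :: "int list \<Rightarrow> nat set" where
  "commutations a =
     {i. i < length a \<and> sgen (a ! i) * inv_product (take i a) = inv_product (take i a) * sgen (a ! i)}"

definition prime_at :: "nat set \<Rightarrow> int list \<Rightarrow> rat list" where
  "prime_at S a = map (\<lambda>i. if i \<in> S then primed (a ! i) else of_int (a ! i)) [0..<length a]"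

definition R_inv_plus :: "int perm \<Rightarrow> rat list set" where
  "R_inv_plus z = {prime_at S a | S a. a \<in> R_inv z \<and> S \<subseteq> commutations a}"


section \<open>Shifted tableaux\<close>

type_synonym box = "nat \<times> nat"
type_synonym tableau = "box \<rightharpoonup> rat"

definition strict_partition :: "nat list \<Rightarrow> bool" where
  "strict_partition lam \<longleftrightarrow> sorted_wrt (>) lam \<and> 0 \<notin> set lam"

definition SD :: "nat list \<Rightarrow> box set" where
  "SD lam = {(i, i + j - 1) | i j. 1 \<le> i \<and> i \<le> length lam \<and> 1 \<le> j \<and> j \<le> lam ! (i - 1)}"

definition shifted_tableau :: "nat list \<Rightarrow> tableau \<Rightarrow> bool" where
  "shifted_tableau lam T \<longleftrightarrow> dom T = SD lam \<and> ran T \<subseteq> half_ints"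

abbreviation entry :: "tableau \<Rightarrow> box \<Rightarrow> rat" where
  "entry T b \<equiv> the (T b)"

definition diagonal :: "box \<Rightarrow> bool" where
  "diagonal b \<longleftrightarrow> fst b = snd b"

definition increasing_tableau :: "tableau \<Rightarrow> bool" where
  "increasing_tableau T \<longleftrightarrow>
     (\<forall>i j k. (i, j) \<in> dom T \<and> (i, k) \<in> dom T \<and> j < k \<longrightarrow> entry T (i, j) < entry T (i, k)) \<and>
     (\<forall>i k j. (i, j) \<in> dom T \<and> (k, j) \<in> dom T \<and> i < k \<longrightarrow> entry T (i, j) < entry T (k, j))"

definition no_primed_diagonal :: "tableau \<Rightarrow> bool" where
  "no_primed_diagonal T \<longleftrightarrow> (\<forall>b \<in> dom T. diagonal b \<longrightarrow> entry T b \<in> \<int>)"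

definition standard_tableau :: "tableau \<Rightarrow> bool" where
  "standard_tableau T \<longleftrightarrow>
     increasing_tableau T \<and> (\<forall>k \<in> {1..card (dom T)}. of_nat k \<in> ran T \<or> primed (int k) \<in> ran T)"

definition row_entries :: "tableau \<Rightarrow> nat \<Rightarrow> rat list" where
  "row_entries T i = map (\<lambda>j. entry T (i, j)) (sorted_list_of_set {j. (i, j) \<in> dom T})"

definition row_word :: "tableau \<Rightarrow> rat list" where
  "row_word T = concat (map (row_entries T) (rev (sorted_list_of_set (fst ` dom T))))"


section \<open>Orthogonal Edelman--Greene insertion\<close>

datatype segment = Row nat | Column nat

fun boxes :: "segment \<Rightarrow> box set" where
  "boxes (Row r) = {(x, y). x = r \<and> x \<le> y}"
| "boxes (Column c) = {(x, y). y = c \<and> 1 \<le> x \<and> x \<le> y}"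

fun is_column :: "segment \<Rightarrow> bool" where
  "is_column (Row r) = False"
| "is_column (Column c) = True"

fun next_segment :: "segment \<Rightarrow> segment" where
  "next_segment (Row r) = Row (r + 1)"
| "next_segment (Column c) = Column (c + 1)"

fun next_column :: "segment \<Rightarrow> segment" where
  "next_column (Row r) = Column (r + 1)"
| "next_column (Column c) = Column (c + 1)"

fun first_unoccupied :: "tableau \<Rightarrow> segment \<Rightarrow> box" where
  "first_unoccupied T (Row r) = (r, LEAST y. (r, y) \<in> boxes (Row r) - dom T)"
| "first_unoccupied T (Column c) = (LEAST x. (x, c) \<in> boxes (Column c) - dom T, c)"

datatype ending = Row_Insertion | Column_Insertion

definition place :: "tableau \<Rightarrow> segment \<Rightarrow> rat \<Rightarrow> tableau \<times> box \<times> ending" where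
  "place T seg w =
     (let b = first_unoccupied T seg in
      (T(b \<mapsto> (if diagonal b then of_int \<lceil>w\<rceil> else w)),
       b,
       if diagonal b \<and> w \<notin> \<int> \<or> \<not> diagonal b \<and> is_column seg
       then Column_Insertion else Row_Insertion))"

text \<open>
  The letters \<open>m\<close> and \<open>M\<close> of the algorithm are represented by their boxes \<open>bm\<close> and \<open>bM\<close>; the
  entries of a row or column of an increasing tableau are distinct, so this is no choice.

  If \<open>m = M\<close> is on the diagonal, the displaced letter \<open>m\<close> moves on to the next column, and it takes
  over the prime of \<open>w\<close>. The variant that passes on \<open>m + 1\<close> or \<open>(m + 1)'\<close> at this point is a
  misprint: it inserts the involution word \<open>2 1\<close> to the one-row tableau \<open>1 3\<close>, whose row word
  belongs to a different involution, so that further insertions are no longer defined.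
\<close>

partial_function (tailrec) insert_into ::
    "tableau \<Rightarrow> segment \<Rightarrow> rat \<Rightarrow> tableau \<times> box \<times> ending" where
  "insert_into T seg w =
     (if \<exists>b \<in> boxes seg \<inter> dom T. \<lceil>w\<rceil> < \<lceil>entry T b\<rceil> then
        (let bm = arg_min_on (entry T) {b \<in> boxes seg \<inter> dom T. \<lceil>w\<rceil> \<le> \<lceil>entry T b\<rceil>};
             bM = arg_min_on (entry T) {b \<in> boxes seg \<inter> dom T. \<lceil>w\<rceil> < \<lceil>entry T b\<rceil>};
             m = entry T bm;
             M = entry T bM
         in
           if bm = bM then
             if \<not> diagonal bm then
               insert_into (T(bm \<mapsto> w)) (next_segment seg) m
             else
               insert_into (T(bm \<mapsto> of_int \<lceil>w\<rceil>)) (next_column seg)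
                 (if w \<in> \<int> then m else primed \<lceil>m\<rceil>)
           else
             insert_into
               (T(bm \<mapsto> fst (switch_primes m M), bM \<mapsto> snd (switch_primes m M)))
               (if diagonal bm then next_column seg else next_segment seg)
               (w + 1))
      else place T seg w)"

definition O_insert :: "tableau \<Rightarrow> rat \<Rightarrow> tableau \<times> box \<times> ending" where
  "O_insert T u = insert_into T (Row 1) u"

definition P_EG :: "rat list \<Rightarrow> tableau" where
  "P_EG a = foldl (\<lambda>T u. fst (O_insert T u)) Map.empty a"

text \<open>\<open>Q_EG_upto a n\<close> is the recording tableau of the first \<open>n\<close> letters of \<open>a\<close>.\<close>

primrec Q_EG_upto :: "rat list \<Rightarrow> nat \<Rightarrow> tableau" where
  "Q_EG_upto a 0 = Map.empty"
| "Q_EG_upto a (Suc n) =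
     (case O_insert (P_EG (take n a)) (a ! n) of (_, b, e) \<Rightarrow>
        (Q_EG_upto a n)
          (b \<mapsto> (case e of Row_Insertion \<Rightarrow> of_nat (Suc n)
                        | Column_Insertion \<Rightarrow> primed (int (Suc n)))))"

definition Q_EG :: "rat list \<Rightarrow> tableau" where
  "Q_EG a = Q_EG_upto a (length a)"

end

theory Submission
  imports Defs
begin

text \<open>
  One inserts letter by letter, so it suffices to invert a single insertion. Its intermediate
  states consist of a tableau, a segment and a letter; the word that reads the tableau and
  places the letter just before or after that segment stays a primed involution word of the same
  involution, because every iteration amounts to commutations, one braid relation, or, when the
  insertion turns from rows to columns, an exchange of the first two letters. Row and column
  readings agree up to commutations, since boxes read in different orders have letters differing
  by at least two. Conversely, admissible states remember where their letter was displaced, so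
  that each of them except those at row 1 has exactly one predecessor, and each result of an
  insertion, with its new box and its kind of ending, arises from exactly one final state.
\<close>

section \<open>Conjugation in the Demazure product\<close>

text \<open>Two features of the problem shape the proof. The tableaux of the theorem increase only
  as half-integers, so \<open>x'\<close> may a priori be followed by \<open>x\<close>, whereas every
  bump needs gaps between the underlying integers. The predicate \<open>good\<close> therefore
  compares ceilings, and reducedness of the row word supplies the difference. Primes are the second:
  a braid relation moves them between letters, and a diagonal box cannot hold one. The first letter
  of a word may be primed freely, and an unprimed first letter can be exchanged with the second
  while the prime stays in second position. So a prime that would land on the diagonal moves on with
  the displaced letter or is stored in the kind of ending. The place that a letter was displaced
  from is the last box of the previous row or column with a smaller integer, and the box after it
  tells whether the old entry was overwritten or kept. If a column letter came from the diagonal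
  box, the previous segment was a row.\<close>

definition act :: "int perm \<Rightarrow> int \<Rightarrow> int perm" where
  "act y i = sgen i \<circ>\<^sub>D y \<circ>\<^sub>D sgen i"

definition commutes :: "int \<Rightarrow> int perm \<Rightarrow> bool" where
  "commutes i y \<longleftrightarrow> sgen i * y = y * sgen i"

definition desc :: "int perm \<Rightarrow> int \<Rightarrow> bool" where
  "desc y i \<longleftrightarrow> Perm.apply y (i + 1) < Perm.apply y i"

lemma is_demazure_product_demazure: "is_demazure_product demazure"
  unfolding demazure_def by (rule theI'[OF ex1_demazure_product])

lemma demazure_assoc: "\<rho> \<circ>\<^sub>D \<sigma> \<circ>\<^sub>D \<tau> = \<rho> \<circ>\<^sub>D (\<sigma> \<circ>\<^sub>D \<tau>)"
  using is_demazure_product_demazure by (simp add: is_demazure_product_def)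

lemma demazure_sgen: "\<sigma> \<circ>\<^sub>D sgen i = ract \<sigma> i"
proof (cases "Perm.apply \<sigma> i > Perm.apply \<sigma> (i + 1)")
  case False
  then have "Perm.apply \<sigma> i < Perm.apply \<sigma> (i + 1)"
    using apply_inj[of \<sigma> i "i + 1"] by auto
  then show ?thesis
    using is_demazure_product_demazure by (simp add: is_demazure_product_def ract_def)
qed (use is_demazure_product_demazure in \<open>simp add: is_demazure_product_def ract_def\<close>)

lemma ract_1 [simp]: "ract 1 i = sgen i"
  by (simp add: ract_def)

lemma lact_1 [simp]: "lact 1 i = sgen i"
  by (simp add: lact_def)

text \<open>Associativity appends one generator at a time. The word is nonempty so that right
  multiplication by generators suffices; the empty word would call for the unit law.\<close>

lemma demazure_foldl_ract: "\<sigma> \<circ>\<^sub>D foldl ract 1 (i # a) = foldl ract \<sigma> (i # a)"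
proof (induction a rule: rev_induct)
  case (snoc j a)
  have "\<sigma> \<circ>\<^sub>D foldl ract 1 (i # a @ [j]) = \<sigma> \<circ>\<^sub>D (foldl ract 1 (i # a) \<circ>\<^sub>D sgen j)"
    by (simp add: demazure_sgen)
  also have "\<dots> = (\<sigma> \<circ>\<^sub>D foldl ract 1 (i # a)) \<circ>\<^sub>D sgen j"
    by (simp only: demazure_assoc)
  also have "\<dots> = foldl ract \<sigma> (i # a @ [j])"
    unfolding snoc demazure_sgen by simp
  finally show ?case by simp
qed (simp add: demazure_sgen)

text \<open>Writing \<open>y\<close> as a nonempty word turns the product into a right action on
  \<open>sgen i = lact 1 i\<close>, and the left action can be pulled out of it.\<close>

lemma sgen_demazure:
  assumes "y \<noteq> 1"
  shows "sgen i \<circ>\<^sub>D y = lact y i"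
proof -
  obtain a where a: "foldl ract 1 a = y" using reduced_word by blast
  with assms obtain j b where "a = j # b" by (cases a) auto
  then have "sgen i \<circ>\<^sub>D y = foldl ract (lact 1 i) a"
    unfolding a[symmetric] lact_1 by (simp only: demazure_foldl_ract)
  then show ?thesis by (simp only: foldl_ract_lact a)
qed

lemma act_lact_ract: "act y i = ract (lact y i) i"
proof (cases "y = 1")
  case True
  have "act 1 i = sgen i \<circ>\<^sub>D (1 \<circ>\<^sub>D sgen i)"
    by (simp only: act_def demazure_assoc)
  with True show ?thesis by (simp add: demazure_sgen)
qed (simp add: act_def sgen_demazure demazure_sgen)

text \<open>Commuting with \<open>sgen i\<close> makes \<open>y\<close> permute the pair
  \<open>i, i + 1\<close>; without a descent it cannot exchange them.\<close>

lemma commutes_iff: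
  assumes "\<not> desc y i"
  shows "commutes i y \<longleftrightarrow> Perm.apply y i = i \<and> Perm.apply y (i + 1) = i + 1"
proof
  assume "commutes i y"
  then have *: "Perm.apply (sgen i) (Perm.apply y x) = Perm.apply y (Perm.apply (sgen i) x)" for x
    by (metis apply_times commutes_def comp_apply)
  have ne: "Perm.apply y i \<noteq> Perm.apply y (i + 1)" by (simp add: apply_inj)
  from *[of i] *[of "i + 1"] ne assms show "Perm.apply y i = i \<and> Perm.apply y (i + 1) = i + 1"
    by (auto simp: apply_sgen desc_def split: if_splits)
next
  assume fx: "Perm.apply y i = i \<and> Perm.apply y (i + 1) = i + 1"
  show "commutes i y"
    unfolding commutes_def
  proof (rule perm_eqI)
    fix x
    have "Perm.apply y x = i \<longleftrightarrow> x = i" "Perm.apply y x = i + 1 \<longleftrightarrow> x = i + 1"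
      using fx by (metis apply_inj)+
    with fx show "Perm.apply (sgen i * y) x = Perm.apply (y * sgen i) x"
      by (auto simp: apply_times apply_sgen)
  qed
qed

text \<open>An involution has the same left and right descents, so at a descent both factors are
  absorbed. Otherwise the left factor is multiplied on, and the right one is absorbed exactly when
  \<open>sgen i * y = y * sgen i\<close>.\<close>

lemma act_eq:
  assumes "inverse y = y"
  shows "act y i = (if desc y i then y else if commutes i y then sgen i * y else sgen i * y * sgen i)"
proof (cases "desc y i")
  case True
  then show ?thesis
    using assms by (simp add: act_lact_ract lact_eq ract_def desc_def)
next
  case False
  have ne: "Perm.apply y i \<noteq> Perm.apply y (i + 1)" by (simp add: apply_inj)
  then show ?thesis
    using assms False unfolding commutes_iff[OF False]
    by (auto simp: act_lact_ract lact_eq ract_def desc_def apply_times apply_sgen mult.assoc)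
qed

lemma inverse_act:
  assumes "inverse y = y"
  shows "inverse (act y i) = act y i"
  using assms by (simp add: act_eq perm.inverse_distrib_swap mult.assoc) (simp add: commutes_def)

lemma act_act_same [simp]: "act (act y i) i = act y i"
proof -
  have "sgen i \<circ>\<^sub>D sgen i = sgen i"
    by (simp add: demazure_sgen ract_def apply_sgen)
  then show ?thesis
    by (metis act_def demazure_assoc)
qed

lemma sgen_commute:
  assumes "2 \<le> \<bar>i - j\<bar>"
  shows "sgen i * sgen j = sgen j * sgen i"
  by (rule perm_eqI) (use assms in \<open>auto simp: apply_times apply_sgen\<close>)

lemma act_commute:
  assumes "2 \<le> \<bar>i - j\<bar>"
  shows "act (act y i) j = act (act y j) i"
proof -
  have "sgen i \<circ>\<^sub>D sgen j = sgen j \<circ>\<^sub>D sgen i"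
    using assms sgen_commute[OF assms] by (simp add: demazure_sgen ract_def apply_sgen)
  then show ?thesis
    unfolding act_def by (metis demazure_assoc)
qed

lemma act_1 [simp]: "act 1 i = sgen i"
  by (simp add: act_lact_ract) (simp add: ract_def apply_sgen)

lemma sgen_braid:
  assumes "\<bar>i - j\<bar> = 1"
  shows "sgen i * sgen j * sgen i = sgen j * sgen i * sgen j"
  by (rule perm_eqI) (use assms in \<open>auto simp: apply_times apply_sgen\<close>)

lemma demazure_braid:
  assumes "\<bar>i - j\<bar> = 1"
  shows "sgen i \<circ>\<^sub>D sgen j \<circ>\<^sub>D sgen i = sgen j \<circ>\<^sub>D sgen i \<circ>\<^sub>D sgen j"
proof -
  have "j = i + 1 \<or> i = j + 1" using assms by linarith
  then show ?thesis
    using sgen_braid[OF assms] by (auto simp: demazure_sgen ract_def apply_times apply_sgen)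
qed

text \<open>Acting with a word conjugates by a Demazure product, and the words \<open>i j i\<close>
  and \<open>j i j\<close> have the same product.\<close>

lemma act_braid:
  assumes "\<bar>i - j\<bar> = 1"
  shows "act (act (act y i) j) i = act (act (act y j) i) j"
proof -
  have *: "act (act (act y i) j) i = (sgen i \<circ>\<^sub>D sgen j \<circ>\<^sub>D sgen i) \<circ>\<^sub>D y \<circ>\<^sub>D (sgen i \<circ>\<^sub>D sgen j \<circ>\<^sub>D sgen i)" for i j
    unfolding act_def by (simp only: demazure_assoc)
  show ?thesis
    unfolding * demazure_braid[OF assms] ..
qed

text \<open>Both sides are the Demazure braid of \<open>i\<close> and \<open>j\<close>. This is the
  extra relation of involution words, available at the start of a word.\<close>

lemma act_sgen_swap:
  assumes "\<bar>i - j\<bar> = 1"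
  shows "act (sgen i) j = act (sgen j) i"
  using demazure_braid[OF assms] by (simp add: act_def)

section \<open>Which primes survive commutations and braids\<close>

lemma commutes_1 [simp]: "commutes i 1"
  by (simp add: commutes_def)

lemma not_commutes_sgen:
  assumes "\<bar>i - j\<bar> = 1"
  shows "\<not> commutes j (sgen i)"
proof
  assume "commutes j (sgen i)"
  then have "Perm.apply (sgen j * sgen i) i = Perm.apply (sgen i * sgen j) i"
    by (simp add: commutes_def)
  moreover have "j = i + 1 \<or> i = j + 1" using assms by linarith
  ultimately show False
    by (auto simp: apply_times apply_sgen)
qed

lemma commutes_sgen:
  assumes "2 \<le> \<bar>i - j\<bar>"
  shows "commutes j (sgen i)"
  using sgen_commute[OF assms] by (simp add: commutes_def)

text \<open>Each form of \<open>act y j\<close> in \<open>act_eq\<close> arises from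
  \<open>y\<close> by multiplication with \<open>sgen j\<close>, which commutes with
  \<open>sgen i\<close> and cancels. Hence a prime can travel with its letter past a distant
  one.\<close>

lemma commutes_act:
  assumes "2 \<le> \<bar>i - j\<bar>" "inverse y = y"
  shows "commutes i (act y j) \<longleftrightarrow> commutes i y"
proof -
  note c = sgen_commute[OF assms(1)]
  have ss: "sgen j * (sgen j * x) = x" "x * sgen j * sgen j = x" for x
    by (simp flip: mult.assoc, simp add: mult.assoc)
  have cl: "sgen j * x = sgen j * x' \<longleftrightarrow> x = x'" and cr: "x * sgen j = x' * sgen j \<longleftrightarrow> x = x'" for x x'
    by (metis ss(1), metis ss(2))
  have l: "sgen i * (sgen j * x) = sgen j * (sgen i * x)" and r: "x * sgen j * sgen i = x * sgen i * sgen j" for x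
    by (simp add: c flip: mult.assoc, simp add: c mult.assoc)
  define Q where "Q w \<longleftrightarrow> (sgen i * w = w * sgen i \<longleftrightarrow> sgen i * y = y * sgen i)" for w
  have "Q (sgen j * y)"
    unfolding Q_def by (simp add: l cl mult.assoc)
  moreover have "Q (sgen j * y * sgen j)"
  proof -
    have 1: "sgen i * (sgen j * y * sgen j) = sgen j * (sgen i * y * sgen j)"
      by (simp add: l mult.assoc)
    have 2: "sgen j * y * sgen j * sgen i = sgen j * (y * sgen i * sgen j)"
      unfolding r by (simp add: mult.assoc)
    show ?thesis unfolding Q_def 1 2 cl cr ..
  qed
  moreover have "Q y" by (simp add: Q_def)
  ultimately have "Q (act y j)"
    by (simp add: act_eq[OF assms(2)])
  then show ?thesis by (simp add: Q_def commutes_def)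
qed

lemma apply_act_fixed:
  assumes "inverse y = y" "\<not> desc y i" "Perm.apply y i = i" "Perm.apply y (i + 1) = i + 1"
  shows "Perm.apply (act y i) x = Perm.apply (sgen i) (Perm.apply y x)"
  using assms by (simp add: act_eq commutes_iff apply_times)

lemma apply_act_not_fixed:
  assumes "inverse y = y" "\<not> desc y i" "\<not> (Perm.apply y i = i \<and> Perm.apply y (i + 1) = i + 1)"
  shows "Perm.apply (act y i) x = Perm.apply (sgen i) (Perm.apply y (Perm.apply (sgen i) x))"
proof -
  have "\<not> commutes i y" using assms(2,3) commutes_iff by blast
  with assms(1,2) show ?thesis by (simp add: act_eq apply_times)
qed

lemma apply_act:
  assumes "inverse y = y" "\<not> desc y i"
  shows "Perm.apply (act y i) x = (if Perm.apply y i = i \<and> Perm.apply y (i + 1) = i + 1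
      then Perm.apply (sgen i) (Perm.apply y x)
      else Perm.apply (sgen i) (Perm.apply y (Perm.apply (sgen i) x)))"
  using apply_act_fixed[OF assms] apply_act_not_fixed[OF assms] by simp

text \<open>By \<open>commutes_iff\<close>, commuting would make \<open>act y i\<close> fix
  \<open>j\<close> and \<open>j + 1\<close>. If \<open>y\<close> fixes \<open>i\<close> and
  \<open>i + 1\<close>, then \<open>act y i\<close> exchanges them, and one of them is
  \<open>j\<close> or \<open>j + 1\<close>. Otherwise the ascents of \<open>y\<close> force it to
  fix all three points, against the case. Hence the middle letter of a braid carries no
  prime.\<close>

lemma not_commutes_act:
  assumes "\<bar>i - j\<bar> = 1" "inverse y = y"
    and "\<not> desc y i" "\<not> desc (act y i) j" "\<not> desc y j"
  shows "\<not> commutes j (act y i)"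
proof -
  define f where "f = Perm.apply y"
  have inj: "f u = f v \<longleftrightarrow> u = v" for u v by (simp add: f_def apply_inj)
  note ai = apply_act[OF assms(2,3), folded f_def]
  have "j = i + 1 \<or> i = j + 1" using assms(1) by linarith
  then show ?thesis
  proof
    assume j: "j = i + 1"
    show ?thesis
      using assms(3,5) unfolding commutes_iff[OF assms(4)] ai unfolding desc_def f_def[symmetric] unfolding j
      using inj[of i "i + 1"] inj[of i "i + 2"] inj[of "i + 1" "i + 2"]
      by (auto simp: apply_sgen ac_simps split: if_splits)
  next
    assume i: "i = j + 1"
    show ?thesis
      using assms(3,5) unfolding commutes_iff[OF assms(4)] ai unfolding desc_def f_def[symmetric] unfolding i
      using inj[of j "j + 1"] inj[of j "j + 2"] inj[of "j + 1" "j + 2"]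
      by (auto simp: apply_sgen ac_simps split: if_splits)
  qed
qed

text \<open>In general \<open>act (act y j) i\<close> is the conjugate of \<open>y\<close> by
  \<open>sgen i * sgen j\<close>, which carries \<open>i, i + 1\<close> to \<open>j, j + 1\<close>.
  If \<open>y\<close> fixes \<open>j\<close> and \<open>j + 1\<close>, both sides fail: on the left
  \<open>y\<close> would fix all three points, and then \<open>i j i\<close> would meet a descent.
  So the prime of the first letter of a braid becomes that of the last, and conversely.\<close>

lemma braid_commutes_iff:
  assumes "\<bar>i - j\<bar> = 1" "inverse y = y"
    and "\<not> desc y i" "\<not> desc (act y i) j" "\<not> desc (act (act y i) j) i"
    and "\<not> desc y j" "\<not> desc (act y j) i" "\<not> desc (act (act y j) i) j"
  shows "commutes i y \<longleftrightarrow> commutes j (act (act y j) i)"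
proof -
  define f where "f = Perm.apply y"
  have inj: "f u = f v \<longleftrightarrow> u = v" for u v by (simp add: f_def apply_inj)
  note ai = apply_act[OF assms(2,3), folded f_def]
  note aj = apply_act[OF assms(2,6), folded f_def]
  note inv = inverse_act[OF assms(2)]
  have "\<not> commutes j (act y i)" "\<not> commutes i (act y j)"
    using not_commutes_act assms by simp_all
  then have aij: "Perm.apply (act (act y i) j) x = Perm.apply (sgen j) (Perm.apply (act y i) (Perm.apply (sgen j) x))"
    and aji: "Perm.apply (act (act y j) i) x = Perm.apply (sgen i) (Perm.apply (act y j) (Perm.apply (sgen i) x))" for x
    using apply_act_not_fixed[OF inv] commutes_iff assms by metis+
  have "j = i + 1 \<or> i = j + 1" using assms(1) by linarith
  then show ?thesis
  proof
    assume j: "j = i + 1"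
    show ?thesis
      using assms(3,5,6,7) unfolding commutes_iff[OF assms(3)] commutes_iff[OF assms(8)] desc_def aij aji ai aj
      unfolding f_def[symmetric] unfolding j
      using inj[of i "i + 1"] inj[of i "i + 2"] inj[of "i + 1" "i + 2"]
      by (simp add: apply_sgen ac_simps split: if_splits; fastforce)
  next
    assume i: "i = j + 1"
    show ?thesis
      using assms(3,5,6,7) unfolding commutes_iff[OF assms(3)] commutes_iff[OF assms(8)] desc_def aij aji ai aj
      unfolding f_def[symmetric] unfolding i
      using inj[of j "j + 1"] inj[of j "j + 2"] inj[of "j + 1" "j + 2"]
      by (simp add: apply_sgen ac_simps split: if_splits; fastforce)
  qed
qed

section \<open>Primed involution words\<close>

text \<open>Integers and primes move separately in a braid; this puts the prime status of one letter
  on the value of another.\<close>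

definition like :: "rat \<Rightarrow> int \<Rightarrow> rat" where
  "like x i = (if x \<in> \<int> then of_int i else primed i)"

lemma ceiling_primed [simp]: "\<lceil>primed i\<rceil> = i"
  unfolding primed_def by (rule ceiling_unique) auto

lemma primed_notin_Ints [simp]: "primed i \<notin> \<int>"
proof
  assume "primed i \<in> \<int>"
  then obtain k where k: "primed i = of_int k" by (auto elim: Ints_cases)
  then have "i = k" using ceiling_primed[of i] by simp
  with k show False by (simp add: primed_def)
qed

lemma half_ints_iff: "x \<in> half_ints \<longleftrightarrow> x \<in> \<int> \<or> x = primed \<lceil>x\<rceil>"
  by (auto simp: half_ints_def)

lemma ceiling_like [simp]: "\<lceil>like x i\<rceil> = i"
  by (simp add: like_def)

lemma like_in_Ints [simp]: "like x i \<in> \<int> \<longleftrightarrow> x \<in> \<int>"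
  by (simp add: like_def)

lemma like_half_ints [simp]: "like x i \<in> half_ints"
  by (simp add: half_ints_iff) (simp add: like_def)

lemma of_int_half_ints [simp]: "of_int i \<in> half_ints"
  by (simp add: half_ints_def)

lemma Ints_eq_of_int_ceiling: "(x :: rat) \<in> \<int> \<Longrightarrow> of_int \<lceil>x\<rceil> = x"
  by (auto elim: Ints_cases)

lemma like_ceiling: "x \<in> half_ints \<Longrightarrow> like x \<lceil>x\<rceil> = x"
  by (auto simp: half_ints_iff like_def Ints_eq_of_int_ceiling)

lemma like_cong: "(x \<in> \<int> \<longleftrightarrow> y \<in> \<int>) \<Longrightarrow> like x = like y"
  by (simp add: like_def fun_eq_iff)

text \<open>The condition on primes relative to an arbitrary starting element, so that a word can be
  cut and its pieces replaced.\<close>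

primrec flagged :: "int perm \<Rightarrow> rat list \<Rightarrow> bool" where
  "flagged y [] \<longleftrightarrow> True"
| "flagged y (x # a) \<longleftrightarrow> x \<in> half_ints \<and> (x \<notin> \<int> \<longrightarrow> commutes \<lceil>x\<rceil> y) \<and> flagged (act y \<lceil>x\<rceil>) a"

abbreviation ceilings :: "rat list \<Rightarrow> int list" where
  "ceilings \<equiv> map ceiling"

lemma inv_product_foldl: "inv_product a = foldl act 1 a"
  by (simp add: inv_product_def act_def[abs_def])

lemma inv_product_append: "inv_product (a @ b) = foldl act (inv_product a) b"
  by (simp add: inv_product_foldl)

lemma inverse_foldl_act: "inverse y = y \<Longrightarrow> inverse (foldl act y a) = foldl act y a"
  by (induction a arbitrary: y) (simp_all add: inverse_act)

lemma inverse_inv_product: "inverse (inv_product a) = inv_product a"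
  by (simp add: inv_product_foldl inverse_foldl_act)

lemma flagged_append: "flagged y (a @ b) \<longleftrightarrow> flagged y a \<and> flagged (foldl act y (ceilings a)) b"
  by (induction a arbitrary: y) auto

lemma flagged_iff_nth:
  "flagged y a \<longleftrightarrow> set a \<subseteq> half_ints \<and>
     (\<forall>i<length a. a ! i \<notin> \<int> \<longrightarrow> commutes \<lceil>a ! i\<rceil> (foldl act y (ceilings (take i a))))"
proof (induction a arbitrary: y)
  case (Cons x a)
  show ?case unfolding flagged.simps Cons.IH by (auto simp: All_less_Suc2)
qed simp

text \<open>The set of primed positions can be read off a primed word, so choosing a word and a
  subset of its commutations amounts to one condition on each primed letter.\<close>

lemma R_inv_plus_iff: "a \<in> R_inv_plus z \<longleftrightarrow> flagged 1 a \<and> ceilings a \<in> R_inv z"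
proof
  assume "a \<in> R_inv_plus z"
  then obtain S b where b: "a = prime_at S b" "b \<in> R_inv z" "S \<subseteq> commutations b"
    by (auto simp: R_inv_plus_def)
  have c: "ceilings a = b"
    by (rule nth_equalityI) (auto simp: b(1) prime_at_def)
  have "commutes \<lceil>a ! i\<rceil> (foldl act 1 (ceilings (take i a)))" if "i < length a" "a ! i \<notin> \<int>" for i
  proof -
    have "i \<in> S" "i < length b" using that by (auto simp: b(1) prime_at_def split: if_splits)
    with b(3) have "commutes (b ! i) (inv_product (take i b))"
      by (auto simp: commutations_def commutes_def)
    then show ?thesis using c that(1) by (auto simp: inv_product_foldl take_map)
  qed
  moreover have "set a \<subseteq> half_ints"
    by (auto simp: b(1) prime_at_def half_ints_def)
  ultimately show "flagged 1 a \<and> ceilings a \<in> R_inv z"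
    using b(2) by (simp add: flagged_iff_nth c)
next
  assume a: "flagged 1 a \<and> ceilings a \<in> R_inv z"
  define S where "S = {i. i < length a \<and> a ! i \<notin> \<int>}"
  have "a = prime_at S (ceilings a)"
  proof (rule nth_equalityI)
    fix i assume i: "i < length a"
    then have "a ! i \<in> half_ints" using a by (auto simp: flagged_iff_nth)
    with i show "a ! i = prime_at S (ceilings a) ! i"
      by (auto simp: prime_at_def S_def half_ints_iff Ints_eq_of_int_ceiling)
  qed (simp add: prime_at_def)
  moreover have "S \<subseteq> commutations (ceilings a)"
    using a by (auto simp: S_def commutations_def flagged_iff_nth commutes_def inv_product_foldl take_map)
  ultimately show "a \<in> R_inv_plus z" using a by (auto simp: R_inv_plus_def)
qed

lemma R_inv_eqI:
  assumes "a \<in> R_inv z" "inv_product b = inv_product a" "length b = length a"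
  shows "b \<in> R_inv z"
  using assms by (auto simp: R_inv_def)

text \<open>A letter at a descent acts trivially, so deleting it would shorten the word.\<close>

lemma R_inv_not_desc:
  assumes "u @ x # v \<in> R_inv z"
  shows "\<not> desc (inv_product u) x"
proof
  assume "desc (inv_product u) x"
  then have "inv_product (u @ v) = inv_product (u @ x # v)"
    by (simp add: inv_product_append act_eq inverse_inv_product)
  then show False using assms by (fastforce simp: R_inv_def)
qed

lemma R_inv_plus_not_desc:
  "u @ x # v \<in> R_inv_plus z \<Longrightarrow> \<not> desc (inv_product (ceilings u)) \<lceil>x\<rceil>"
  by (rule R_inv_not_desc[of _ _ "ceilings v" z]) (simp add: R_inv_plus_iff)

text \<open>All that the insertion algorithm uses about the set of primed involution words of a fixed
  involution.\<close>

locale word_class =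
  fixes W :: "rat list set"
  assumes half_intsD: "a \<in> W \<Longrightarrow> set a \<subseteq> half_ints"
    and comm: "u @ x # y # v \<in> W \<Longrightarrow> 2 \<le> \<bar>\<lceil>x\<rceil> - \<lceil>y\<rceil>\<bar> \<Longrightarrow> u @ y # x # v \<in> W"
    and braid_middle: "u @ x # y # x' # v \<in> W \<Longrightarrow> \<lceil>x'\<rceil> = \<lceil>x\<rceil> \<Longrightarrow> \<bar>\<lceil>x\<rceil> - \<lceil>y\<rceil>\<bar> = 1 \<Longrightarrow> y \<in> \<int>"
    and braid: "u @ x # y # x' # v \<in> W \<Longrightarrow> \<lceil>x'\<rceil> = \<lceil>x\<rceil> \<Longrightarrow> \<bar>\<lceil>x\<rceil> - \<lceil>y\<rceil>\<bar> = 1 \<Longrightarrow>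
      u @ like x' \<lceil>y\<rceil> # of_int \<lceil>x\<rceil> # like x \<lceil>y\<rceil> # v \<in> W"
    and no_repeat: "\<lceil>x\<rceil> = \<lceil>y\<rceil> \<Longrightarrow> u @ x # y # v \<notin> W"
    and swap_first: "x # y # v \<in> W \<Longrightarrow> x \<in> \<int> \<Longrightarrow> of_int \<lceil>y\<rceil> # like y \<lceil>x\<rceil> # v \<in> W"
    and toggle_first: "x # v \<in> W \<Longrightarrow> x' \<in> half_ints \<Longrightarrow> \<lceil>x'\<rceil> = \<lceil>x\<rceil> \<Longrightarrow> x' # v \<in> W"
    and second_unprimed: "x # y # v \<in> W \<Longrightarrow> \<bar>\<lceil>x\<rceil> - \<lceil>y\<rceil>\<bar> = 1 \<Longrightarrow> y \<in> \<int>"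

lemma word_class_R_inv_plus: "word_class (R_inv_plus z)"
proof
  fix a assume "a \<in> R_inv_plus z"
  then show "set a \<subseteq> half_ints" by (simp add: R_inv_plus_iff flagged_iff_nth)
next
  fix u x y v assume a: "u @ x # y # v \<in> R_inv_plus z" and xy: "2 \<le> \<bar>\<lceil>x\<rceil> - \<lceil>y\<rceil>\<bar>"
  have "2 \<le> \<bar>\<lceil>y\<rceil> - \<lceil>x\<rceil>\<bar>" using xy by linarith
  with xy a show "u @ y # x # v \<in> R_inv_plus z"
    by (auto simp: R_inv_plus_iff flagged_append commutes_act act_commute inverse_foldl_act
        inv_product_foldl elim!: R_inv_eqI)
next
  fix u x y x' v
  assume a: "u @ x # y # x' # v \<in> R_inv_plus z" and x: "\<lceil>x'\<rceil> = \<lceil>x\<rceil>" and xy: "\<bar>\<lceil>x\<rceil> - \<lceil>y\<rceil>\<bar> = 1"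
  define w where "w = inv_product (ceilings u)"
  have w: "inverse w = w" by (simp add: w_def inverse_inv_product)
  have yx: "\<bar>\<lceil>y\<rceil> - \<lceil>x\<rceil>\<bar> = 1" using xy by linarith
  \<comment> \<open>The other side of the braid has the same length and product. It is therefore
    reduced too and yields the three further ascents that \<open>braid_commutes_iff\<close> asks
    for.\<close>
  have b: "ceilings u @ \<lceil>y\<rceil> # \<lceil>x\<rceil> # \<lceil>y\<rceil> # ceilings v \<in> R_inv z"
    using a x act_braid[OF xy]
    by (auto simp: R_inv_plus_iff inv_product_foldl elim!: R_inv_eqI)
  have nd: "\<not> desc w \<lceil>x\<rceil>" "\<not> desc (act w \<lceil>x\<rceil>) \<lceil>y\<rceil>" "\<not> desc (act (act w \<lceil>x\<rceil>) \<lceil>y\<rceil>) \<lceil>x\<rceil>"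
    using R_inv_plus_not_desc[of u x "y # x' # v" z] R_inv_plus_not_desc[of "u @ [x]" y "x' # v" z]
      R_inv_plus_not_desc[of "u @ [x, y]" x' v z] a x
    by (simp_all add: w_def inv_product_append)
  have nd': "\<not> desc w \<lceil>y\<rceil>" "\<not> desc (act w \<lceil>y\<rceil>) \<lceil>x\<rceil>" "\<not> desc (act (act w \<lceil>y\<rceil>) \<lceil>x\<rceil>) \<lceil>y\<rceil>"
    using R_inv_not_desc[of "ceilings u" "\<lceil>y\<rceil>" "\<lceil>x\<rceil> # \<lceil>y\<rceil> # ceilings v" z]
      R_inv_not_desc[of "ceilings u @ [\<lceil>y\<rceil>]" "\<lceil>x\<rceil>" "\<lceil>y\<rceil> # ceilings v" z]
      R_inv_not_desc[of "ceilings u @ [\<lceil>y\<rceil>, \<lceil>x\<rceil>]" "\<lceil>y\<rceil>" "ceilings v" z] b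
    by (simp_all add: w_def inv_product_append)
  have f: "flagged w (x # y # x' # v)" "flagged 1 u"
    using a by (simp_all add: R_inv_plus_iff flagged_append w_def inv_product_foldl)
  with not_commutes_act[OF xy w nd(1,2) nd'(1)] show y: "y \<in> \<int>" by auto
  show "u @ like x' \<lceil>y\<rceil> # of_int \<lceil>x\<rceil> # like x \<lceil>y\<rceil> # v \<in> R_inv_plus z"
    using b f act_braid[OF xy, of w] x
      braid_commutes_iff[OF xy w nd nd'] braid_commutes_iff[OF yx w nd' nd]
    by (simp add: R_inv_plus_iff flagged_append w_def inv_product_foldl)
next
  fix u v and x y :: rat assume x: "\<lceil>x\<rceil> = \<lceil>y\<rceil>"
  show "u @ x # y # v \<notin> R_inv_plus z"
  proof
    assume "u @ x # y # v \<in> R_inv_plus z"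
    then have "ceilings u @ \<lceil>x\<rceil> # \<lceil>x\<rceil> # ceilings v \<in> R_inv z" using x by (simp add: R_inv_plus_iff)
    moreover have "inv_product (ceilings u @ \<lceil>x\<rceil> # \<lceil>x\<rceil> # ceilings v) = inv_product (ceilings u @ \<lceil>x\<rceil> # ceilings v)"
      by (simp add: inv_product_append)
    ultimately show False by (fastforce simp: R_inv_def)
  qed
next
  fix x y v assume a: "x # y # v \<in> R_inv_plus z" and x: "x \<in> \<int>"
  \<comment> \<open>Of two equal first letters one could be dropped, since
    \<open>act 1 i = sgen i\<close> and acting twice with \<open>i\<close> changes nothing
    more.\<close>
  have ne: "\<lceil>x\<rceil> \<noteq> \<lceil>y\<rceil>"
  proof
    assume "\<lceil>x\<rceil> = \<lceil>y\<rceil>"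
    then have "inv_product (ceilings (x # v)) = inv_product (ceilings (x # y # v))"
      by (simp add: inv_product_foldl flip: act_1)
    then show False using a by (fastforce simp: R_inv_plus_iff R_inv_def)
  qed
  \<comment> \<open>If the letters are adjacent, the second is unprimed, as it does not commute with
    the first. If they are distant, the second position remains a commutation after the exchange, so
    the prime stays in that position.\<close>
  show "of_int \<lceil>y\<rceil> # like y \<lceil>x\<rceil> # v \<in> R_inv_plus z"
  proof (cases "\<bar>\<lceil>x\<rceil> - \<lceil>y\<rceil>\<bar> = 1")
    case True
    with a not_commutes_sgen[OF True] show ?thesis
      by (auto simp: R_inv_plus_iff act_sgen_swap like_def inv_product_foldl elim!: R_inv_eqI)
  next
    case False
    with ne have far: "2 \<le> \<bar>\<lceil>x\<rceil> - \<lceil>y\<rceil>\<bar>" "2 \<le> \<bar>\<lceil>y\<rceil> - \<lceil>x\<rceil>\<bar>" by linarith+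
    with a act_commute[OF far(1), of 1] show ?thesis
      by (auto simp: R_inv_plus_iff commutes_sgen inv_product_foldl elim!: R_inv_eqI)
  qed
next
  fix x v x' assume "x # v \<in> R_inv_plus z" "x' \<in> half_ints" "\<lceil>x'\<rceil> = \<lceil>x\<rceil>"
  then show "x' # v \<in> R_inv_plus z" by (simp add: R_inv_plus_iff)
next
  fix x y v assume "x # y # v \<in> R_inv_plus z" "\<bar>\<lceil>x\<rceil> - \<lceil>y\<rceil>\<bar> = 1"
  then show "y \<in> \<int>" using not_commutes_sgen by (auto simp: R_inv_plus_iff)
qed

text \<open>A shorter word for the prefix could be prolonged by \<open>u\<close> to a shorter word
  for \<open>z\<close>.\<close>

lemma R_inv_plus_butlast:
  assumes "a @ [u] \<in> R_inv_plus z"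
  shows "a \<in> R_inv_plus (inv_product (ceilings a))"
proof -
  have "length (ceilings a) \<le> length b" if "inv_product b = inv_product (ceilings a)" for b
  proof -
    have "inv_product (b @ [\<lceil>u\<rceil>]) = z"
      using assms that by (simp add: R_inv_plus_iff R_inv_def inv_product_append)
    then show ?thesis using assms by (fastforce simp: R_inv_plus_iff R_inv_def)
  qed
  with assms show ?thesis by (auto simp: R_inv_plus_iff R_inv_def flagged_append)
qed

text \<open>Whether \<open>u\<close> may follow depends only on the product and the length of the
  letters before it. This is how an inserted word gets replaced by the row word of its
  tableau.\<close>

lemma R_inv_plus_snoc_cong:
  assumes "a \<in> R_inv_plus z'" "b \<in> R_inv_plus z'" "a @ [u] \<in> R_inv_plus z"
  shows "b @ [u] \<in> R_inv_plus z"
proof -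
  have *: "foldl act 1 (ceilings a) = foldl act 1 (ceilings b)" "length a = length b"
    using assms(1,2) by (auto simp: R_inv_plus_iff R_inv_def simp flip: inv_product_foldl intro!: antisym)
  show ?thesis
    using assms(2,3) * by (auto simp: R_inv_plus_iff flagged_append inv_product_foldl elim!: R_inv_eqI)
qed

section \<open>Commutations and braids inside a word\<close>

context word_class
begin

lemma comm_iff: "2 \<le> \<bar>\<lceil>x\<rceil> - \<lceil>y\<rceil>\<bar> \<Longrightarrow> u @ x # y # v \<in> W \<longleftrightarrow> u @ y # x # v \<in> W"
  using comm[of u x y v] comm[of u y x v] by (auto simp: abs_minus_commute)

lemma move_right:
  assumes "\<forall>y \<in> set ys. 2 \<le> \<bar>\<lceil>x\<rceil> - \<lceil>y\<rceil>\<bar>"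
  shows "u @ x # ys @ v \<in> W \<longleftrightarrow> u @ ys @ x # v \<in> W"
  using assms
proof (induction ys arbitrary: u)
  case (Cons y ys)
  then show ?case using comm_iff[of x y u "ys @ v"] Cons.IH[of "u @ [y]"] by simp
qed simp

text \<open>Insertion sort: the head of \<open>xs\<close> is found in \<open>ys\<close> and moved to
  the front past letters that \<open>xs\<close> puts after it. Only pairs on which the two orders
  disagree are ever exchanged, so only those have to be far apart.\<close>

lemma rearrange:
  assumes "sorted_wrt P xs" "sorted_wrt Q ys" "distinct xs" "distinct ys" "set xs = set ys"
    and "\<And>a b. a \<in> set xs \<Longrightarrow> b \<in> set xs \<Longrightarrow> P a b \<Longrightarrow> Q b a \<Longrightarrow> 2 \<le> \<bar>\<lceil>f a\<rceil> - \<lceil>f b\<rceil>\<bar>"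
  shows "u @ map f xs @ v \<in> W \<longleftrightarrow> u @ map f ys @ v \<in> W"
  using assms
proof (induction xs arbitrary: u ys)
  case (Cons x xs)
  then have "x \<in> set ys" by auto
  then obtain a b where ys: "ys = a @ x # b" by (auto simp: in_set_conv_decomp)
  have "set xs = set (a @ b)" using Cons.prems(3,4,5) unfolding ys by auto
  have "2 \<le> \<bar>\<lceil>f x\<rceil> - \<lceil>y\<rceil>\<bar>" if y: "y \<in> set (map f a)" for y
  proof -
    obtain c where c: "c \<in> set a" "y = f c" using y by auto
    with \<open>set xs = set (a @ b)\<close> have "c \<in> set xs" by auto
    with c Cons.prems(1,2,6) show ?thesis by (auto simp: ys sorted_wrt_append)
  qed
  then have "u @ map f a @ f x # map f b @ v \<in> W \<longleftrightarrow> u @ f x # map f a @ map f b @ v \<in> W"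
    by (subst move_right) auto
  moreover have "(u @ [f x]) @ map f xs @ v \<in> W \<longleftrightarrow> (u @ [f x]) @ map f (a @ b) @ v \<in> W"
    using Cons.prems \<open>set xs = set (a @ b)\<close>
    by (intro Cons.IH) (auto simp: ys sorted_wrt_append)
  ultimately show ?case by (simp add: ys)
qed simp

text \<open>If all letters in between were at distance two or more, commutations would make the
  equal letters adjacent.\<close>

lemma repeat_gap:
  assumes "u @ x # q @ y # v \<in> W" "\<lceil>x\<rceil> = \<lceil>y\<rceil>"
  shows "\<exists>z \<in> set q. \<bar>\<lceil>z\<rceil> - \<lceil>x\<rceil>\<bar> \<le> 1"
proof (rule ccontr)
  assume "\<not> ?thesis"
  then have "\<forall>z \<in> set q. 2 \<le> \<bar>\<lceil>x\<rceil> - \<lceil>z\<rceil>\<bar>" by force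
  then have "u @ q @ x # y # v \<in> W" using assms(1) move_right by simp
  then show False using no_repeat[of x y "u @ q" v] assms(2) by simp
qed

text \<open>Since \<open>m\<close> lies strictly between, the letters of \<open>q\<close> exceed
  \<open>w\<close> by at least two; since \<open>w\<close> lies strictly between, \<open>m\<close>
  exceeds those of \<open>p\<close> by at least two. Commutations therefore suffice.\<close>

lemma row_bump:
  assumes "\<forall>x \<in> set p. \<lceil>x\<rceil> < \<lceil>w\<rceil>" "\<lceil>w\<rceil> < \<lceil>m\<rceil>" "\<forall>x \<in> set q. \<lceil>m\<rceil> < \<lceil>x\<rceil>"
  shows "A @ p @ m # q @ w # B \<in> W \<longleftrightarrow> A @ m # p @ w # q @ B \<in> W"
proof -
  have "A @ p @ m # q @ w # B \<in> W \<longleftrightarrow> A @ p @ m # w # q @ B \<in> W"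
    using move_right[of q w "A @ p @ [m]" B] assms by fastforce
  also have "\<dots> \<longleftrightarrow> A @ m # p @ w # q @ B \<in> W"
    using move_right[of p m A "w # q @ B"] assms by fastforce
  finally show ?thesis .
qed

lemma column_bump:
  assumes "\<forall>x \<in> set p. \<lceil>x\<rceil> < \<lceil>w\<rceil>" "\<lceil>w\<rceil> < \<lceil>m\<rceil>" "\<forall>x \<in> set q. \<lceil>m\<rceil> < \<lceil>x\<rceil>"
  shows "A @ w # q @ m # p @ B \<in> W \<longleftrightarrow> A @ q @ w # p @ m # B \<in> W"
proof -
  have "A @ w # q @ m # p @ B \<in> W \<longleftrightarrow> A @ q @ w # m # p @ B \<in> W"
    using move_right[of q w A "m # p @ B"] assms by fastforce
  also have "\<dots> \<longleftrightarrow> A @ q @ w # p @ m # B \<in> W"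
    using move_right[of p m "A @ q @ [w]" B] assms by fastforce
  finally show ?thesis .
qed

text \<open>Once \<open>w\<close> is moved next to \<open>M\<close>, the braid turns
  \<open>m M w\<close> into \<open>M m M\<close>. Middle letters are unprimed and outer primes trade
  places, so \<open>m\<close> hands its prime to \<open>M\<close> while the letter passed on keeps
  that of \<open>w\<close>: this is the origin of the switching rule.\<close>

lemma row_pair:
  assumes "\<forall>x \<in> set p. \<lceil>x\<rceil> < \<lceil>m\<rceil>" "\<lceil>w\<rceil> = \<lceil>m\<rceil>" "\<lceil>M\<rceil> = \<lceil>m\<rceil> + 1" "\<forall>x \<in> set q. \<lceil>M\<rceil> < \<lceil>x\<rceil>"
    and "A @ p @ m # M # q @ w # B \<in> W"
  shows "M \<in> \<int>" "A @ like w \<lceil>M\<rceil> # p @ of_int \<lceil>m\<rceil> # like m \<lceil>M\<rceil> # q @ B \<in> W"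
proof -
  have *: "(A @ p) @ m # M # w # q @ B \<in> W"
    using move_right[of q w "A @ p @ [m, M]" B] assms by fastforce
  from braid_middle[OF *] assms(2,3) show "M \<in> \<int>" by simp
  from braid[OF *] assms(2,3) have "A @ p @ like w \<lceil>M\<rceil> # of_int \<lceil>m\<rceil> # like m \<lceil>M\<rceil> # q @ B \<in> W" by simp
  then show "A @ like w \<lceil>M\<rceil> # p @ of_int \<lceil>m\<rceil> # like m \<lceil>M\<rceil> # q @ B \<in> W"
    using assms by (subst move_right) fastforce+
qed

lemma row_pair_reverse:
  assumes "\<forall>x \<in> set p. \<lceil>x\<rceil> < \<lceil>m\<rceil>" "\<lceil>v\<rceil> = \<lceil>M\<rceil>" "\<lceil>M\<rceil> = \<lceil>m\<rceil> + 1" "\<forall>x \<in> set q. \<lceil>M\<rceil> < \<lceil>x\<rceil>"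
    and "A @ v # p @ m # M # q @ B \<in> W"
  shows "m \<in> \<int>" "A @ p @ like M \<lceil>m\<rceil> # of_int \<lceil>M\<rceil> # q @ like v \<lceil>m\<rceil> # B \<in> W"
proof -
  have *: "(A @ p) @ v # m # M # q @ B \<in> W"
    using move_right[of p v A "m # M # q @ B"] assms by fastforce
  from braid_middle[OF *] assms(2,3) show "m \<in> \<int>" by simp
  from braid[OF *] assms(2,3) have "(A @ p @ [like M \<lceil>m\<rceil>, of_int \<lceil>M\<rceil>]) @ like v \<lceil>m\<rceil> # q @ B \<in> W" by simp
  then show "A @ p @ like M \<lceil>m\<rceil> # of_int \<lceil>M\<rceil> # q @ like v \<lceil>m\<rceil> # B \<in> W"
    using assms by (subst (asm) move_right) fastforce+
qed

lemma column_pair: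
  assumes "\<forall>x \<in> set p. \<lceil>x\<rceil> < \<lceil>m\<rceil>" "\<lceil>w\<rceil> = \<lceil>m\<rceil>" "\<lceil>M\<rceil> = \<lceil>m\<rceil> + 1" "\<forall>x \<in> set q. \<lceil>M\<rceil> < \<lceil>x\<rceil>"
    and "A @ w # q @ M # m # p @ B \<in> W"
  shows "M \<in> \<int>" "A @ q @ like m \<lceil>M\<rceil> # of_int \<lceil>m\<rceil> # p @ like w \<lceil>M\<rceil> # B \<in> W"
proof -
  have *: "(A @ q) @ w # M # m # p @ B \<in> W"
    using move_right[of q w A "M # m # p @ B"] assms by fastforce
  from braid_middle[OF *] assms(2,3) show "M \<in> \<int>" by simp
  from braid[OF *] assms(2,3) have "(A @ q @ [like m \<lceil>M\<rceil>, of_int \<lceil>m\<rceil>]) @ like w \<lceil>M\<rceil> # p @ B \<in> W" by simp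
  then show "A @ q @ like m \<lceil>M\<rceil> # of_int \<lceil>m\<rceil> # p @ like w \<lceil>M\<rceil> # B \<in> W"
    using assms by (subst (asm) move_right) fastforce+
qed

lemma column_pair_reverse:
  assumes "\<forall>x \<in> set p. \<lceil>x\<rceil> < \<lceil>m\<rceil>" "\<lceil>v\<rceil> = \<lceil>M\<rceil>" "\<lceil>M\<rceil> = \<lceil>m\<rceil> + 1" "\<forall>x \<in> set q. \<lceil>M\<rceil> < \<lceil>x\<rceil>"
    and "A @ q @ M # m # p @ v # B \<in> W"
  shows "m \<in> \<int>" "A @ like v \<lceil>m\<rceil> # q @ of_int \<lceil>M\<rceil> # like M \<lceil>m\<rceil> # p @ B \<in> W"
proof -
  have *: "(A @ q) @ M # m # v # p @ B \<in> W"
    using move_right[of p v "A @ q @ [M, m]" B] assms by fastforce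
  from braid_middle[OF *] assms(2,3) show "m \<in> \<int>" by simp
  from braid[OF *] assms(2,3) have "A @ q @ like v \<lceil>m\<rceil> # of_int \<lceil>M\<rceil> # like M \<lceil>m\<rceil> # p @ B \<in> W" by simp
  then show "A @ like v \<lceil>m\<rceil> # q @ of_int \<lceil>M\<rceil> # like M \<lceil>m\<rceil> # p @ B \<in> W"
    using assms by (subst move_right) fastforce+
qed

lemma swap_first_iff:
  assumes "\<lceil>x'\<rceil> = \<lceil>x\<rceil>" "\<lceil>y'\<rceil> = \<lceil>y\<rceil>" "x \<in> \<int>" "y' \<in> \<int>" "x' = like y \<lceil>x\<rceil>" "y = like x' \<lceil>y\<rceil>"
  shows "x # y # v \<in> W \<longleftrightarrow> y' # x' # v \<in> W"
proof
  assume "x # y # v \<in> W"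
  from swap_first[OF this] assms show "y' # x' # v \<in> W" by (metis Ints_eq_of_int_ceiling)
next
  assume "y' # x' # v \<in> W"
  from swap_first[OF this] assms show "x # y # v \<in> W" by (metis Ints_eq_of_int_ceiling)
qed

end

section \<open>Listings of boxes\<close>

text \<open>Both readings list a finite set of boxes by a strict total order. Such a list is unique,
  so a reading can be split or extended by exhibiting one sorted list.\<close>

locale strict_total_order =
  fixes R :: "'a \<Rightarrow> 'a \<Rightarrow> bool"
  assumes irrefl: "\<not> R x x"
    and trans: "R x y \<Longrightarrow> R y z \<Longrightarrow> R x z"
    and total: "x \<noteq> y \<Longrightarrow> R x y \<or> R y x"
begin

definition listing :: "'a set \<Rightarrow> 'a list" where
  "listing S = (SOME xs. distinct xs \<and> set xs = S \<and> sorted_wrt R xs)"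

lemma listing_props:
  assumes "finite S"
  shows "distinct (listing S) \<and> set (listing S) = S \<and> sorted_wrt R (listing S)"
  unfolding listing_def
proof (rule someI_ex)
  show "\<exists>xs. distinct xs \<and> set xs = S \<and> sorted_wrt R xs"
    using assms
  proof (induction S)
    case (insert x S)
    then obtain xs where xs: "distinct xs" "set xs = S" "sorted_wrt R xs" by blast
    define ys where "ys = filter (\<lambda>y. R y x) xs @ x # filter (R x) xs"
    have "sorted_wrt R ys"
      using xs(3) by (auto simp: ys_def sorted_wrt_append sorted_wrt_filter intro: trans)
    moreover have "set ys = insert x S"
      using total xs(2) insert.hyps(2) by (auto simp: ys_def)
    moreover have "distinct ys"
      using xs insert.hyps(2) trans irrefl by (auto simp: ys_def)
    ultimately show ?case by blast
  qed simp
qed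

lemmas distinct_listing [simp] = listing_props[THEN conjunct1]
  and set_listing [simp] = listing_props[THEN conjunct2, THEN conjunct1]
  and sorted_listing = listing_props[THEN conjunct2, THEN conjunct2]

lemma sorted_wrt_unique:
  assumes "sorted_wrt R xs" "sorted_wrt R ys" "set xs = set ys"
  shows "xs = ys"
  using assms
proof (induction xs arbitrary: ys)
  case (Cons x xs)
  then obtain y zs where ys: "ys = y # zs" by (cases ys) auto
  have "x = y"
    using Cons.prems irrefl trans unfolding ys by (metis insert_iff list.simps(15) sorted_wrt.simps(2))
  moreover have "set xs = set zs"
    using Cons.prems irrefl \<open>x = y\<close> unfolding ys by (metis insert_ident list.simps(15) sorted_wrt.simps(2))
  ultimately show ?case using Cons unfolding ys by auto
qed simp

lemma listing_eqI: "sorted_wrt R xs \<Longrightarrow> set xs = S \<Longrightarrow> listing S = xs"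
  by (rule sorted_wrt_unique) (auto simp: sorted_listing)

lemma listing_empty [simp]: "listing {} = []"
  by (rule listing_eqI) auto

lemma listing_Un:
  assumes "finite A" "finite B" "\<And>a b. a \<in> A \<Longrightarrow> b \<in> B \<Longrightarrow> R a b"
  shows "listing (A \<union> B) = listing A @ listing B"
  by (rule listing_eqI) (use assms in \<open>auto simp: sorted_wrt_append sorted_listing\<close>)

lemma listing_insert_between:
  assumes "finite A" "finite B" "\<And>a. a \<in> A \<Longrightarrow> R a x" "\<And>b. b \<in> B \<Longrightarrow> R x b"
    and "S = A \<union> insert x B"
  shows "listing S = listing A @ x # listing B"
  by (rule listing_eqI) (use assms in \<open>auto simp: sorted_wrt_append sorted_listing intro: trans\<close>)

end

definition row_before :: "box \<Rightarrow> box \<Rightarrow> bool" where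
  "row_before a b \<longleftrightarrow> fst b < fst a \<or> fst a = fst b \<and> snd a < snd b"

definition column_before :: "box \<Rightarrow> box \<Rightarrow> bool" where
  "column_before a b \<longleftrightarrow> snd a < snd b \<or> snd a = snd b \<and> fst b < fst a"

interpretation row: strict_total_order row_before
  by unfold_locales (auto simp: row_before_def prod_eq_iff)

interpretation column: strict_total_order column_before
  by unfold_locales (auto simp: column_before_def prod_eq_iff)

abbreviation "row_boxes \<equiv> row.listing"
abbreviation "column_boxes \<equiv> column.listing"

section \<open>Shifted shapes\<close>

text \<open>The sets \<open>SD lam\<close> without the partition: closure to the left and below
  within \<open>i \<le> j\<close>. Adding and removing a box then becomes an operation on
  sets.\<close>

definition shape :: "box set \<Rightarrow> bool" where
  "shape D \<longleftrightarrow> finite D \<and> (\<forall>i j. (i, j) \<in> D \<longrightarrow> 1 \<le> i \<and> i \<le> j) \<and>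
     (\<forall>i j k l. (i, j) \<in> D \<longrightarrow> 1 \<le> k \<longrightarrow> k \<le> i \<longrightarrow> k \<le> l \<longrightarrow> l \<le> j \<longrightarrow> (k, l) \<in> D)"

lemma shapeD:
  assumes "shape D"
  shows "finite D" "(i, j) \<in> D \<Longrightarrow> 1 \<le> i" "(i, j) \<in> D \<Longrightarrow> i \<le> j"
    "(i, j) \<in> D \<Longrightarrow> 1 \<le> k \<Longrightarrow> k \<le> i \<Longrightarrow> k \<le> l \<Longrightarrow> l \<le> j \<Longrightarrow> (k, l) \<in> D"
  using assms unfolding shape_def by blast+

lemma SD_iff: "(i, j) \<in> SD lam \<longleftrightarrow> 1 \<le> i \<and> i \<le> length lam \<and> i \<le> j \<and> j < i + lam ! (i - 1)"
  by (auto simp: SD_def intro!: exI[of _ "j + 1 - i"])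

text \<open>The loss of at least one box per row compensates for the shift of the rows; this is what
  closes the columns of \<open>SD lam\<close> downwards.\<close>

lemma strict_partition_decrease:
  assumes "strict_partition lam" "k \<le> i" "i < length lam"
  shows "lam ! i + (i - k) \<le> lam ! k"
  using assms(2,3)
proof (induction i rule: dec_induct)
  case (step i)
  then have "lam ! Suc i < lam ! i"
    using assms(1) by (auto simp: strict_partition_def sorted_wrt_iff_nth_less)
  with step show ?case by simp
qed simp

lemma shape_SD:
  assumes "strict_partition lam"
  shows "shape (SD lam)"
proof -
  have "SD lam \<subseteq> {..length lam} \<times> {..length lam + sum_list lam}"
  proof
    fix b assume "b \<in> SD lam"
    then obtain i j where b: "b = (i, j)" "1 \<le> i" "i \<le> length lam" "j < i + lam ! (i - 1)"
      by (cases b) (auto simp: SD_iff)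
    moreover from b have "lam ! (i - 1) \<le> sum_list lam" by (simp add: elem_le_sum_list)
    ultimately show "b \<in> {..length lam} \<times> {..length lam + sum_list lam}" by auto
  qed
  then have "finite (SD lam)" by (rule finite_subset) auto
  moreover have "(k, l) \<in> SD lam" if "(i, j) \<in> SD lam" "1 \<le> k" "k \<le> i" "k \<le> l" "l \<le> j" for i j k l
  proof -
    from that(1) have "i \<le> length lam" "j < i + lam ! (i - 1)" by (simp_all add: SD_iff)
    moreover from this that have "lam ! (i - 1) + (i - 1 - (k - 1)) \<le> lam ! (k - 1)"
      by (intro strict_partition_decrease[OF assms]) auto
    ultimately have "l < k + lam ! (k - 1)" "k \<le> length lam" using that by linarith+
    with that show ?thesis by (simp add: SD_iff)
  qed
  ultimately show ?thesis by (auto simp: shape_def SD_iff)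
qed

lemma shape_lower_set:
  assumes "finite A" "\<And>j. j \<in> A \<Longrightarrow> i \<le> j" "\<And>j l. j \<in> A \<Longrightarrow> i \<le> l \<Longrightarrow> l \<le> j \<Longrightarrow> l \<in> A"
  shows "A = {i..<i + card A}"
proof (cases "A = {}")
  case False
  define m where "m = Max A"
  have "m \<in> A" "\<And>j. j \<in> A \<Longrightarrow> j \<le> m" using assms(1) False by (simp_all add: m_def)
  have "A = {i..m}"
    using assms(2) \<open>\<And>j. j \<in> A \<Longrightarrow> j \<le> m\<close> assms(3)[OF \<open>m \<in> A\<close>]
    unfolding set_eq_iff atLeastAtMost_iff by blast
  then have "card A = m + 1 - i" by simp
  with \<open>A = {i..m}\<close> assms(2)[OF \<open>m \<in> A\<close>] show ?thesis by auto
qed simp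

text \<open>Every nonempty row starts on the diagonal, so the diagonal boxes count the rows.\<close>

lemma ex_strict_partition:
  assumes "shape D"
  shows "\<exists>lam. strict_partition lam \<and> D = SD lam"
proof -
  define k where "k = card {i. (i, i) \<in> D}"
  have diag: "{i. (i, i) \<in> D} = {1..<1 + k}"
  proof -
    have "{i. (i, i) \<in> D} \<subseteq> fst ` D" by force
    then have "finite {i. (i, i) \<in> D}" using shapeD(1)[OF assms] finite_subset by blast
    moreover have "(l, l) \<in> D" if "(j, j) \<in> D" "1 \<le> l" "l \<le> j" for j l
      using shapeD(4)[OF assms that] that by simp
    ultimately show ?thesis unfolding k_def
      by (intro shape_lower_set) (auto dest: shapeD(2)[OF assms])
  qed
  define f where "f i = card {j. (i, j) \<in> D}" for i
  have row: "{j. (i, j) \<in> D} = {i..<i + f i}" if "1 \<le> i" for i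
  proof -
    have "{j. (i, j) \<in> D} \<subseteq> snd ` D" by force
    then have "finite {j. (i, j) \<in> D}" using shapeD(1)[OF assms] finite_subset by blast
    moreover have "(i, l) \<in> D" if "(i, j) \<in> D" "i \<le> l" "l \<le> j" for j l
      using shapeD(4)[OF assms that(1) \<open>1 \<le> i\<close> order.refl that(2,3)] .
    ultimately show ?thesis unfolding f_def
      by (intro shape_lower_set) (auto dest: shapeD(3)[OF assms])
  qed
  define lam where "lam = map f [1..<1 + k]"
  have diag': "(l, l) \<in> D \<longleftrightarrow> 1 \<le> l \<and> l \<le> k" for l
    using arg_cong[OF diag, of "\<lambda>S. l \<in> S"] by auto
  have row': "(i, j) \<in> D \<longleftrightarrow> i \<le> j \<and> j < i + f i" if "1 \<le> i" for i j
    using arg_cong[OF row[OF that], of "\<lambda>S. j \<in> S"] by simp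
  have D: "(i, j) \<in> D \<longleftrightarrow> 1 \<le> i \<and> i \<le> k \<and> i \<le> j \<and> j < i + f i" for i j
  proof
    assume ij: "(i, j) \<in> D"
    then have "1 \<le> i" "i \<le> j" using shapeD[OF assms] by blast+
    moreover from this ij have "(i, i) \<in> D" using shapeD(4)[OF assms ij] by simp
    ultimately show "1 \<le> i \<and> i \<le> k \<and> i \<le> j \<and> j < i + f i"
      using ij row'[of i j] diag'[of i] by simp
  next
    assume "1 \<le> i \<and> i \<le> k \<and> i \<le> j \<and> j < i + f i"
    then show "(i, j) \<in> D" using row'[of i j] by simp
  qed
  have "D = SD lam"
  proof (rule set_eqI)
    fix b show "b \<in> D \<longleftrightarrow> b \<in> SD lam"
      by (cases b) (auto simp: D SD_iff lam_def simp del: upt_Suc)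
  qed
  moreover have "strict_partition lam"
  proof -
    have pos: "0 < f i" if "1 \<le> i" "i \<le> k" for i
    proof -
      have "(i, i) \<in> D" using diag' that by blast
      then show ?thesis using D[of i i] by simp
    qed
    have dec: "f l < f i" if "1 \<le> i" "i < l" "l \<le> k" for i l
    proof -
      \<comment> \<open>The last box of row \<open>l\<close> has boxes of all lower rows beneath it,
        so row \<open>i\<close> reaches at least as far to the right although it starts further
        left.\<close>
      have "(l, l + f l - 1) \<in> D" using D[of l "l + f l - 1"] pos[of l] that by simp
      then have "(i, l + f l - 1) \<in> D" using shapeD(4)[OF assms] that by simp
      then have "l + f l - 1 < i + f i" using D[of i "l + f l - 1"] by simp
      then show ?thesis using pos[of l] that by linarith
    qed
    show ?thesis
      using pos dec by (force simp: strict_partition_def sorted_wrt_iff_nth_less lam_def simp del: upt_Suc)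
  qed
  ultimately show ?thesis by blast
qed

text \<open>The concatenated rows are sorted by \<open>row_before\<close>, and sorted listings are
  unique.\<close>

lemma row_word_eq:
  assumes "finite (dom T)"
  shows "row_word T = map (entry T) (row_boxes (dom T))"
proof -
  define rows where "rows = rev (sorted_list_of_set (fst ` dom T))"
  define R where "R i = map (Pair i) (sorted_list_of_set {j. (i, j) \<in> dom T})" for i
  have fin: "finite {j. (i, j) \<in> dom T}" for i
    by (rule finite_subset[of _ "snd ` dom T"]) (use assms in force)+
  have R: "sorted_wrt row_before (R i)" "set (R i) = {b \<in> dom T. fst b = i}" for i
    using fin[of i] by (auto simp: R_def sorted_wrt_map row_before_def)
  have "sorted_wrt (>) rows"
    by (simp add: rows_def sorted_wrt_rev)
  then have "sorted_wrt row_before (concat (map R rows))"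
  proof (induction rows)
    case (Cons i ks)
    moreover from this have "\<forall>a \<in> set (R i). \<forall>b \<in> set (concat (map R ks)). row_before a b"
      by (auto simp: R(2) row_before_def)
    ultimately show ?case using R(1) by (simp add: sorted_wrt_append)
  qed simp
  moreover have "set (concat (map R rows)) = dom T"
    using assms R by (auto simp: rows_def)
  ultimately have "row_boxes (dom T) = concat (map R rows)"
    by (rule row.listing_eqI)
  then show ?thesis
    by (simp add: row_word_def row_entries_def[abs_def] map_concat R_def[abs_def] rows_def comp_def)
qed

section \<open>Increasing tableaux and their words\<close>

abbreviation val :: "tableau \<Rightarrow> box \<Rightarrow> int" where
  "val T b \<equiv> \<lceil>entry T b\<rceil>"

text \<open>Strictness of the ceilings implies \<open>increasing_tableau\<close>; for the converse
  the row word has to be reduced, see \<open>good_if_increasing\<close>.\<close>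

definition good :: "tableau \<Rightarrow> bool" where
  "good T \<longleftrightarrow> shape (dom T) \<and> (\<forall>b \<in> dom T. entry T b \<in> half_ints) \<and> no_primed_diagonal T \<and>
     (\<forall>i j k. (i, j) \<in> dom T \<longrightarrow> (i, k) \<in> dom T \<longrightarrow> j < k \<longrightarrow> val T (i, j) < val T (i, k)) \<and>
     (\<forall>i j k. (i, j) \<in> dom T \<longrightarrow> (k, j) \<in> dom T \<longrightarrow> i < k \<longrightarrow> val T (i, j) < val T (k, j))"

lemma goodD:
  assumes "good T"
  shows "shape (dom T)" "finite (dom T)"
    "b \<in> dom T \<Longrightarrow> entry T b \<in> half_ints"
    "(i, i) \<in> dom T \<Longrightarrow> entry T (i, i) \<in> \<int>"
    "(i, j) \<in> dom T \<Longrightarrow> (i, k) \<in> dom T \<Longrightarrow> j < k \<Longrightarrow> val T (i, j) < val T (i, k)"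
    "(i, j) \<in> dom T \<Longrightarrow> (k, j) \<in> dom T \<Longrightarrow> i < k \<Longrightarrow> val T (i, j) < val T (k, j)"
    "(i, j) \<in> dom T \<Longrightarrow> 1 \<le> i" "(i, j) \<in> dom T \<Longrightarrow> i \<le> j"
    "(i, j) \<in> dom T \<Longrightarrow> 1 \<le> k \<Longrightarrow> k \<le> i \<Longrightarrow> k \<le> l \<Longrightarrow> l \<le> j \<Longrightarrow> (k, l) \<in> dom T"
proof -
  have s: "shape (dom T)" using assms by (simp add: good_def)
  then show "shape (dom T)" .
  show "finite (dom T)" using s by (rule shapeD)
  show "b \<in> dom T \<Longrightarrow> entry T b \<in> half_ints" using assms by (simp add: good_def)
  have n: "no_primed_diagonal T" using assms by (simp add: good_def)
  show "(i, i) \<in> dom T \<Longrightarrow> entry T (i, i) \<in> \<int>"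
    using bspec[OF n[unfolded no_primed_diagonal_def], of "(i, i)"] by (simp add: diagonal_def)
  show "(i, j) \<in> dom T \<Longrightarrow> (i, k) \<in> dom T \<Longrightarrow> j < k \<Longrightarrow> val T (i, j) < val T (i, k)"
    using assms unfolding good_def by blast
  show "(i, j) \<in> dom T \<Longrightarrow> (k, j) \<in> dom T \<Longrightarrow> i < k \<Longrightarrow> val T (i, j) < val T (k, j)"
    using assms unfolding good_def by blast
  show "(i, j) \<in> dom T \<Longrightarrow> 1 \<le> i" using shapeD(2)[OF s] .
  show "(i, j) \<in> dom T \<Longrightarrow> i \<le> j" using shapeD(3)[OF s] .
  show "(i, j) \<in> dom T \<Longrightarrow> 1 \<le> k \<Longrightarrow> k \<le> i \<Longrightarrow> k \<le> l \<Longrightarrow> l \<le> j \<Longrightarrow> (k, l) \<in> dom T"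
    using shapeD(4)[OF s] .
qed

lemma val_row_mono:
  "good T \<Longrightarrow> (i, j) \<in> dom T \<Longrightarrow> (i, k) \<in> dom T \<Longrightarrow> j \<le> k \<Longrightarrow> val T (i, j) \<le> val T (i, k)"
  by (cases "j = k") (auto dest: goodD(5)[of T i j k])

lemma val_column_mono:
  "good T \<Longrightarrow> (i, j) \<in> dom T \<Longrightarrow> (k, j) \<in> dom T \<Longrightarrow> i \<le> k \<Longrightarrow> val T (i, j) \<le> val T (k, j)"
  by (cases "i = k") (auto dest: goodD(6)[of T i j k])

text \<open>The corner \<open>(k, j)\<close> belongs to the shape, and the way through it makes two
  strict increases.\<close>

lemma val_south_west:
  assumes "good T" "(k, l) \<in> dom T" "(i, j) \<in> dom T" "k < i" "l < j"
  shows "val T (k, l) + 2 \<le> val T (i, j)"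
proof -
  have "1 \<le> k" "k \<le> l" using goodD(7,8)[OF assms(1,2)] by simp_all
  then have kj: "(k, j) \<in> dom T" using goodD(9)[OF assms(1,3)] assms(4,5) by simp
  show ?thesis
    using goodD(5)[OF assms(1,2) kj assms(5)] goodD(6)[OF assms(1) kj assms(3,4)] by linarith
qed

lemma good_upd:
  assumes "good T" "shape (insert (i, j) (dom T))" "x \<in> half_ints" "i = j \<Longrightarrow> x \<in> \<int>"
    and "\<And>q. (i, q) \<in> dom T \<Longrightarrow> q < j \<Longrightarrow> val T (i, q) < \<lceil>x\<rceil>"
    and "\<And>q. (i, q) \<in> dom T \<Longrightarrow> j < q \<Longrightarrow> \<lceil>x\<rceil> < val T (i, q)"
    and "\<And>k. (k, j) \<in> dom T \<Longrightarrow> k < i \<Longrightarrow> val T (k, j) < \<lceil>x\<rceil>"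
    and "\<And>k. (k, j) \<in> dom T \<Longrightarrow> i < k \<Longrightarrow> \<lceil>x\<rceil> < val T (k, j)"
  shows "good (T((i, j) \<mapsto> x))"
  unfolding good_def no_primed_diagonal_def diagonal_def
proof (intro conjI allI impI ballI)
  show "shape (dom (T((i, j) \<mapsto> x)))" using assms(2) by simp
next
  fix b assume "b \<in> dom (T((i, j) \<mapsto> x))"
  then show "entry (T((i, j) \<mapsto> x)) b \<in> half_ints" using goodD(3)[OF assms(1), of b] assms(3) by auto
next
  fix b assume "b \<in> dom (T((i, j) \<mapsto> x))" "fst b = snd b"
  then show "entry (T((i, j) \<mapsto> x)) b \<in> \<int>"
    using goodD(4)[OF assms(1)] assms(4) by (cases b) auto
next
  fix a b c assume "(a, b) \<in> dom (T((i, j) \<mapsto> x))" "(a, c) \<in> dom (T((i, j) \<mapsto> x))" "b < c"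
  then show "val (T((i, j) \<mapsto> x)) (a, b) < val (T((i, j) \<mapsto> x)) (a, c)"
    using goodD(5)[OF assms(1), of a b c] assms(5,6) by (auto simp: domI split: if_splits)
next
  fix a b c assume "(a, b) \<in> dom (T((i, j) \<mapsto> x))" "(c, b) \<in> dom (T((i, j) \<mapsto> x))" "a < c"
  then show "val (T((i, j) \<mapsto> x)) (a, b) < val (T((i, j) \<mapsto> x)) (c, b)"
    using goodD(6)[OF assms(1), of a b c] assms(7,8) by (auto simp: domI split: if_splits)
qed

lemma good_replace:
  assumes "good T" "(i, j) \<in> dom T" "x \<in> half_ints" "i = j \<Longrightarrow> x \<in> \<int>"
    and "\<And>q. (i, q) \<in> dom T \<Longrightarrow> q < j \<Longrightarrow> val T (i, q) < \<lceil>x\<rceil>"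
    and "\<And>q. (i, q) \<in> dom T \<Longrightarrow> j < q \<Longrightarrow> \<lceil>x\<rceil> < val T (i, q)"
    and "\<And>k. (k, j) \<in> dom T \<Longrightarrow> k < i \<Longrightarrow> val T (k, j) < \<lceil>x\<rceil>"
    and "\<And>k. (k, j) \<in> dom T \<Longrightarrow> i < k \<Longrightarrow> \<lceil>x\<rceil> < val T (k, j)"
  shows "good (T((i, j) \<mapsto> x))"
  using assms by (intro good_upd) (auto simp: insert_absorb goodD(1))

text \<open>On half-integers this agrees with \<open>switch_primes\<close>. Written with
  \<open>like\<close> it visibly leaves all ceilings, hence all inequalities, untouched, and on two
  boxes of a good tableau it is its own inverse.\<close>

definition swap_entries :: "tableau \<Rightarrow> box \<Rightarrow> box \<Rightarrow> tableau" where
  "swap_entries T a b = T(a \<mapsto> like (entry T b) (val T a), b \<mapsto> like (entry T a) (val T b))"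

lemma dom_swap_entries [simp]: "a \<in> dom T \<Longrightarrow> b \<in> dom T \<Longrightarrow> dom (swap_entries T a b) = dom T"
  by (auto simp: swap_entries_def)

lemma val_swap_entries [simp]: "val (swap_entries T a b) c = val T c"
  by (simp add: swap_entries_def)

lemma entry_swap_entries:
  "a \<noteq> b \<Longrightarrow> entry (swap_entries T a b) a = like (entry T b) (val T a)"
  "entry (swap_entries T a b) b = like (entry T a) (val T b)"
  "c \<noteq> a \<Longrightarrow> c \<noteq> b \<Longrightarrow> entry (swap_entries T a b) c = entry T c"
  by (simp_all add: swap_entries_def)

lemma swap_entries_swap_entries:
  assumes "good T" "a \<in> dom T" "b \<in> dom T" "a \<noteq> b"
  shows "swap_entries (swap_entries T a b) a b = T"
proof -
  have e: "like (like x i) = like x" for x i by (rule like_cong) simp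
  have "like (entry T c) (val T c) = entry T c" if "c \<in> dom T" for c
    using goodD(3)[OF assms(1) that] by (rule like_ceiling)
  moreover have "T c = Some (entry T c)" if "c \<in> dom T" for c using that by auto
  ultimately show ?thesis
    using assms(2-4) by (auto simp: swap_entries_def[of "swap_entries T a b"] entry_swap_entries e fun_eq_iff)
      (auto simp: swap_entries_def)
qed

lemma swap_entries_unprimed:
  assumes "good T" "a \<in> dom T" "b \<in> dom T" "entry T a \<in> \<int>" "entry T b \<in> \<int>"
  shows "swap_entries T a b = T"
  using assms Ints_eq_of_int_ceiling[OF assms(4)] Ints_eq_of_int_ceiling[OF assms(5)]
  by (auto simp: swap_entries_def like_def fun_eq_iff)

text \<open>A diagonal box receives the prime of its partner, hence the two conditions on partners
  of diagonal boxes.\<close>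

lemma good_swap_entries:
  assumes "good T" "a \<in> dom T" "b \<in> dom T" "a \<noteq> b"
    and "fst a = snd a \<Longrightarrow> entry T b \<in> \<int>" "fst b = snd b \<Longrightarrow> entry T a \<in> \<int>"
  shows "good (swap_entries T a b)"
  unfolding good_def no_primed_diagonal_def diagonal_def
proof (intro conjI allI impI ballI)
  show "shape (dom (swap_entries T a b))" using assms by (simp add: goodD(1))
next
  fix c assume "c \<in> dom (swap_entries T a b)"
  then show "entry (swap_entries T a b) c \<in> half_ints"
    using goodD(3)[OF assms(1), of c] assms(2,3)
    by (cases "c = a"; cases "c = b") (simp_all add: swap_entries_def)
next
  fix c assume "c \<in> dom (swap_entries T a b)" "fst c = snd c"
  then show "entry (swap_entries T a b) c \<in> \<int>"
    using goodD(4)[OF assms(1)] assms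
    by (cases c; cases "c = a"; cases "c = b") (auto simp add: swap_entries_def)
qed (use assms goodD(5,6)[OF assms(1)] in auto)

section \<open>Row and column readings of sets of boxes\<close>

definition row_reading :: "tableau \<Rightarrow> box set \<Rightarrow> rat list" where
  "row_reading T S = map (entry T) (row_boxes S)"

definition column_reading :: "tableau \<Rightarrow> box set \<Rightarrow> rat list" where
  "column_reading T S = map (entry T) (column_boxes S)"

lemma readings_cong:
  assumes "finite S" "\<And>b. b \<in> S \<Longrightarrow> entry T b = entry T' b"
  shows "row_reading T S = row_reading T' S" "column_reading T S = column_reading T' S"
  using assms by (auto simp: row_reading_def column_reading_def)

lemma readings_upd [simp]:
  assumes "finite S" "b \<notin> S"
  shows "row_reading (T(b \<mapsto> x)) S = row_reading T S" "column_reading (T(b \<mapsto> x)) S = column_reading T S"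
  using assms by (auto intro!: readings_cong)

lemma set_readings [simp]:
  "finite S \<Longrightarrow> set (row_reading T S) = entry T ` S" "finite S \<Longrightarrow> set (column_reading T S) = entry T ` S"
  by (auto simp: row_reading_def column_reading_def)

lemma readings_empty [simp]: "row_reading T {} = []" "column_reading T {} = []"
  by (simp_all add: row_reading_def column_reading_def)

lemma row_word_row_reading: "good T \<Longrightarrow> row_word T = row_reading T (dom T)"
  by (simp add: row_word_eq goodD(2) row_reading_def)

definition rows_above :: "tableau \<Rightarrow> nat \<Rightarrow> box set" where
  "rows_above T r = {b \<in> dom T. r < fst b}"
definition rows_below :: "tableau \<Rightarrow> nat \<Rightarrow> box set" where
  "rows_below T r = {b \<in> dom T. fst b < r}"
definition row_left :: "tableau \<Rightarrow> nat \<Rightarrow> nat \<Rightarrow> box set" where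
  "row_left T r p = {b \<in> dom T. fst b = r \<and> snd b < p}"
definition row_right :: "tableau \<Rightarrow> nat \<Rightarrow> nat \<Rightarrow> box set" where
  "row_right T r p = {b \<in> dom T. fst b = r \<and> p < snd b}"
definition columns_right :: "tableau \<Rightarrow> nat \<Rightarrow> box set" where
  "columns_right T c = {b \<in> dom T. c < snd b}"
definition columns_left :: "tableau \<Rightarrow> nat \<Rightarrow> box set" where
  "columns_left T c = {b \<in> dom T. snd b < c}"
definition column_up :: "tableau \<Rightarrow> nat \<Rightarrow> nat \<Rightarrow> box set" where
  "column_up T c p = {b \<in> dom T. snd b = c \<and> p < fst b}"
definition column_down :: "tableau \<Rightarrow> nat \<Rightarrow> nat \<Rightarrow> box set" where
  "column_down T c p = {b \<in> dom T. snd b = c \<and> fst b < p}"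

lemmas box_set_defs = rows_above_def rows_below_def row_left_def row_right_def
  columns_right_def columns_left_def column_up_def column_down_def

lemma box_sets_upd [simp]:
  assumes "b \<in> dom T"
  shows "rows_above (T(b \<mapsto> x)) r = rows_above T r" "rows_below (T(b \<mapsto> x)) r = rows_below T r"
    "row_left (T(b \<mapsto> x)) r p = row_left T r p" "row_right (T(b \<mapsto> x)) r p = row_right T r p"
    "columns_right (T(b \<mapsto> x)) r = columns_right T r" "columns_left (T(b \<mapsto> x)) r = columns_left T r"
    "column_up (T(b \<mapsto> x)) r p = column_up T r p" "column_down (T(b \<mapsto> x)) r p = column_down T r p"
  using assms unfolding box_set_defs by auto

lemma finite_box_sets [simp]:
  assumes "finite (dom T)"
  shows "finite (rows_above T r)" "finite (rows_below T r)" "finite (row_left T r p)" "finite (row_right T r p)"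
    "finite (columns_right T r)" "finite (columns_left T r)" "finite (column_up T r p)" "finite (column_down T r p)"
  using assms unfolding box_set_defs by auto

fun state_word :: "tableau \<Rightarrow> segment \<Rightarrow> rat \<Rightarrow> rat list" where
  "state_word T (Row r) w = row_reading T {b \<in> dom T. r \<le> fst b} @ w # row_reading T (rows_below T r)"
| "state_word T (Column c) w = column_reading T (columns_left T c) @ w # column_reading T {b \<in> dom T. c \<le> snd b}"

lemma row_reading_at_least:
  assumes "finite (dom T)" "(r, p) \<in> dom T"
  shows "row_reading T {b \<in> dom T. r \<le> fst b} = row_reading T (rows_above T r) @
    row_reading T (row_left T r p) @ entry T (r, p) # row_reading T (row_right T r p)"
proof -
  have "row_boxes {b \<in> dom T. fst b = r} = row_boxes (row_left T r p) @ (r, p) # row_boxes (row_right T r p)"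
    using assms by (intro row.listing_insert_between) (auto simp: box_set_defs row_before_def prod_eq_iff)
  moreover have "row_boxes {b \<in> dom T. r \<le> fst b} = row_boxes (rows_above T r) @ row_boxes {b \<in> dom T. fst b = r}"
    using assms by (subst row.listing_Un[symmetric]) (auto simp: box_set_defs row_before_def intro!: arg_cong[of _ _ row_boxes])
  ultimately show ?thesis by (simp add: row_reading_def)
qed

lemma row_reading_less_Suc:
  assumes "finite (dom T)" "(r, p) \<in> dom T"
  shows "row_reading T (rows_below T (Suc r)) =
    row_reading T (row_left T r p) @ entry T (r, p) # row_reading T (row_right T r p) @ row_reading T (rows_below T r)"
proof -
  have "row_boxes {b \<in> dom T. fst b = r} = row_boxes (row_left T r p) @ (r, p) # row_boxes (row_right T r p)"
    using assms by (intro row.listing_insert_between) (auto simp: box_set_defs row_before_def prod_eq_iff)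
  moreover have "row_boxes (rows_below T (Suc r)) = row_boxes {b \<in> dom T. fst b = r} @ row_boxes (rows_below T r)"
    using assms by (subst row.listing_Un[symmetric]) (auto simp: box_set_defs row_before_def intro!: arg_cong[of _ _ row_boxes])
  ultimately show ?thesis by (simp add: row_reading_def)
qed

lemma row_reading_right:
  assumes "finite (dom T)" "(r, Suc p) \<in> dom T"
  shows "row_reading T (row_right T r p) = entry T (r, Suc p) # row_reading T (row_right T r (Suc p))"
proof -
  have "row_boxes (row_right T r p) = row_boxes {} @ (r, Suc p) # row_boxes (row_right T r (Suc p))"
    using assms by (intro row.listing_insert_between) (auto simp: box_set_defs row_before_def prod_eq_iff)
  then show ?thesis by (simp add: row_reading_def)
qed

lemma row_reading_left:
  assumes "finite (dom T)" "(r, p) \<in> dom T"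
  shows "row_reading T (row_left T r (Suc p)) = row_reading T (row_left T r p) @ [entry T (r, p)]"
proof -
  have "row_boxes (row_left T r (Suc p)) = row_boxes (row_left T r p) @ (r, p) # row_boxes {}"
    using assms by (intro row.listing_insert_between) (auto simp: box_set_defs row_before_def prod_eq_iff)
  then show ?thesis by (simp add: row_reading_def)
qed

lemma column_reading_at_least:
  assumes "finite (dom T)" "(p, c) \<in> dom T"
  shows "column_reading T {b \<in> dom T. c \<le> snd b} = column_reading T (column_up T c p) @
    entry T (p, c) # column_reading T (column_down T c p) @ column_reading T (columns_right T c)"
proof -
  have "column_boxes {b \<in> dom T. snd b = c} = column_boxes (column_up T c p) @ (p, c) # column_boxes (column_down T c p)"
    using assms by (intro column.listing_insert_between) (auto simp: box_set_defs column_before_def prod_eq_iff)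
  moreover have "column_boxes {b \<in> dom T. c \<le> snd b} = column_boxes {b \<in> dom T. snd b = c} @ column_boxes (columns_right T c)"
    using assms by (subst column.listing_Un[symmetric]) (auto simp: box_set_defs column_before_def intro!: arg_cong[of _ _ column_boxes])
  ultimately show ?thesis by (simp add: column_reading_def)
qed

lemma column_reading_less_Suc:
  assumes "finite (dom T)" "(p, c) \<in> dom T"
  shows "column_reading T (columns_left T (Suc c)) = column_reading T (columns_left T c) @
    column_reading T (column_up T c p) @ entry T (p, c) # column_reading T (column_down T c p)"
proof -
  have "column_boxes {b \<in> dom T. snd b = c} = column_boxes (column_up T c p) @ (p, c) # column_boxes (column_down T c p)"
    using assms by (intro column.listing_insert_between) (auto simp: box_set_defs column_before_def prod_eq_iff)
  moreover have "column_boxes (columns_left T (Suc c)) = column_boxes (columns_left T c) @ column_boxes {b \<in> dom T. snd b = c}"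
    using assms by (subst column.listing_Un[symmetric]) (auto simp: box_set_defs column_before_def intro!: arg_cong[of _ _ column_boxes])
  ultimately show ?thesis by (simp add: column_reading_def)
qed

lemma column_reading_up:
  assumes "finite (dom T)" "(Suc p, c) \<in> dom T"
  shows "column_reading T (column_up T c p) = column_reading T (column_up T c (Suc p)) @ [entry T (Suc p, c)]"
proof -
  have "column_boxes (column_up T c p) = column_boxes (column_up T c (Suc p)) @ (Suc p, c) # column_boxes {}"
    using assms by (intro column.listing_insert_between) (auto simp: box_set_defs column_before_def prod_eq_iff)
  then show ?thesis by (simp add: column_reading_def)
qed

context word_class
begin

text \<open>Two boxes in different orders in the two readings lie strictly south-west of each other, so
  that their letters commute.\<close>

lemma row_column_reading_iff:
  assumes "good T"
  shows "row_reading T (dom T) \<in> W \<longleftrightarrow> column_reading T (dom T) \<in> W"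
proof -
  have f: "finite (dom T)" using assms by (rule goodD)
  have "[] @ map (entry T) (row_boxes (dom T)) @ [] \<in> W \<longleftrightarrow> [] @ map (entry T) (column_boxes (dom T)) @ [] \<in> W"
  proof (rule rearrange)
    fix a b assume "a \<in> set (row_boxes (dom T))" "b \<in> set (row_boxes (dom T))" and
      *: "row_before a b" "column_before b a"
    then have "a \<in> dom T" "b \<in> dom T" using f by simp_all
    with * show "2 \<le> \<bar>val T a - val T b\<bar>"
      using val_south_west[OF assms, of "fst b" "snd b" "fst a" "snd a"]
      by (auto simp: row_before_def column_before_def)
  qed (use f in \<open>auto simp: row.sorted_listing column.sorted_listing\<close>)
  then show ?thesis by (simp add: row_reading_def column_reading_def)
qed

text \<open>\<open>None\<close> stands for the travelling letter. Here the diagonal box comes first,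
  then the letter, then the other boxes row by row; \<open>diagonal_column_order\<close> puts the
  letter between columns \<open>s\<close> and \<open>s + 1\<close>.\<close>

fun diagonal_row_order :: "nat \<Rightarrow> box option \<Rightarrow> box option \<Rightarrow> bool" where
  "diagonal_row_order s (Some a) (Some b) \<longleftrightarrow> a = (s, s) \<or> row_before a b"
| "diagonal_row_order s None (Some b) \<longleftrightarrow> b \<noteq> (s, s)"
| "diagonal_row_order s (Some a) None \<longleftrightarrow> a = (s, s)"
| "diagonal_row_order s None None \<longleftrightarrow> False"

fun diagonal_column_order :: "nat \<Rightarrow> box option \<Rightarrow> box option \<Rightarrow> bool" where
  "diagonal_column_order s (Some a) (Some b) \<longleftrightarrow> column_before a b"
| "diagonal_column_order s None (Some b) \<longleftrightarrow> s < snd b"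
| "diagonal_column_order s (Some a) None \<longleftrightarrow> snd a \<le> s"
| "diagonal_column_order s None None \<longleftrightarrow> False"

text \<open>An instance of \<open>rearrange\<close>. Two boxes in opposite orders lie strictly
  south-west of each other. The letter has to pass the boxes in columns up to \<open>s\<close> other
  than \<open>(s, s)\<close>; these lie below row \<open>s\<close>, so their values are smaller than
  \<open>val T (s, s) < \<lceil>v\<rceil>\<close> and at least two away from the letter.\<close>

lemma diagonal_transition:
  assumes "good T" "(s, s) \<in> dom T" "val T (s, s) < \<lceil>v\<rceil>"
  shows "entry T (s, s) # v # row_reading T (rows_above T s) @ row_reading T (row_right T s s) @
      row_reading T (rows_below T s) \<in> W \<longleftrightarrow> state_word T (Column (Suc s)) v \<in> W"
proof -
  have f: "finite (dom T)" using assms(1) by (rule goodD)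
  define f where "f b = (case b of None \<Rightarrow> v | Some b \<Rightarrow> entry T b)" for b
  have fs: "map f (map Some xs) = map (entry T) xs" for xs by (simp add: f_def)
  define A where "A = rows_above T s \<union> row_right T s s \<union> rows_below T s"
  have A: "row_boxes A = row_boxes (rows_above T s) @ row_boxes (row_right T s s) @ row_boxes (rows_below T s)"
    unfolding A_def using f by (subst row.listing_Un, auto simp: box_set_defs row_before_def)+
  have dom: "dom T = insert (s, s) A"
    using assms(2) goodD(8)[OF assms(1)] by (auto simp: A_def box_set_defs) (metis domI le_neq_implies_less)
  have nA: "(s, s) \<notin> A" "finite A" using f by (auto simp: A_def box_set_defs)
  define xs where "xs = Some (s, s) # None # map Some (row_boxes A)"
  define L where "L = columns_left T (Suc s)"
  define R where "R = {b \<in> dom T. Suc s \<le> snd b}"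
  have LR: "finite L" "finite R" "L \<union> R = dom T" "L \<inter> R = {}"
    using f by (auto simp: L_def R_def columns_left_def)
  define ys where "ys = map Some (column_boxes L) @ None # map Some (column_boxes R)"
  have "[] @ map f xs @ [] \<in> W \<longleftrightarrow> [] @ map f ys @ [] \<in> W"
  proof (rule rearrange)
    show "sorted_wrt (diagonal_row_order s) xs"
      using nA row.sorted_listing[of A]
      by (auto simp: xs_def sorted_wrt_map elim: sorted_wrt_mono_rel[rotated])
    show "sorted_wrt (diagonal_column_order s) ys"
      using LR column.sorted_listing[of L] column.sorted_listing[of R]
      by (auto simp: ys_def sorted_wrt_map sorted_wrt_append L_def R_def columns_left_def column_before_def
          elim: sorted_wrt_mono_rel[rotated])
    show "distinct xs" using nA by (auto simp: xs_def distinct_map)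
    show "distinct ys" using LR by (auto simp: ys_def distinct_map)
    show "set xs = set ys" using nA LR dom by (auto simp: xs_def ys_def)
  next
    fix a b assume "a \<in> set xs" "b \<in> set xs" and
      *: "diagonal_row_order s a b" "diagonal_column_order s b a"
    then have ab: "a \<in> insert None (Some ` dom T)" "b \<in> insert None (Some ` dom T)"
      using nA dom by (auto simp: xs_def)
    show "2 \<le> \<bar>\<lceil>f a\<rceil> - \<lceil>f b\<rceil>\<bar>"
    proof (cases a)
      case None
      with * obtain b' where b': "b = Some b'" "b' \<noteq> (s, s)" "snd b' \<le> s" by (cases b) auto
      obtain k l where "b' = (k, l)" by (cases b')
      with b' have b: "b = Some (k, l)" "(k, l) \<noteq> (s, s)" "l \<le> s" by simp_all
      have "(k, l) \<in> dom T" using ab b by auto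
      with goodD(7,8)[OF assms(1)] have kl: "(k, l) \<in> dom T" "1 \<le> k" "k \<le> l" by blast+
      then have "k < s" using b by auto
      then have "(k, s) \<in> dom T" using goodD(9)[OF assms(1,2), of k s] kl by simp
      then have "val T (k, l) < val T (s, s)"
        using val_row_mono[OF assms(1) kl(1) \<open>(k, s) \<in> dom T\<close>] goodD(6)[OF assms(1) \<open>(k, s) \<in> dom T\<close> assms(2) \<open>k < s\<close>] b
        by linarith
      with None b assms(3) show ?thesis by (simp add: f_def)
    next
      case (Some a')
      with * obtain b' where b: "b = Some b'" by (cases b) auto
      with Some ab have "a' \<in> dom T" "b' \<in> dom T" by auto
      moreover have "fst b' < fst a' \<and> snd b' < snd a'"
        using * Some b goodD(8)[OF assms(1), of "fst b'" "snd b'"] \<open>b' \<in> dom T\<close>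
        by (auto simp: row_before_def column_before_def)
      ultimately show ?thesis
        using val_south_west[OF assms(1), of "fst b'" "snd b'" "fst a'" "snd a'"] Some b
        by (simp add: f_def)
    qed
  qed
  then show ?thesis
    by (simp add: xs_def ys_def A row_reading_def column_reading_def L_def R_def) (simp add: f_def comp_def)
qed

text \<open>The first letter may be unprimed and then exchanged with the second, which makes the two
  equal letters adjacent.\<close>

lemma first_pair_gap:
  assumes "x # y # z # v \<in> W" "\<lceil>z\<rceil> = \<lceil>x\<rceil>"
  shows False
proof -
  have "of_int \<lceil>x\<rceil> # y # z # v \<in> W" by (rule toggle_first[OF assms(1)]) simp_all
  then have "of_int \<lceil>y\<rceil> # like y \<lceil>x\<rceil> # z # v \<in> W" by (drule_tac swap_first) simp_all
  then show False using no_repeat[of "like y \<lceil>x\<rceil>" z "[of_int \<lceil>y\<rceil>]" v] assms(2) by simp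
qed

lemma swap_first_unprimed:
  assumes "x # y # v \<in> W" "x \<in> \<int>" "y \<in> \<int>"
  shows "y # x # v \<in> W"
  using swap_first[OF assms(1,2)] assms(2,3) by (simp add: like_def Ints_eq_of_int_ceiling)

text \<open>The case where a diagonal entry \<open>m\<close> and its right neighbour \<open>M\<close> survive the insertion of a
  letter equal to \<open>m\<close>. Here \<open>A\<close> reads the rows above them, and \<open>g\<close>, if present, is the next
  diagonal entry.\<close>

lemma diagonal_pair:
  assumes "\<lceil>M\<rceil> = \<lceil>v\<rceil>"
    and A: "(\<forall>x \<in> set A. \<lceil>v\<rceil> + 2 \<le> \<lceil>x\<rceil>) \<or> (\<exists>A1 g A2. A = A1 @ g # A2 \<and> \<lceil>g\<rceil> = \<lceil>v\<rceil> + 1 \<and> g \<in> \<int> \<and>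
      (\<forall>x \<in> set (A1 @ A2). \<lceil>g\<rceil> + 1 \<le> \<lceil>x\<rceil>) \<and> (\<forall>x \<in> set A1. \<lceil>g\<rceil> + 2 \<le> \<lceil>x\<rceil>))"
    and m: "m \<in> \<int>" "\<lceil>m\<rceil> < \<lceil>v\<rceil>"
  shows "A @ v # m # M # B \<in> W \<Longrightarrow> \<lceil>m\<rceil> = \<lceil>v\<rceil> - 1 \<Longrightarrow> v \<in> \<int> \<and> m # v # A @ M # B \<in> W"
    and "m # v # A @ M # B \<in> W \<Longrightarrow> \<lceil>m\<rceil> = \<lceil>v\<rceil> - 1 \<and> v \<in> \<int> \<and> A @ v # m # M # B \<in> W"
proof -
  note mv = assms(1) m
  {
    \<comment> \<open>Without a near \<open>g\<close> neither word exists: commutations bring the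
      equal letters \<open>v\<close> and \<open>M\<close> next to each other or to first and third
      position.\<close>
    assume "\<forall>x \<in> set A. \<lceil>v\<rceil> + 2 \<le> \<lceil>x\<rceil>"
    then have far: "\<forall>x \<in> set A. 2 \<le> \<bar>\<lceil>v\<rceil> - \<lceil>x\<rceil>\<bar>" "\<forall>x \<in> set A. 2 \<le> \<bar>\<lceil>m\<rceil> - \<lceil>x\<rceil>\<bar>" "\<forall>x \<in> set A. 2 \<le> \<bar>\<lceil>M\<rceil> - \<lceil>x\<rceil>\<bar>"
      using mv by fastforce+
    have "A @ v # m # M # B \<notin> W"
    proof
      assume "A @ v # m # M # B \<in> W"
      then have "v # A @ m # M # B \<in> W" using move_right[OF far(1), of "[]"] by simp
      then have "v # m # A @ M # B \<in> W" using move_right[OF far(2), of "[v]"] by simp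
      then have "v # m # M # A @ B \<in> W" using move_right[OF far(3), of "[v, m]"] by simp
      then show False by (rule first_pair_gap) (rule mv)
    qed
    moreover have "m # v # A @ M # B \<notin> W"
    proof
      assume "m # v # A @ M # B \<in> W"
      then have "[m] @ A @ v # M # B \<in> W" using move_right[OF far(1), of "[m]"] by simp
      then show False using no_repeat[of v M "m # A" B] mv by simp
    qed
    ultimately have "A @ v # m # M # B \<notin> W \<and> m # v # A @ M # B \<notin> W" by blast
  } note no = this
  {
    fix A1 g A2 assume A12: "A = A1 @ g # A2" "\<lceil>g\<rceil> = \<lceil>v\<rceil> + 1" "g \<in> \<int>"
      "\<forall>x \<in> set (A1 @ A2). \<lceil>g\<rceil> + 1 \<le> \<lceil>x\<rceil>" "\<forall>x \<in> set A1. \<lceil>g\<rceil> + 2 \<le> \<lceil>x\<rceil>"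
    have far: "\<forall>x \<in> set (A1 @ A2). 2 \<le> \<bar>\<lceil>v\<rceil> - \<lceil>x\<rceil>\<bar>" "\<forall>x \<in> set (A1 @ A2). 2 \<le> \<bar>\<lceil>m\<rceil> - \<lceil>x\<rceil>\<bar>"
      "\<forall>x \<in> set (A1 @ A2). 2 \<le> \<bar>\<lceil>M\<rceil> - \<lceil>x\<rceil>\<bar>" "\<forall>x \<in> set A1. 2 \<le> \<bar>\<lceil>g\<rceil> - \<lceil>x\<rceil>\<bar>" "2 \<le> \<bar>\<lceil>g\<rceil> - \<lceil>m\<rceil>\<bar>"
      using A12 mv by fastforce+
    have 1: "A @ v # m # M # B \<in> W \<longleftrightarrow> g # v # m # A1 @ A2 @ M # B \<in> W"
    proof -
      have "A @ v # m # M # B \<in> W \<longleftrightarrow> g # (A1 @ A2) @ v # m # M # B \<in> W"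
        using move_right[OF far(4), of "[]"] A12(1) by simp
      also have "\<dots> \<longleftrightarrow> g # v # (A1 @ A2) @ m # M # B \<in> W"
        using move_right[OF far(1), of "[g]"] by simp
      also have "\<dots> \<longleftrightarrow> g # v # m # A1 @ A2 @ M # B \<in> W"
        using move_right[OF far(2), of "[g, v]"] by simp
      finally show ?thesis .
    qed
    have 2: "m # v # A @ M # B \<in> W \<longleftrightarrow> m # v # g # A1 @ A2 @ M # B \<in> W"
      using move_right[OF far(4), of "[m, v]"] A12(1) by simp
    \<comment> \<open>\<open>g v m\<close> turns into \<open>v g m\<close>, then
      \<open>v m g\<close>, then \<open>m v g\<close>: two exchanges of the first letters around one
      commutation.\<close>
    have 3: "v \<in> \<int> \<and> m # v # A @ M # B \<in> W" if "A @ v # m # M # B \<in> W"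
    proof -
      have *: "g # v # m # A1 @ A2 @ M # B \<in> W" using that 1 by simp
      then have v: "v \<in> \<int>" using A12(2) second_unprimed[OF *] by simp
      from swap_first_unprimed[OF * A12(3) v] have "[v] @ m # g # A1 @ A2 @ M # B \<in> W"
        using comm_iff[OF far(5), of "[v]"] by simp
      then show ?thesis using swap_first_unprimed[OF _ v m(1)] v 2 by simp
    qed
    \<comment> \<open>If \<open>m\<close> were further below \<open>v\<close>, commutations would
      move it out of the way and produce a word starting with \<open>v g M\<close>, where
      \<open>M\<close> and \<open>v\<close> have the same integer.\<close>
    have 4: "\<lceil>m\<rceil> = \<lceil>v\<rceil> - 1" if "m # v # A @ M # B \<in> W"
    proof (rule ccontr)
      assume "\<lceil>m\<rceil> \<noteq> \<lceil>v\<rceil> - 1"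
      then have far': "2 \<le> \<bar>\<lceil>m\<rceil> - \<lceil>v\<rceil>\<bar>" "2 \<le> \<bar>\<lceil>m\<rceil> - \<lceil>M\<rceil>\<bar>" using mv by simp_all
      have "[] @ m # v # g # A1 @ A2 @ M # B \<in> W" using 2 that by simp
      then have "[v] @ m # g # (A1 @ A2) @ M # B \<in> W" using comm_iff[OF far'(1), of "[]"] by simp
      then have "[v, g] @ m # (A1 @ A2) @ M # B \<in> W"
        using comm_iff[OF far(5), of "[v]"] by simp
      then have "[v, g] @ m # M # (A1 @ A2) @ B \<in> W" using move_right[OF far(3), of "[v, g, m]"] by simp
      then have "v # g # M # m # A1 @ A2 @ B \<in> W" using comm_iff[OF far'(2), of "[v, g]"] by simp
      then show False by (rule first_pair_gap) (rule mv)
    qed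
    have 5: "v \<in> \<int> \<and> A @ v # m # M # B \<in> W" if "m # v # A @ M # B \<in> W"
    proof -
      have *: "m # v # g # A1 @ A2 @ M # B \<in> W" using that 2 by simp
      have v: "v \<in> \<int>" using second_unprimed[OF *] 4[OF that] by simp
      from swap_first_unprimed[OF * m(1) v] have "v # g # m # A1 @ A2 @ M # B \<in> W"
        using comm_iff[OF far(5), of "[v]"] by simp
      from swap_first_unprimed[OF this v A12(3)] show ?thesis using 1 v by simp
    qed
    note 3 4 5
  } note yes = this
  show "A @ v # m # M # B \<in> W \<Longrightarrow> \<lceil>m\<rceil> = \<lceil>v\<rceil> - 1 \<Longrightarrow> v \<in> \<int> \<and> m # v # A @ M # B \<in> W"
    using A no yes(1) by blast
  show "m # v # A @ M # B \<in> W \<Longrightarrow> \<lceil>m\<rceil> = \<lceil>v\<rceil> - 1 \<and> v \<in> \<int> \<and> A @ v # m # M # B \<in> W"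
    using A no yes(2,3) by blast
qed

end

section \<open>The states of the insertion algorithm\<close>

text \<open>A letter \<open>w\<close> that is about to be inserted into a segment comes from the preceding row or column,
  where it has just been displaced from position \<open>j\<close> (respectively \<open>i\<close>); admissibility is what
  the tableau remembers of this. In a column, \<open>i = s\<close> happens exactly when the insertion
  has just turned from rows to columns.\<close>

fun admissible :: "tableau \<Rightarrow> segment \<Rightarrow> rat \<Rightarrow> bool" where
  "admissible T (Row r) w \<longleftrightarrow> 1 \<le> r \<and> (\<forall>s. r = Suc s \<longrightarrow> 1 \<le> s \<longrightarrow>
     (\<exists>j>s. (s, j) \<in> dom T \<and> val T (s, j) < \<lceil>w\<rceil> \<and> ((r, j) \<in> dom T \<longrightarrow> \<lceil>w\<rceil> \<le> val T (r, j)) \<and>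
       (\<forall>q>j. (s, q) \<in> dom T \<longrightarrow> \<lceil>w\<rceil> \<le> val T (s, q))))"
| "admissible T (Column c) w \<longleftrightarrow> (\<exists>s i. c = Suc s \<and> 1 \<le> i \<and> i \<le> s \<and> (i, s) \<in> dom T \<and>
     val T (i, s) < \<lceil>w\<rceil> \<and> ((i, c) \<in> dom T \<longrightarrow> \<lceil>w\<rceil> \<le> val T (i, c)) \<and>
     (\<forall>k>i. (k, s) \<in> dom T \<longrightarrow> \<lceil>w\<rceil> \<le> val T (k, s)) \<and>
     ((s, c) \<in> dom T \<longrightarrow> val T (s, c) = \<lceil>w\<rceil> \<longrightarrow> entry T (s, c) \<in> \<int>))"

text \<open>The algorithm without its minima. In the keeping rules the second box is the neighbour
  of the first and holds the next integer, which \<open>row_next\<close> and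
  \<open>column_next\<close> force in valid states. The column rules have no diagonal variant,
  because \<open>column_state_landing\<close> puts the landing box off the diagonal.\<close>

inductive step :: "tableau \<times> segment \<times> rat \<Rightarrow> tableau \<times> segment \<times> rat \<Rightarrow> bool" where
  row_replace: "step (T, Row r, w) (T((r, p) \<mapsto> w), Row (Suc r), entry T (r, p))"
    if "(r, p) \<in> dom T" "r < p" "\<And>q. q < p \<Longrightarrow> (r, q) \<in> dom T \<Longrightarrow> val T (r, q) < \<lceil>w\<rceil>" "\<lceil>w\<rceil> < val T (r, p)"
| row_diagonal: "step (T, Row r, w) (T((r, r) \<mapsto> of_int \<lceil>w\<rceil>), Column (Suc r), like w (val T (r, r)))"
    if "(r, r) \<in> dom T" "\<lceil>w\<rceil> < val T (r, r)"
| row_keep: "step (T, Row r, w) (swap_entries T (r, p) (r, Suc p), Row (Suc r), like w (\<lceil>w\<rceil> + 1))"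
    if "(r, p) \<in> dom T" "r < p" "(r, Suc p) \<in> dom T" "val T (r, p) = \<lceil>w\<rceil>" "val T (r, Suc p) = \<lceil>w\<rceil> + 1"
| row_diagonal_keep: "step (T, Row r, w) (swap_entries T (r, r) (r, Suc r), Column (Suc r), like w (\<lceil>w\<rceil> + 1))"
    if "(r, r) \<in> dom T" "(r, Suc r) \<in> dom T" "val T (r, r) = \<lceil>w\<rceil>" "val T (r, Suc r) = \<lceil>w\<rceil> + 1"
| column_replace: "step (T, Column c, w) (T((p, c) \<mapsto> w), Column (Suc c), entry T (p, c))"
    if "(p, c) \<in> dom T" "\<And>k. k < p \<Longrightarrow> (k, c) \<in> dom T \<Longrightarrow> val T (k, c) < \<lceil>w\<rceil>" "\<lceil>w\<rceil> < val T (p, c)"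
| column_keep: "step (T, Column c, w) (swap_entries T (p, c) (Suc p, c), Column (Suc c), like w (\<lceil>w\<rceil> + 1))"
    if "(p, c) \<in> dom T" "(Suc p, c) \<in> dom T" "val T (p, c) = \<lceil>w\<rceil>" "val T (Suc p, c) = \<lceil>w\<rceil> + 1"

text \<open>Row \<open>Suc s\<close> has at the remembered position \<open>j\<close> either no entry
  or one that is at least \<open>w\<close>, so the letter cannot land to the right of
  \<open>j\<close>. Up to \<open>j\<close>, row \<open>s\<close> stays below the letter.\<close>

lemma row_landing:
  assumes "good T" "admissible T (Row (Suc s)) w" "1 \<le> s" "Suc s \<le> p"
    and "\<And>q. Suc s \<le> q \<Longrightarrow> q < p \<Longrightarrow> (Suc s, q) \<in> dom T \<and> val T (Suc s, q) < \<lceil>w\<rceil>"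
  shows "(s, p) \<in> dom T \<and> val T (s, p) < \<lceil>w\<rceil>"
proof -
  obtain j where j: "s < j" "(s, j) \<in> dom T" "val T (s, j) < \<lceil>w\<rceil>" "(Suc s, j) \<in> dom T \<Longrightarrow> \<lceil>w\<rceil> \<le> val T (Suc s, j)"
    using assms(2,3) by auto
  have "p \<le> j"
  proof (rule ccontr)
    assume "\<not> p \<le> j"
    then have "(Suc s, j) \<in> dom T \<and> val T (Suc s, j) < \<lceil>w\<rceil>" using assms(5)[of j] j(1) by simp
    with j(4) show False by simp
  qed
  moreover from this have "(s, p) \<in> dom T" using goodD(9)[OF assms(1) j(2)] assms(3,4) by simp
  ultimately show ?thesis using val_row_mono[OF assms(1) _ j(2)] j(3) by fastforce
qed

lemma row_landing_below:
  assumes "good T" "admissible T (Row r) w" "r \<le> p" "k < r" "(k, p) \<in> dom T"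
    and "\<And>q. r \<le> q \<Longrightarrow> q < p \<Longrightarrow> (r, q) \<in> dom T \<and> val T (r, q) < \<lceil>w\<rceil>"
  shows "val T (k, p) < \<lceil>w\<rceil>"
proof -
  have "1 \<le> k" using goodD(7)[OF assms(1,5)] .
  then obtain s where s: "r = Suc s" "k \<le> s" "1 \<le> s" using assms(4) by (cases r) auto
  then have "(s, p) \<in> dom T \<and> val T (s, p) < \<lceil>w\<rceil>"
    using row_landing[OF assms(1), of s w p] assms(2,3,6) by simp
  then show ?thesis using val_column_mono[OF assms(1,5), of s] s(2) by fastforce
qed

text \<open>The transposed argument. The bound \<open>p \<le> s\<close> says that a letter inserted
  into a column never lands on the diagonal.\<close>

lemma column_landing:
  assumes "good T" "admissible T (Column (Suc s)) w" "1 \<le> p"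
    and "\<And>k. 1 \<le> k \<Longrightarrow> k < p \<Longrightarrow> (k, Suc s) \<in> dom T \<and> val T (k, Suc s) < \<lceil>w\<rceil>"
  shows "p \<le> s \<and> (p, s) \<in> dom T \<and> val T (p, s) < \<lceil>w\<rceil>"
proof -
  obtain i where i: "1 \<le> i" "i \<le> s" "(i, s) \<in> dom T" "val T (i, s) < \<lceil>w\<rceil>"
      "(i, Suc s) \<in> dom T \<Longrightarrow> \<lceil>w\<rceil> \<le> val T (i, Suc s)"
    using assms(2) by auto
  have "p \<le> i"
  proof (rule ccontr)
    assume "\<not> p \<le> i"
    then have "(i, Suc s) \<in> dom T \<and> val T (i, Suc s) < \<lceil>w\<rceil>" using assms(4)[of i] i(1) by simp
    with i(5) show False by simp
  qed
  moreover from this have "(p, s) \<in> dom T" using goodD(9)[OF assms(1) i(3)] assms(3) i(2) by simp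
  ultimately show ?thesis using val_column_mono[OF assms(1) _ i(3), of p] i(2,4) by fastforce
qed

text \<open>The position \<open>j\<close> need not be the last one with a smaller entry: the maximum
  of all such positions lies at \<open>j\<close> or further right and satisfies the remaining clause
  by its choice.\<close>

lemma admissible_rowI:
  assumes "good T" "1 \<le> r" "r \<le> j"
    and below: "\<And>s. r = Suc s \<Longrightarrow> 1 \<le> s \<Longrightarrow> (s, j) \<in> dom T \<and> val T (s, j) < \<lceil>w\<rceil>"
    and right: "\<And>q. j \<le> q \<Longrightarrow> (r, q) \<in> dom T \<Longrightarrow> \<lceil>w\<rceil> \<le> val T (r, q)"
  shows "admissible T (Row r) w"
  unfolding admissible.simps
proof (intro conjI allI impI)
  fix s assume s: "r = Suc s" "1 \<le> s"
  define J where "J = {q. (s, q) \<in> dom T \<and> val T (s, q) < \<lceil>w\<rceil>}"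
  have "J \<subseteq> snd ` dom T" by (force simp: J_def)
  then have J: "finite J" "j \<in> J"
    using goodD(2)[OF assms(1)] finite_subset below[OF s] by (blast, simp add: J_def)
  then have m: "Max J \<in> J" "j \<le> Max J" using Max_in by (blast, simp)
  moreover have "\<forall>q>Max J. (s, q) \<in> dom T \<longrightarrow> \<lceil>w\<rceil> \<le> val T (s, q)"
  proof (intro allI impI)
    fix q assume "Max J < q" "(s, q) \<in> dom T"
    then have "q \<notin> J" using Max_ge[OF J(1), of q] by linarith
    with \<open>(s, q) \<in> dom T\<close> show "\<lceil>w\<rceil> \<le> val T (s, q)" by (simp add: J_def)
  qed
  ultimately show "\<exists>j>s. (s, j) \<in> dom T \<and> val T (s, j) < \<lceil>w\<rceil> \<and> ((r, j) \<in> dom T \<longrightarrow> \<lceil>w\<rceil> \<le> val T (r, j)) \<and>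
       (\<forall>q>j. (s, q) \<in> dom T \<longrightarrow> \<lceil>w\<rceil> \<le> val T (s, q))"
    using assms(3) s right by (intro exI[of _ "Max J"]) (auto simp: J_def)
qed (use assms in simp)

lemma admissible_columnI:
  assumes "good T" "c = Suc s" "1 \<le> i" "i \<le> s"
    and left: "(i, s) \<in> dom T" "val T (i, s) < \<lceil>w\<rceil>"
    and up: "\<And>k. i \<le> k \<Longrightarrow> (k, c) \<in> dom T \<Longrightarrow> \<lceil>w\<rceil> \<le> val T (k, c)"
    and unprimed: "(s, c) \<in> dom T \<Longrightarrow> val T (s, c) = \<lceil>w\<rceil> \<Longrightarrow> entry T (s, c) \<in> \<int>"
  shows "admissible T (Column c) w"
proof -
  define J where "J = {k. (k, s) \<in> dom T \<and> val T (k, s) < \<lceil>w\<rceil>}"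
  have "J \<subseteq> fst ` dom T" by (force simp: J_def)
  then have J: "finite J" "i \<in> J"
    using goodD(2)[OF assms(1)] finite_subset left by (blast, simp add: J_def)
  then have m: "Max J \<in> J" "i \<le> Max J" using Max_in by (blast, simp)
  have max: "\<forall>k>Max J. (k, s) \<in> dom T \<longrightarrow> \<lceil>w\<rceil> \<le> val T (k, s)"
  proof (intro allI impI)
    fix k assume "Max J < k" "(k, s) \<in> dom T"
    then have "k \<notin> J" using Max_ge[OF J(1), of k] by linarith
    with \<open>(k, s) \<in> dom T\<close> show "\<lceil>w\<rceil> \<le> val T (k, s)" by (simp add: J_def)
  qed
  have "Max J \<le> s" using m(1) goodD(8)[OF assms(1)] by (simp add: J_def)
  with m max assms show ?thesis
    unfolding admissible.simps by (intro exI[of _ s] exI[of _ "Max J"]) (auto simp: J_def)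
qed

lemma at_least_Suc [simp]:
  "{b \<in> dom T. Suc r \<le> fst b} = rows_above T r" "{b \<in> dom T. Suc c \<le> snd b} = columns_right T c"
  by (auto simp: box_set_defs)

lemma reading_bounds:
  assumes "good T" "(r, c) \<in> dom T"
  shows "\<forall>x \<in> set (row_reading T (row_left T r c)). \<lceil>x\<rceil> < val T (r, c)"
    "\<forall>x \<in> set (row_reading T (row_right T r c)). val T (r, c) < \<lceil>x\<rceil>"
    "\<forall>x \<in> set (column_reading T (column_down T c r)). \<lceil>x\<rceil> < val T (r, c)"
    "\<forall>x \<in> set (column_reading T (column_up T c r)). val T (r, c) < \<lceil>x\<rceil>"
  using goodD(2)[OF assms(1)] goodD(5,6)[OF assms(1)] assms(2) by (auto simp: box_set_defs)

lemma not_in_box_sets [simp]: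
  "(r, c) \<notin> rows_above T r" "(r, c) \<notin> rows_below T r" "(r, c) \<notin> row_left T r c" "(r, c) \<notin> row_right T r c"
  "(r, c) \<notin> columns_right T c" "(r, c) \<notin> columns_left T c" "(r, c) \<notin> column_up T c r" "(r, c) \<notin> column_down T c r"
  "(r, Suc c) \<notin> rows_above T r" "(r, Suc c) \<notin> rows_below T r" "(r, Suc c) \<notin> row_left T r c"
  "(Suc r, c) \<notin> columns_right T c" "(Suc r, c) \<notin> columns_left T c" "(Suc r, c) \<notin> column_down T c r"
  "(r, c) \<notin> row_right T r (Suc c)" "(r, c) \<notin> column_up T c (Suc r)"
  by (simp_all add: box_set_defs)

lemma dom_upd_same [simp]: "b \<in> dom T \<Longrightarrow> insert b (dom T) = dom T"
  by blast

lemma row_left_diagonal [simp]: "good T \<Longrightarrow> row_left T r r = {}"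
  using goodD(8) by (force simp: box_set_defs)

lemma column_up_diagonal [simp]: "good T \<Longrightarrow> column_up T r r = {}"
  using goodD(8) by (force simp: box_set_defs)

lemma readings_swap_entries [simp]:
  assumes "finite S" "a \<notin> S" "b \<notin> S"
  shows "row_reading (swap_entries T a b) S = row_reading T S"
    "column_reading (swap_entries T a b) S = column_reading T S"
  using assms by (auto simp: swap_entries_def)

lemma box_sets_swap_entries [simp]:
  assumes "a \<in> dom T" "b \<in> dom T"
  shows "rows_above (swap_entries T a b) r = rows_above T r" "rows_below (swap_entries T a b) r = rows_below T r"
    "row_left (swap_entries T a b) r p = row_left T r p" "row_right (swap_entries T a b) r p = row_right T r p"
    "columns_right (swap_entries T a b) r = columns_right T r" "columns_left (swap_entries T a b) r = columns_left T r"
    "column_up (swap_entries T a b) r p = column_up T r p" "column_down (swap_entries T a b) r p = column_down T r p"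
  using assms by (simp_all add: box_set_defs)

context word_class
begin

definition valid :: "tableau \<times> segment \<times> rat \<Rightarrow> bool" where
  "valid s \<longleftrightarrow> (case s of (T, seg, w) \<Rightarrow> good T \<and> admissible T seg w \<and> state_word T seg w \<in> W)"

lemma validD:
  assumes "valid (T, seg, w)"
  shows "good T" "admissible T seg w" "state_word T seg w \<in> W" "w \<in> half_ints" "finite (dom T)"
proof -
  show "good T" "admissible T seg w" "state_word T seg w \<in> W" using assms by (simp_all add: valid_def)
  then show "w \<in> half_ints" "finite (dom T)" using half_intsD goodD(2) by (cases seg; fastforce)+
qed

section \<open>The state word under each kind of step, in both directions\<close>

lemma word_row_replace:
  assumes "good T" "(r, p) \<in> dom T" "\<And>q. q < p \<Longrightarrow> (r, q) \<in> dom T \<Longrightarrow> val T (r, q) < \<lceil>w\<rceil>" "\<lceil>w\<rceil> < val T (r, p)"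
  shows "state_word T (Row r) w \<in> W \<longleftrightarrow> state_word (T((r, p) \<mapsto> w)) (Row (Suc r)) (entry T (r, p)) \<in> W"
proof -
  note f = goodD(2)[OF assms(1)]
  let ?T = "T((r, p) \<mapsto> w)"
  have p: "(r, p) \<in> dom ?T" and f': "finite (dom ?T)" using assms(2) f by auto
  have l: "\<forall>x \<in> set (row_reading T (row_left T r p)). \<lceil>x\<rceil> < \<lceil>w\<rceil>"
    using assms(3) f by (auto simp: box_set_defs)
  show ?thesis
    using row_bump[OF l assms(4) reading_bounds(2)[OF assms(1,2)]]
      row_reading_at_least[OF f assms(2)] row_reading_less_Suc[OF f' p] assms(2) f
    by simp
qed

lemma word_column_replace:
  assumes "good T" "(p, c) \<in> dom T" "\<And>k. k < p \<Longrightarrow> (k, c) \<in> dom T \<Longrightarrow> val T (k, c) < \<lceil>w\<rceil>" "\<lceil>w\<rceil> < val T (p, c)"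
  shows "state_word T (Column c) w \<in> W \<longleftrightarrow> state_word (T((p, c) \<mapsto> w)) (Column (Suc c)) (entry T (p, c)) \<in> W"
proof -
  note f = goodD(2)[OF assms(1)]
  let ?T = "T((p, c) \<mapsto> w)"
  have p: "(p, c) \<in> dom ?T" and f': "finite (dom ?T)" using assms(2) f by auto
  have l: "\<forall>x \<in> set (column_reading T (column_down T c p)). \<lceil>x\<rceil> < \<lceil>w\<rceil>"
    using assms(3) f by (auto simp: box_set_defs)
  show ?thesis
    using column_bump[OF l assms(4) reading_bounds(4)[OF assms(1,2)]]
      column_reading_at_least[OF f assms(2)] column_reading_less_Suc[OF f' p] assms(2) f
    by simp
qed

text \<open>The braid leaves \<open>m\<close> unprimed. This agrees with switching primes because
  the old right neighbour turns out to be unprimed.\<close>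

lemma word_row_keep:
  assumes "good T" "(r, p) \<in> dom T" "(r, Suc p) \<in> dom T" "val T (r, p) = \<lceil>w\<rceil>" "val T (r, Suc p) = \<lceil>w\<rceil> + 1"
    and "state_word T (Row r) w \<in> W"
  shows "entry T (r, Suc p) \<in> \<int>"
    "state_word (swap_entries T (r, p) (r, Suc p)) (Row (Suc r)) (like w (\<lceil>w\<rceil> + 1)) \<in> W"
proof -
  note f = goodD(2)[OF assms(1)]
  let ?T = "swap_entries T (r, p) (r, Suc p)"
  have p: "(r, p) \<in> dom ?T" "(r, Suc p) \<in> dom ?T" and f': "finite (dom ?T)" using assms(2,3) f by auto
  have "row_reading T (rows_above T r) @ row_reading T (row_left T r p) @ entry T (r, p) #
      entry T (r, Suc p) # row_reading T (row_right T r (Suc p)) @ w # row_reading T (rows_below T r) \<in> W"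
    using assms(6) by (simp add: row_reading_at_least[OF f assms(2)] row_reading_right[OF f assms(3)])
  note * = row_pair[OF reading_bounds(1)[OF assms(1,2)] _ _ reading_bounds(2)[OF assms(1,3)] this]
  show i: "entry T (r, Suc p) \<in> \<int>"
    using *(1) assms by simp
  then have "like (entry T (r, Suc p)) (val T (r, p)) = of_int (val T (r, p))" by (simp add: like_def)
  with *(2) show "state_word ?T (Row (Suc r)) (like w (\<lceil>w\<rceil> + 1)) \<in> W"
    using assms f row_reading_less_Suc[OF f' p(1)] row_reading_right[OF f' p(2)] by (simp add: entry_swap_entries)
qed

lemma word_column_keep:
  assumes "good T" "(p, c) \<in> dom T" "(Suc p, c) \<in> dom T" "val T (p, c) = \<lceil>w\<rceil>" "val T (Suc p, c) = \<lceil>w\<rceil> + 1"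
    and "state_word T (Column c) w \<in> W"
  shows "entry T (Suc p, c) \<in> \<int>"
    "state_word (swap_entries T (p, c) (Suc p, c)) (Column (Suc c)) (like w (\<lceil>w\<rceil> + 1)) \<in> W"
proof -
  note f = goodD(2)[OF assms(1)]
  let ?T = "swap_entries T (p, c) (Suc p, c)"
  have p: "(p, c) \<in> dom ?T" "(Suc p, c) \<in> dom ?T" and f': "finite (dom ?T)" using assms(2,3) f by auto
  have "column_reading T (columns_left T c) @ w # column_reading T (column_up T c (Suc p)) @ entry T (Suc p, c) #
      entry T (p, c) # column_reading T (column_down T c p) @ column_reading T (columns_right T c) \<in> W"
    using assms(6) by (simp add: column_reading_at_least[OF f assms(2)] column_reading_up[OF f assms(3)])
  note * = column_pair[OF reading_bounds(3)[OF assms(1,2)] _ _ reading_bounds(4)[OF assms(1,3)] this]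
  show i: "entry T (Suc p, c) \<in> \<int>"
    using *(1) assms by simp
  then have "like (entry T (Suc p, c)) (val T (p, c)) = of_int (val T (p, c))" by (simp add: like_def)
  with *(2) show "state_word ?T (Column (Suc c)) (like w (\<lceil>w\<rceil> + 1)) \<in> W"
    using assms f column_reading_less_Suc[OF f' p(1)] column_reading_up[OF f' p(2)] by (simp add: entry_swap_entries)
qed

lemma word_row_keep_reverse:
  assumes "good T" "(r, p) \<in> dom T" "(r, Suc p) \<in> dom T" "val T (r, Suc p) = \<lceil>v\<rceil>" "val T (r, p) = \<lceil>v\<rceil> - 1"
    and "state_word T (Row (Suc r)) v \<in> W"
  shows "entry T (r, p) \<in> \<int>"
    "state_word (swap_entries T (r, p) (r, Suc p)) (Row r) (like v (\<lceil>v\<rceil> - 1)) \<in> W"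
proof -
  note f = goodD(2)[OF assms(1)]
  let ?T = "swap_entries T (r, p) (r, Suc p)"
  have p: "(r, p) \<in> dom ?T" "(r, Suc p) \<in> dom ?T" and f': "finite (dom ?T)" using assms(2,3) f by auto
  have "row_reading T (rows_above T r) @ v # row_reading T (row_left T r p) @ entry T (r, p) #
      entry T (r, Suc p) # row_reading T (row_right T r (Suc p)) @ row_reading T (rows_below T r) \<in> W"
    using assms(6) by (simp add: row_reading_less_Suc[OF f assms(2)] row_reading_right[OF f assms(3)])
  note * = row_pair_reverse[OF reading_bounds(1)[OF assms(1,2)] _ _ reading_bounds(2)[OF assms(1,3)] this]
  show i: "entry T (r, p) \<in> \<int>"
    using *(1) assms by simp
  then have "like (entry T (r, p)) (val T (r, Suc p)) = of_int (val T (r, Suc p))" by (simp add: like_def)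
  with *(2) show "state_word ?T (Row r) (like v (\<lceil>v\<rceil> - 1)) \<in> W"
    using assms f row_reading_at_least[OF f' p(1)] row_reading_right[OF f' p(2)] by (simp add: entry_swap_entries)
qed

lemma word_column_keep_reverse:
  assumes "good T" "(p, c) \<in> dom T" "(Suc p, c) \<in> dom T" "val T (Suc p, c) = \<lceil>v\<rceil>" "val T (p, c) = \<lceil>v\<rceil> - 1"
    and "state_word T (Column (Suc c)) v \<in> W"
  shows "entry T (p, c) \<in> \<int>"
    "state_word (swap_entries T (p, c) (Suc p, c)) (Column c) (like v (\<lceil>v\<rceil> - 1)) \<in> W"
proof -
  note f = goodD(2)[OF assms(1)]
  let ?T = "swap_entries T (p, c) (Suc p, c)"
  have p: "(p, c) \<in> dom ?T" "(Suc p, c) \<in> dom ?T" and f': "finite (dom ?T)" using assms(2,3) f by auto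
  have "column_reading T (columns_left T c) @ column_reading T (column_up T c (Suc p)) @ entry T (Suc p, c) #
      entry T (p, c) # column_reading T (column_down T c p) @ v # column_reading T (columns_right T c) \<in> W"
    using assms(6) by (simp add: column_reading_less_Suc[OF f assms(2)] column_reading_up[OF f assms(3)])
  then have "(column_reading T (columns_left T c)) @ column_reading T (column_up T c (Suc p)) @ entry T (Suc p, c) #
      entry T (p, c) # column_reading T (column_down T c p) @ v # column_reading T (columns_right T c) \<in> W"
    by simp
  note * = column_pair_reverse[OF reading_bounds(3)[OF assms(1,2)] _ _ reading_bounds(4)[OF assms(1,3)] this]
  show i: "entry T (p, c) \<in> \<int>"
    using *(1) assms by simp
  then have "like (entry T (p, c)) (val T (Suc p, c)) = of_int (val T (Suc p, c))" by (simp add: like_def)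
  with *(2) show "state_word ?T (Column c) (like v (\<lceil>v\<rceil> - 1)) \<in> W"
    using assms f column_reading_at_least[OF f' p(1)] column_reading_up[OF f' p(2)] by (simp add: entry_swap_entries)
qed

text \<open>After the bump, \<open>m\<close> and then \<open>w\<close> move to the front past the
  rows above. Exchanging these two first letters leaves \<open>w\<close> unprimed, ready for the
  diagonal, and gives its prime to \<open>m\<close>. The turn is completed by
  \<open>diagonal_transition\<close>.\<close>

lemma word_row_diagonal:
  assumes "good T" "(r, r) \<in> dom T" "\<lceil>w\<rceil> < val T (r, r)" "w \<in> half_ints"
    and "good (T((r, r) \<mapsto> of_int \<lceil>w\<rceil>))"
  shows "state_word T (Row r) w \<in> W \<longleftrightarrow>
    state_word (T((r, r) \<mapsto> of_int \<lceil>w\<rceil>)) (Column (Suc r)) (like w (val T (r, r))) \<in> W"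
proof -
  note f = goodD(2)[OF assms(1)]
  let ?T = "T((r, r) \<mapsto> of_int \<lceil>w\<rceil>)"
  define A where "A = row_reading T (rows_above T r)"
  define q where "q = row_reading T (row_right T r r)"
  define B where "B = row_reading T (rows_below T r)"
  define m where "m = entry T (r, r)"
  define v where "v = like w \<lceil>m\<rceil>"
  \<comment> \<open>Boxes in higher rows lie strictly north-east of a diagonal box.\<close>
  have far: "\<forall>x \<in> set A. \<lceil>m\<rceil> + 2 \<le> \<lceil>x\<rceil>"
  proof
    fix x assume "x \<in> set A"
    then have "x \<in> entry T ` rows_above T r" using f by (simp add: A_def)
    then obtain i j where ij: "(i, j) \<in> dom T" "r < i" "x = entry T (i, j)"
      unfolding rows_above_def by force
    then show "\<lceil>m\<rceil> + 2 \<le> \<lceil>x\<rceil>"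
      using val_south_west[OF assms(1,2) ij(1)] goodD(8)[OF assms(1) ij(1)] by (simp add: m_def)
  qed
  have far': "\<forall>x \<in> set A. 2 \<le> \<bar>\<lceil>m\<rceil> - \<lceil>x\<rceil>\<bar>" "\<forall>x \<in> set A. 2 \<le> \<bar>\<lceil>w\<rceil> - \<lceil>x\<rceil>\<bar>"
    using far assms(3) unfolding m_def by fastforce+
  have m: "m \<in> \<int>" using goodD(4)[OF assms(1,2)] by (simp add: m_def)
  have wm: "\<lceil>w\<rceil> < \<lceil>m\<rceil>" "\<forall>x \<in> set q. \<lceil>m\<rceil> < \<lceil>x\<rceil>"
    using assms(3) reading_bounds(2)[OF assms(1,2)] by (simp_all add: m_def q_def)
  have "state_word T (Row r) w = A @ [] @ m # q @ w # B"
    using row_reading_at_least[OF f assms(2)] assms(1) by (simp add: A_def m_def q_def B_def)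
  also have "\<dots> \<in> W \<longleftrightarrow> A @ m # [] @ w # q @ B \<in> W"
    by (rule row_bump) (use wm in simp_all)
  also have "\<dots> \<longleftrightarrow> m # A @ w # q @ B \<in> W"
    using move_right[OF far'(1), of "[]"] by simp
  also have "\<dots> \<longleftrightarrow> m # w # A @ q @ B \<in> W"
    using move_right[OF far'(2), of "[m]"] by simp
  also have "\<dots> \<longleftrightarrow> of_int \<lceil>w\<rceil> # v # A @ q @ B \<in> W"
    using m assms(4) by (intro swap_first_iff) (simp_all add: v_def like_ceiling like_cong[of "like w \<lceil>m\<rceil>" w])
  also have "\<dots> \<longleftrightarrow> state_word ?T (Column (Suc r)) v \<in> W"
    using diagonal_transition[OF assms(5), of r v] assms(2) f wm by (simp add: v_def A_def q_def B_def)
  finally show ?thesis by (simp add: v_def m_def)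
qed

text \<open>Everything above row \<open>r\<close> is governed by the next diagonal box: its entry
  \<open>g\<close> exceeds \<open>v\<close>, and all other entries above exceed \<open>g\<close>.
  Either \<open>g\<close> is the next integer or the whole of \<open>A\<close> is far from
  \<open>v\<close>, which are the two alternatives of \<open>diagonal_pair\<close>.\<close>

lemma rows_above_structure:
  assumes "good T" "(r, Suc r) \<in> dom T" "val T (r, Suc r) = \<lceil>v\<rceil>" "A = row_reading T (rows_above T r)"
  shows "(\<forall>x \<in> set A. \<lceil>v\<rceil> + 2 \<le> \<lceil>x\<rceil>) \<or> (\<exists>A1 g A2. A = A1 @ g # A2 \<and> \<lceil>g\<rceil> = \<lceil>v\<rceil> + 1 \<and> g \<in> \<int> \<and>
      (\<forall>x \<in> set (A1 @ A2). \<lceil>g\<rceil> + 1 \<le> \<lceil>x\<rceil>) \<and> (\<forall>x \<in> set A1. \<lceil>g\<rceil> + 2 \<le> \<lceil>x\<rceil>))"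
proof -
  note f = goodD(2)[OF assms(1)]
  have diag: "(Suc r, Suc r) \<in> dom T" if "b \<in> rows_above T r" for b
  proof -
    have "b \<in> dom T" "r < fst b" using that by (simp_all add: rows_above_def)
    then show ?thesis
      using goodD(8)[OF assms(1), of "fst b" "snd b"] goodD(9)[OF assms(1), of "fst b" "snd b" "Suc r" "Suc r"] by simp
  qed
  show ?thesis
  proof (cases "(Suc r, Suc r) \<in> dom T")
    case False
    then have "rows_above T r = {}" using diag by blast
    then show ?thesis by (simp add: assms(4))
  next
    case True
    define A1 where "A1 = row_reading T (rows_above T (Suc r))"
    define A2 where "A2 = row_reading T (row_right T (Suc r) (Suc r))"
    define g where "g = entry T (Suc r, Suc r)"
    have A: "A = A1 @ g # A2"
      using row_reading_at_least[OF f True] assms(1,4) by (simp add: A1_def A2_def g_def)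
    have 1: "\<lceil>g\<rceil> + 2 \<le> \<lceil>x\<rceil>" if x: "x \<in> set A1" for x
    proof -
      have "x \<in> entry T ` rows_above T (Suc r)" using f x by (simp add: A1_def)
      then obtain i j where ij: "(i, j) \<in> dom T" "Suc r < i" "x = entry T (i, j)"
        unfolding rows_above_def by force
      then show ?thesis
        using val_south_west[OF assms(1) True ij(1)] goodD(8)[OF assms(1) ij(1)] by (simp add: g_def)
    qed
    have 2: "\<lceil>g\<rceil> + 1 \<le> \<lceil>x\<rceil>" if "x \<in> set A2" for x
      using reading_bounds(2)[OF assms(1) True] that by (auto simp: A2_def g_def)
    have "\<lceil>v\<rceil> < \<lceil>g\<rceil>" using goodD(6)[OF assms(1,2) True] assms(3) by (simp add: g_def)
    moreover have "g \<in> \<int>" using goodD(4)[OF assms(1) True] by (simp add: g_def)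
    moreover have 3: "\<lceil>g\<rceil> + 1 \<le> \<lceil>x\<rceil>" if "x \<in> set (A1 @ A2)" for x
      using 1[of x] 2[of x] that by auto
    moreover have "\<lceil>g\<rceil> \<le> \<lceil>x\<rceil>" if "x \<in> set A" for x
      using 3[of x] that by (auto simp: A)
    ultimately consider "\<lceil>g\<rceil> = \<lceil>v\<rceil> + 1" | "\<forall>x \<in> set A. \<lceil>v\<rceil> + 2 \<le> \<lceil>x\<rceil>" by fastforce
    then show ?thesis
    proof cases
      case 1
      then show ?thesis
        using A \<open>g \<in> \<int>\<close> 3 \<open>\<And>x. x \<in> set A1 \<Longrightarrow> \<lceil>g\<rceil> + 2 \<le> \<lceil>x\<rceil>\<close> by blast
    qed blast
  qed
qed

text \<open>Both entries turn out to be unprimed, so the braid of the row leaves the tableau as it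
  is and only moves the letter. Then \<open>diagonal_pair\<close> and
  \<open>diagonal_transition\<close> carry the letter from the row to the column.\<close>

lemma word_row_diagonal_keep:
  assumes "good T" "(r, r) \<in> dom T" "(r, Suc r) \<in> dom T" "val T (r, r) = \<lceil>w\<rceil>" "val T (r, Suc r) = \<lceil>w\<rceil> + 1"
    and "state_word T (Row r) w \<in> W"
  shows "entry T (r, Suc r) \<in> \<int>" "state_word T (Column (Suc r)) (like w (\<lceil>w\<rceil> + 1)) \<in> W"
proof -
  note f = goodD(2)[OF assms(1)]
  show M: "entry T (r, Suc r) \<in> \<int>" using word_row_keep(1)[OF assms] .
  have m: "entry T (r, r) \<in> \<int>" using goodD(4)[OF assms(1,2)] .
  define v where "v = like w (\<lceil>w\<rceil> + 1)"
  have v: "val T (r, Suc r) = \<lceil>v\<rceil>" "val T (r, r) < \<lceil>v\<rceil>" "val T (r, r) = \<lceil>v\<rceil> - 1" using assms by (simp_all add: v_def)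
  note pair = diagonal_pair(1)[OF v(1) rows_above_structure[OF assms(1,3) v(1) refl] m v(2)]
  have "state_word T (Row (Suc r)) v \<in> W"
    using word_row_keep(2)[OF assms] swap_entries_unprimed[OF assms(1-3) m M] by (simp add: v_def)
  then show "state_word T (Column (Suc r)) v \<in> W"
    using pair v(3) diagonal_transition[OF assms(1,2) v(2)] assms(1)
    by (simp add: row_reading_less_Suc[OF f assms(2)] row_reading_right[OF f assms(3)])
qed

text \<open>That the diagonal entry is smaller by exactly one comes from the word: the second half
  of \<open>diagonal_pair\<close> excludes a larger difference.\<close>

lemma word_row_diagonal_keep_reverse:
  assumes "good T" "(r, r) \<in> dom T" "(r, Suc r) \<in> dom T" "val T (r, Suc r) = \<lceil>v\<rceil>" "entry T (r, Suc r) \<in> \<int>"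
    and "state_word T (Column (Suc r)) v \<in> W"
  shows "val T (r, r) = \<lceil>v\<rceil> - 1" "state_word T (Row r) (like v (\<lceil>v\<rceil> - 1)) \<in> W"
proof -
  note f = goodD(2)[OF assms(1)]
  have m: "entry T (r, r) \<in> \<int>" using goodD(4)[OF assms(1,2)] .
  have lt: "val T (r, r) < \<lceil>v\<rceil>" using goodD(5)[OF assms(1-3)] assms(4) by simp
  note pair = diagonal_pair(2)[OF assms(4) rows_above_structure[OF assms(1,3,4) refl] m lt]
  have *: "val T (r, r) = \<lceil>v\<rceil> - 1 \<and> state_word T (Row (Suc r)) v \<in> W"
    using pair assms(6) diagonal_transition[OF assms(1,2) lt] assms(1)
    by (simp add: row_reading_less_Suc[OF f assms(2)] row_reading_right[OF f assms(3)])
  then show "val T (r, r) = \<lceil>v\<rceil> - 1" by simp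
  with * show "state_word T (Row r) (like v (\<lceil>v\<rceil> - 1)) \<in> W"
    using word_row_keep_reverse(2)[OF assms(1-4)] swap_entries_unprimed[OF assms(1-3) m assms(5)] by simp
qed


subsection \<open>Forward steps\<close>

lemma valid_row_replace:
  assumes "valid (T, Row r, w)" "(r, p) \<in> dom T" "r < p"
    and left: "\<And>q. q < p \<Longrightarrow> (r, q) \<in> dom T \<Longrightarrow> val T (r, q) < \<lceil>w\<rceil>" and lt: "\<lceil>w\<rceil> < val T (r, p)"
  shows "valid (T((r, p) \<mapsto> w), Row (Suc r), entry T (r, p))"
proof -
  note v = validD[OF assms(1)]
  note g = goodD[OF v(1)]
  let ?T = "T((r, p) \<mapsto> w)"
  have r: "1 \<le> r" using v(2) by simp
  have row: "(r, q) \<in> dom T \<and> val T (r, q) < \<lceil>w\<rceil>" if "r \<le> q" "q < p" for q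
  proof -
    have "(r, q) \<in> dom T" using g(9)[OF assms(2) r order.refl that(1)] that(2) by simp
    then show ?thesis using left that by simp
  qed
  have good: "good ?T"
  proof (rule good_replace[OF v(1) assms(2) v(4)])
    fix q assume q: "(r, q) \<in> dom T" "p < q"
    show "\<lceil>w\<rceil> < val T (r, q)" using g(5)[OF assms(2) q] lt by simp
  next
    fix k assume k: "(k, p) \<in> dom T" "k < r"
    show "val T (k, p) < \<lceil>w\<rceil>"
      by (rule row_landing_below[OF v(1,2) _ k(2,1)]) (use assms(3) row in auto)
  next
    fix k assume k: "(k, p) \<in> dom T" "r < k"
    show "\<lceil>w\<rceil> < val T (k, p)" using g(6)[OF assms(2) k] lt by simp
  qed (use assms(3) left in auto)
  moreover have "admissible ?T (Row (Suc r)) (entry T (r, p))"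
  proof (rule admissible_rowI[OF good, of _ p])
    fix q assume q: "p \<le> q" "(Suc r, q) \<in> dom ?T"
    then have q': "(Suc r, q) \<in> dom T" using assms(2) by auto
    have "(Suc r, p) \<in> dom T" using g(9)[OF q', of "Suc r" p] assms(3) q(1) by simp
    then have "val T (r, p) < val T (Suc r, p)" "val T (Suc r, p) \<le> val T (Suc r, q)"
      using g(6)[OF assms(2), of "Suc r"] val_row_mono[OF v(1) _ q' q(1)] by auto
    then show "\<lceil>entry T (r, p)\<rceil> \<le> val ?T (Suc r, q)" by simp
  qed (use assms(2,3) lt in auto)
  moreover have "state_word ?T (Row (Suc r)) (entry T (r, p)) \<in> W"
    using word_row_replace[OF v(1) assms(2) left lt] v(3) by simp
  ultimately show ?thesis by (simp add: valid_def)
qed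

lemma valid_row_diagonal:
  assumes "valid (T, Row r, w)" "(r, r) \<in> dom T" and lt: "\<lceil>w\<rceil> < val T (r, r)"
  shows "valid (T((r, r) \<mapsto> of_int \<lceil>w\<rceil>), Column (Suc r), like w (val T (r, r)))"
proof -
  note v = validD[OF assms(1)]
  note g = goodD[OF v(1)]
  let ?T = "T((r, r) \<mapsto> of_int \<lceil>w\<rceil>)"
  have r: "1 \<le> r" using v(2) by simp
  have good: "good ?T"
  proof (rule good_replace[OF v(1) assms(2)])
    fix q assume q: "(r, q) \<in> dom T" "q < r"
    then show "val T (r, q) < \<lceil>of_int \<lceil>w\<rceil> :: rat\<rceil>" using g(8)[OF q(1)] by simp
  next
    fix q assume q: "(r, q) \<in> dom T" "r < q"
    show "\<lceil>of_int \<lceil>w\<rceil> :: rat\<rceil> < val T (r, q)" using g(5)[OF assms(2) q] lt by simp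
  next
    fix k assume k: "(k, r) \<in> dom T" "k < r"
    have "val T (k, r) < \<lceil>w\<rceil>"
      by (rule row_landing_below[OF v(1,2) _ k(2,1)]) auto
    then show "val T (k, r) < \<lceil>of_int \<lceil>w\<rceil> :: rat\<rceil>" by simp
  next
    fix k assume k: "(k, r) \<in> dom T" "r < k"
    show "\<lceil>of_int \<lceil>w\<rceil> :: rat\<rceil> < val T (k, r)" using g(8)[OF k(1)] k(2) by simp
  qed auto
  moreover have "admissible ?T (Column (Suc r)) (like w (val T (r, r)))"
  proof (rule admissible_columnI[OF good refl r order.refl])
    fix k assume k: "r \<le> k" "(k, Suc r) \<in> dom ?T"
    then have k': "(k, Suc r) \<in> dom T" using assms(2) by auto
    have "(r, Suc r) \<in> dom T" using g(9)[OF k', of r "Suc r"] r k(1) by simp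
    then have "val T (r, r) < val T (r, Suc r)" "val T (r, Suc r) \<le> val T (k, Suc r)"
      using g(5)[OF assms(2), of "Suc r"] val_column_mono[OF v(1) _ k' k(1)] by auto
    then show "\<lceil>like w (val T (r, r))\<rceil> \<le> val ?T (k, Suc r)" by simp
  next
    \<comment> \<open>The corner clause of admissibility is vacuous here, since the right neighbour
      exceeds the displaced diagonal entry.\<close>
    assume "(r, Suc r) \<in> dom ?T" and eq: "val ?T (r, Suc r) = \<lceil>like w (val T (r, r))\<rceil>"
    then have "(r, Suc r) \<in> dom T" by auto
    with eq show "entry ?T (r, Suc r) \<in> \<int>" using g(5)[OF assms(2), of "Suc r"] by simp
  qed (use assms(2) lt in auto)
  moreover have "state_word ?T (Column (Suc r)) (like w (val T (r, r))) \<in> W"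
    using word_row_diagonal[OF v(1) assms(2) lt v(4) good] v(3) by simp
  ultimately show ?thesis by (simp add: valid_def)
qed

lemma valid_row_keep:
  assumes "valid (T, Row r, w)" "(r, p) \<in> dom T" "r < p" "(r, Suc p) \<in> dom T"
    and eq: "val T (r, p) = \<lceil>w\<rceil>" "val T (r, Suc p) = \<lceil>w\<rceil> + 1"
  shows "valid (swap_entries T (r, p) (r, Suc p), Row (Suc r), like w (\<lceil>w\<rceil> + 1))"
proof -
  note v = validD[OF assms(1)]
  note g = goodD[OF v(1)]
  let ?T = "swap_entries T (r, p) (r, Suc p)"
  note word = word_row_keep[OF v(1) assms(2,4) eq v(3)]
  have dom: "dom ?T = dom T" using assms(2,4) by simp
  have good: "good ?T"
    by (rule good_swap_entries) (use v(1) assms(2-4) in auto)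
  moreover have "admissible ?T (Row (Suc r)) (like w (\<lceil>w\<rceil> + 1))"
  proof (rule admissible_rowI[OF good, of _ p])
    fix q assume q: "p \<le> q" "(Suc r, q) \<in> dom ?T"
    then have q': "(Suc r, q) \<in> dom T" using dom by simp
    have "(Suc r, p) \<in> dom T" using g(9)[OF q', of "Suc r" p] assms(3) q(1) by simp
    then have "val T (r, p) < val T (Suc r, p)" "val T (Suc r, p) \<le> val T (Suc r, q)"
      using g(6)[OF assms(2), of "Suc r"] val_row_mono[OF v(1) _ q' q(1)] by auto
    then show "\<lceil>like w (\<lceil>w\<rceil> + 1)\<rceil> \<le> val ?T (Suc r, q)" using eq by simp
  qed (use assms(2,3) dom eq in auto)
  ultimately show ?thesis using word by (simp add: valid_def)
qed

lemma valid_row_diagonal_keep: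
  assumes "valid (T, Row r, w)" "(r, r) \<in> dom T" "(r, Suc r) \<in> dom T"
    and eq: "val T (r, r) = \<lceil>w\<rceil>" "val T (r, Suc r) = \<lceil>w\<rceil> + 1"
  shows "valid (swap_entries T (r, r) (r, Suc r), Column (Suc r), like w (\<lceil>w\<rceil> + 1))"
proof -
  note v = validD[OF assms(1)]
  note g = goodD[OF v(1)]
  note word = word_row_diagonal_keep[OF v(1) assms(2,3) eq v(3)]
  have T: "swap_entries T (r, r) (r, Suc r) = T"
    by (rule swap_entries_unprimed[OF v(1) assms(2,3) g(4)[OF assms(2)] word(1)])
  have r: "1 \<le> r" using v(2) by simp
  have "admissible T (Column (Suc r)) (like w (\<lceil>w\<rceil> + 1))"
  proof (rule admissible_columnI[OF v(1) refl r order.refl assms(2)])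
    fix k assume k: "r \<le> k" "(k, Suc r) \<in> dom T"
    show "\<lceil>like w (\<lceil>w\<rceil> + 1)\<rceil> \<le> val T (k, Suc r)"
      using val_column_mono[OF v(1) assms(3) k(2,1)] eq by simp
  qed (use eq word in auto)
  then show ?thesis unfolding T using word v(1) by (simp add: valid_def)
qed

lemma column_state_landing:
  assumes "valid (T, Column c, w)" "(p, c) \<in> dom T"
    and "\<And>k. k < p \<Longrightarrow> (k, c) \<in> dom T \<Longrightarrow> val T (k, c) < \<lceil>w\<rceil>"
  obtains s where "c = Suc s" "1 \<le> p" "p \<le> s" "(p, s) \<in> dom T" "val T (p, s) < \<lceil>w\<rceil>"
proof -
  note v = validD[OF assms(1)]
  obtain s where s: "c = Suc s" using v(2) by auto
  have p: "1 \<le> p" "p \<le> c" using goodD(7,8)[OF v(1) assms(2)] by simp_all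
  have "(k, c) \<in> dom T \<and> val T (k, c) < \<lceil>w\<rceil>" if "1 \<le> k" "k < p" for k
  proof -
    have "(k, c) \<in> dom T" using goodD(9)[OF v(1) assms(2) that(1)] that(2) p by simp
    then show ?thesis using assms(3) that by simp
  qed
  then have "p \<le> s \<and> (p, s) \<in> dom T \<and> val T (p, s) < \<lceil>w\<rceil>"
    using column_landing[OF v(1), of s w p] v(2) p(1) s by simp
  then show ?thesis using that s p by simp
qed

lemma valid_column_replace:
  assumes "valid (T, Column c, w)" "(p, c) \<in> dom T"
    and down: "\<And>k. k < p \<Longrightarrow> (k, c) \<in> dom T \<Longrightarrow> val T (k, c) < \<lceil>w\<rceil>" and lt: "\<lceil>w\<rceil> < val T (p, c)"
  shows "valid (T((p, c) \<mapsto> w), Column (Suc c), entry T (p, c))"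
proof -
  note v = validD[OF assms(1)]
  note g = goodD[OF v(1)]
  let ?T = "T((p, c) \<mapsto> w)"
  obtain s where s: "c = Suc s" "1 \<le> p" "p \<le> s" "(p, s) \<in> dom T" "val T (p, s) < \<lceil>w\<rceil>"
    using column_state_landing[OF assms(1,2) down] .
  have good: "good ?T"
  proof (rule good_replace[OF v(1) assms(2) v(4)])
    fix q assume q: "(p, q) \<in> dom T" "q < c"
    then show "val T (p, q) < \<lceil>w\<rceil>" using val_row_mono[OF v(1) q(1) s(4)] s by simp
  next
    fix q assume q: "(p, q) \<in> dom T" "c < q"
    show "\<lceil>w\<rceil> < val T (p, q)" using g(5)[OF assms(2) q] lt by simp
  next
    fix k assume k: "(k, c) \<in> dom T" "p < k"
    show "\<lceil>w\<rceil> < val T (k, c)" using g(6)[OF assms(2) k] lt by simp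
  qed (use s down in auto)
  moreover have "admissible ?T (Column (Suc c)) (entry T (p, c))"
  proof (rule admissible_columnI[OF good refl s(2)])
    fix k assume k: "p \<le> k" "(k, Suc c) \<in> dom ?T"
    then have k': "(k, Suc c) \<in> dom T" using assms(2) by auto
    have "(p, Suc c) \<in> dom T" using g(9)[OF k', of p "Suc c"] s k(1) by simp
    then have "val T (p, c) < val T (p, Suc c)" "val T (p, Suc c) \<le> val T (k, Suc c)"
      using g(5)[OF assms(2), of "Suc c"] val_column_mono[OF v(1) _ k' k(1)] by auto
    then show "\<lceil>entry T (p, c)\<rceil> \<le> val ?T (k, Suc c)" by simp
  next
    assume "(c, Suc c) \<in> dom ?T" and eq: "val ?T (c, Suc c) = \<lceil>entry T (p, c)\<rceil>"
    then have c: "(c, Suc c) \<in> dom T" by auto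
    \<comment> \<open>The corner lies to the right of \<open>(c, c)\<close>, which lies above
      \<open>(p, c)\<close>; so its entry exceeds the displaced letter and the clause is
      vacuous.\<close>
    have "(c, c) \<in> dom T" using g(9)[OF c, of c c] s by simp
    with s have "val T (p, c) < val T (c, c)" using g(6)[OF assms(2), of c] by simp
    also have "\<dots> < val T (c, Suc c)" using g(5)[OF \<open>(c, c) \<in> dom T\<close> c] by simp
    finally show "entry ?T (c, Suc c) \<in> \<int>" using eq by simp
  qed (use assms(2) lt s in auto)
  moreover have "state_word ?T (Column (Suc c)) (entry T (p, c)) \<in> W"
    using word_column_replace[OF v(1) assms(2) down lt] v(3) by simp
  ultimately show ?thesis by (simp add: valid_def)
qed

lemma valid_column_keep:
  assumes "valid (T, Column c, w)" "(p, c) \<in> dom T" "(Suc p, c) \<in> dom T"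
    and eq: "val T (p, c) = \<lceil>w\<rceil>" "val T (Suc p, c) = \<lceil>w\<rceil> + 1"
  shows "valid (swap_entries T (p, c) (Suc p, c), Column (Suc c), like w (\<lceil>w\<rceil> + 1))"
proof -
  note v = validD[OF assms(1)]
  note g = goodD[OF v(1)]
  let ?T = "swap_entries T (p, c) (Suc p, c)"
  note word = word_column_keep[OF v(1) assms(2,3) eq v(3)]
  have dom: "dom ?T = dom T" using assms(2,3) by simp
  have "val T (k, c) < \<lceil>w\<rceil>" if "k < p" "(k, c) \<in> dom T" for k
    using g(6)[OF that(2) assms(2) that(1)] eq by simp
  then obtain s where s: "c = Suc s" "1 \<le> p" "p \<le> s" "(p, s) \<in> dom T" "val T (p, s) < \<lceil>w\<rceil>"
    using column_state_landing[OF assms(1,2)] by metis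
  have good: "good ?T"
  proof (rule good_swap_entries)
    \<comment> \<open>The upper box is diagonal and would receive the prime of
      \<open>(p, c)\<close>, which is then the corner box that admissibility declares
      unprimed.\<close>
    assume "fst (Suc p, c) = snd (Suc p, c)"
    then show "entry T (p, c) \<in> \<int>" using v(2) s assms(2) eq by auto
  qed (use v(1) assms(2,3) s in auto)
  moreover have "admissible ?T (Column (Suc c)) (like w (\<lceil>w\<rceil> + 1))"
  proof (rule admissible_columnI[OF good refl s(2)])
    fix k assume k: "p \<le> k" "(k, Suc c) \<in> dom ?T"
    then have k': "(k, Suc c) \<in> dom T" using dom by simp
    have "(p, Suc c) \<in> dom T" using g(9)[OF k', of p "Suc c"] s k(1) by simp
    then have "val T (p, c) < val T (p, Suc c)" "val T (p, Suc c) \<le> val T (k, Suc c)"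
      using g(5)[OF assms(2), of "Suc c"] val_column_mono[OF v(1) _ k' k(1)] by auto
    then show "\<lceil>like w (\<lceil>w\<rceil> + 1)\<rceil> \<le> val ?T (k, Suc c)" using eq by simp
  next
    assume "(c, Suc c) \<in> dom ?T" and e: "val ?T (c, Suc c) = \<lceil>like w (\<lceil>w\<rceil> + 1)\<rceil>"
    then have c: "(c, Suc c) \<in> dom T" using dom by simp
    have "(c, c) \<in> dom T" using g(9)[OF c, of c c] s by simp
    then have "val T (Suc p, c) \<le> val T (c, c)" using val_column_mono[OF v(1) assms(3), of c] s by simp
    also have "\<dots> < val T (c, Suc c)" using g(5)[OF \<open>(c, c) \<in> dom T\<close> c] by simp
    finally show "entry ?T (c, Suc c) \<in> \<int>" using e eq by simp
  qed (use assms(2) dom eq s in auto)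
  ultimately show ?thesis using word by (simp add: valid_def)
qed

lemma valid_step: "step s t \<Longrightarrow> valid s \<Longrightarrow> valid t"
  by (induction rule: step.induct)
    (blast intro: valid_row_replace valid_row_diagonal valid_row_keep valid_row_diagonal_keep
      valid_column_replace valid_column_keep)+

end

subsection \<open>Backward steps\<close>

text \<open>The displaced letter \<open>v\<close> exceeds what now stands in its old place, and all
  entries after that are at least \<open>v\<close>; hence the maximum. If the next entry is
  \<open>v\<close> itself, a pair was kept, otherwise an entry was overwritten. In a column,
  \<open>p = s\<close> is the diagonal box, where a letter inserted into a column cannot have
  landed.\<close>

fun unstep :: "tableau \<times> segment \<times> rat \<Rightarrow> tableau \<times> segment \<times> rat" where
  "unstep (T, Row r, v) = (let s = r - 1; p = Max {q. (s, q) \<in> dom T \<and> val T (s, q) < \<lceil>v\<rceil>} in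
     if (s, Suc p) \<in> dom T \<and> val T (s, Suc p) = \<lceil>v\<rceil>
     then (swap_entries T (s, p) (s, Suc p), Row s, like v (\<lceil>v\<rceil> - 1))
     else (T((s, p) \<mapsto> v), Row s, entry T (s, p)))"
| "unstep (T, Column c, v) = (let s = c - 1; p = Max {k. (k, s) \<in> dom T \<and> val T (k, s) < \<lceil>v\<rceil>} in
     if p = s then
       if (s, c) \<in> dom T \<and> val T (s, c) = \<lceil>v\<rceil>
       then (swap_entries T (s, s) (s, c), Row s, like v (\<lceil>v\<rceil> - 1))
       else (T((s, s) \<mapsto> of_int \<lceil>v\<rceil>), Row s, like v (val T (s, s)))
     else
       if (Suc p, s) \<in> dom T \<and> val T (Suc p, s) = \<lceil>v\<rceil>
       then (swap_entries T (p, s) (Suc p, s), Column s, like v (\<lceil>v\<rceil> - 1))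
       else (T((p, s) \<mapsto> v), Column s, entry T (p, s)))"

lemma Max_row_eq:
  assumes "good T" "(r, p) \<in> dom T" "val T (r, p) < x"
    and "\<And>q. p < q \<Longrightarrow> (r, q) \<in> dom T \<Longrightarrow> x \<le> val T (r, q)"
  shows "Max {q. (r, q) \<in> dom T \<and> val T (r, q) < x} = p"
proof (rule Max_eqI)
  have "{q. (r, q) \<in> dom T \<and> val T (r, q) < x} \<subseteq> snd ` dom T" by force
  then show "finite {q. (r, q) \<in> dom T \<and> val T (r, q) < x}"
    using goodD(2)[OF assms(1)] finite_subset by blast
qed (use assms in \<open>force simp: not_less\<close>)+

lemma Max_column_eq:
  assumes "good T" "(p, c) \<in> dom T" "val T (p, c) < x"
    and "\<And>k. p < k \<Longrightarrow> (k, c) \<in> dom T \<Longrightarrow> x \<le> val T (k, c)"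
  shows "Max {k. (k, c) \<in> dom T \<and> val T (k, c) < x} = p"
proof (rule Max_eqI)
  have "{k. (k, c) \<in> dom T \<and> val T (k, c) < x} \<subseteq> fst ` dom T" by force
  then show "finite {k. (k, c) \<in> dom T \<and> val T (k, c) < x}"
    using goodD(2)[OF assms(1)] finite_subset by blast
qed (use assms in \<open>force simp: not_less\<close>)+

lemma like_like [simp]: "like (like x i) = like x"
  by (rule like_cong) simp

lemma upd_entry [simp]: "b \<in> dom T \<Longrightarrow> T(b \<mapsto> entry T b) = T"
  by auto

context word_class
begin

lemma unstep_step:
  assumes "step s t" "valid s"
  shows "unstep t = s"
proof -
  have "valid t" using valid_step assms by blast
  with assms show ?thesis
  proof (induction rule: step.induct)
    case (row_replace r p T w)
    note v = validD[OF row_replace(5)] and v' = validD[OF row_replace(6)]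
    let ?T = "T((r, p) \<mapsto> w)"
    have "Max {q. (r, q) \<in> dom ?T \<and> val ?T (r, q) < val T (r, p)} = p"
      by (rule Max_row_eq[OF v'(1)]) (use row_replace goodD(5)[OF v(1) row_replace(1)] in \<open>auto intro: less_imp_le\<close>)
    moreover have "\<not> ((r, Suc p) \<in> dom ?T \<and> val ?T (r, Suc p) = val T (r, p))"
    proof
      assume *: "(r, Suc p) \<in> dom ?T \<and> val ?T (r, Suc p) = val T (r, p)"
      then have "(r, Suc p) \<in> dom T" by simp
      with * show False using goodD(5)[OF v(1) row_replace(1), of "Suc p"] by simp
    qed
    ultimately show ?case using row_replace(1) by (auto simp add: Let_def)
  next
    case (row_diagonal r T w)
    note v = validD[OF row_diagonal(3)] and v' = validD[OF row_diagonal(4)]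
    let ?T = "T((r, r) \<mapsto> of_int \<lceil>w\<rceil>)"
    have "Max {k. (k, r) \<in> dom ?T \<and> val ?T (k, r) < val T (r, r)} = r"
      by (rule Max_column_eq[OF v'(1)]) (use row_diagonal goodD(8)[OF v(1)] in \<open>force\<close>)+
    moreover have "\<not> ((r, Suc r) \<in> dom ?T \<and> val ?T (r, Suc r) = val T (r, r))"
    proof
      assume *: "(r, Suc r) \<in> dom ?T \<and> val ?T (r, Suc r) = val T (r, r)"
      then have "(r, Suc r) \<in> dom T" by simp
      with * show False using goodD(5)[OF v(1) row_diagonal(1), of "Suc r"] by simp
    qed
    moreover have "T((r, r) \<mapsto> of_int (val T (r, r))) = T"
      unfolding Ints_eq_of_int_ceiling[OF goodD(4)[OF v(1) row_diagonal(1)]]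
      using row_diagonal(1) by (rule upd_entry)
    ultimately show ?case using row_diagonal(1) v(4) by (auto simp add: Let_def like_ceiling)
  next
    case (row_keep r p T w)
    note v = validD[OF row_keep(6)] and v' = validD[OF row_keep(7)]
    let ?T = "swap_entries T (r, p) (r, Suc p)"
    have dom: "dom ?T = dom T" using row_keep by simp
    have "Max {q. (r, q) \<in> dom ?T \<and> val ?T (r, q) < \<lceil>w\<rceil> + 1} = p"
    proof (rule Max_row_eq[OF v'(1)])
      fix q assume "p < q" "(r, q) \<in> dom ?T"
      then show "\<lceil>w\<rceil> + 1 \<le> val ?T (r, q)"
        using val_row_mono[OF v(1) row_keep(3), of q] row_keep(5) dom by simp
    qed (use row_keep dom in auto)
    then show ?case
      using row_keep v by (simp add: Let_def dom swap_entries_swap_entries like_ceiling)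
  next
    case (row_diagonal_keep r T w)
    note v = validD[OF row_diagonal_keep(5)] and v' = validD[OF row_diagonal_keep(6)]
    let ?T = "swap_entries T (r, r) (r, Suc r)"
    have dom: "dom ?T = dom T" using row_diagonal_keep by simp
    have "Max {k. (k, r) \<in> dom ?T \<and> val ?T (k, r) < \<lceil>w\<rceil> + 1} = r"
    proof (rule Max_column_eq[OF v'(1)])
      fix k assume "r < k" "(k, r) \<in> dom ?T"
      then show "\<lceil>w\<rceil> + 1 \<le> val ?T (k, r)" using goodD(8)[OF v(1), of k r] dom by simp
    qed (use row_diagonal_keep dom in auto)
    then show ?case
      using row_diagonal_keep v by (simp add: Let_def dom swap_entries_swap_entries like_ceiling)
  next
    case (column_replace p c T w)
    note v = validD[OF column_replace(4)] and v' = validD[OF column_replace(5)]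
    let ?T = "T((p, c) \<mapsto> w)"
    obtain s where "c = Suc s" "p \<le> s" using column_state_landing[OF column_replace(4,1,2)] by metis
    then have "p \<noteq> c" by simp
    have "Max {k. (k, c) \<in> dom ?T \<and> val ?T (k, c) < val T (p, c)} = p"
      by (rule Max_column_eq[OF v'(1)])
        (use column_replace goodD(6)[OF v(1) column_replace(1)] in \<open>auto intro: less_imp_le\<close>)
    moreover have "\<not> ((Suc p, c) \<in> dom ?T \<and> val ?T (Suc p, c) = val T (p, c))"
    proof
      assume *: "(Suc p, c) \<in> dom ?T \<and> val ?T (Suc p, c) = val T (p, c)"
      then have "(Suc p, c) \<in> dom T" by simp
      with * show False using goodD(6)[OF v(1) column_replace(1), of "Suc p"] by simp
    qed
    ultimately show ?case using column_replace(1) \<open>p \<noteq> c\<close> by (auto simp add: Let_def)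
  next
    case (column_keep p c T w)
    note v = validD[OF column_keep(5)] and v' = validD[OF column_keep(6)]
    let ?T = "swap_entries T (p, c) (Suc p, c)"
    have dom: "dom ?T = dom T" using column_keep by simp
    have "p \<noteq> c" using goodD(8)[OF v(1) column_keep(2)] by simp
    have "Max {k. (k, c) \<in> dom ?T \<and> val ?T (k, c) < \<lceil>w\<rceil> + 1} = p"
    proof (rule Max_column_eq[OF v'(1)])
      fix k assume "p < k" "(k, c) \<in> dom ?T"
      then show "\<lceil>w\<rceil> + 1 \<le> val ?T (k, c)"
        using val_column_mono[OF v(1) column_keep(2), of k] column_keep(4) dom by simp
    qed (use column_keep dom in auto)
    then show ?case
      using column_keep v \<open>p \<noteq> c\<close> by (simp add: Let_def dom swap_entries_swap_entries like_ceiling)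
  qed
qed

text \<open>Entries to the right of \<open>(r, p)\<close> exceed \<open>w\<close>, and
  \<open>repeat_gap\<close> asks for one among them at distance at most one; in an increasing row
  this must be the next box.\<close>

lemma row_next:
  assumes "good T" "state_word T (Row r) w \<in> W" "(r, p) \<in> dom T" "val T (r, p) = \<lceil>w\<rceil>"
  shows "(r, Suc p) \<in> dom T" "val T (r, Suc p) = \<lceil>w\<rceil> + 1"
proof -
  note g = goodD[OF assms(1)]
  have "(row_reading T (rows_above T r) @ row_reading T (row_left T r p)) @ entry T (r, p) #
      row_reading T (row_right T r p) @ w # row_reading T (rows_below T r) \<in> W"
    using assms(2) row_reading_at_least[OF g(2) assms(3)] by simp
  from repeat_gap[OF this assms(4)] obtain q where q: "(r, q) \<in> dom T" "p < q" "\<bar>val T (r, q) - val T (r, p)\<bar> \<le> 1"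
    using g(2) by (force simp: row_right_def)
  show d: "(r, Suc p) \<in> dom T" using g(9)[OF q(1), of r "Suc p"] q(2) g(7,8)[OF assms(3)] by simp
  show "val T (r, Suc p) = \<lceil>w\<rceil> + 1"
    using g(5)[OF assms(3) d] val_row_mono[OF assms(1) d q(1)] q(2,3) assms(4) by simp
qed

lemma column_next:
  assumes "good T" "state_word T (Column c) w \<in> W" "(p, c) \<in> dom T" "val T (p, c) = \<lceil>w\<rceil>"
  shows "(Suc p, c) \<in> dom T" "val T (Suc p, c) = \<lceil>w\<rceil> + 1"
proof -
  note g = goodD[OF assms(1)]
  have "column_reading T (columns_left T c) @ w # column_reading T (column_up T c p) @ entry T (p, c) #
      column_reading T (column_down T c p) @ column_reading T (columns_right T c) \<in> W"
    using assms(2) column_reading_at_least[OF g(2) assms(3)] by simp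
  from repeat_gap[OF this] assms(4) obtain k where k: "(k, c) \<in> dom T" "p < k" "\<bar>val T (k, c) - val T (p, c)\<bar> \<le> 1"
    using g(2) by (force simp: column_up_def)
  show d: "(Suc p, c) \<in> dom T" using g(9)[OF k(1), of "Suc p" c] k(2) g(8)[OF k(1)] by simp
  show "val T (Suc p, c) = \<lceil>w\<rceil> + 1"
    using g(6)[OF assms(3) d] val_column_mono[OF assms(1) d k(1)] k(2,3) assms(4) by simp
qed

lemma ex_step_to_row:
  assumes "valid (T, Row (Suc r), v)" "1 \<le> r"
  shows "\<exists>T' w. valid (T', Row r, w) \<and> step (T', Row r, w) (T, Row (Suc r), v)"
proof -
  note V = validD[OF assms(1)]
  note g = goodD[OF V(1)]
  obtain j where j: "r < j" "(r, j) \<in> dom T" "val T (r, j) < \<lceil>v\<rceil>" "(Suc r, j) \<in> dom T \<Longrightarrow> \<lceil>v\<rceil> \<le> val T (Suc r, j)"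
    and max: "\<And>q. j < q \<Longrightarrow> (r, q) \<in> dom T \<Longrightarrow> \<lceil>v\<rceil> \<le> val T (r, q)"
    using V(2) assms(2) by auto
  have below: "(k, j) \<in> dom T \<and> val T (k, j) < val T (r, j)" if "r = Suc k" "1 \<le> k" for k
    using g(9)[OF j(2), of k j] g(6)[OF _ j(2), of k] that j(1) by simp
  show ?thesis
  proof (cases "(r, Suc j) \<in> dom T \<and> val T (r, Suc j) = \<lceil>v\<rceil>")
    case True
    let ?T = "swap_entries T (r, j) (r, Suc j)"
    let ?w = "like v (\<lceil>v\<rceil> - 1)"
    have dom: "dom ?T = dom T" using True j(2) by simp
    \<comment> \<open>The letter \<open>v\<close> and the equal entry at \<open>(r, Suc j)\<close>
      need a near letter between them. Everything between is at most the entry at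
      \<open>(r, j)\<close>, whose value is thereby pinned to
      \<open>\<lceil>v\<rceil> - 1\<close>.\<close>
    have "row_reading T (rows_above T r) @ v # (row_reading T (row_left T r j) @ [entry T (r, j)]) @
        entry T (r, Suc j) # row_reading T (row_right T r (Suc j)) @ row_reading T (rows_below T r) \<in> W"
      using V(3) row_reading_less_Suc[OF g(2) j(2)] row_reading_right[OF g(2)] True by simp
    from repeat_gap[OF this] True obtain x where
      x: "x \<in> set (row_reading T (row_left T r j) @ [entry T (r, j)])" "\<lceil>v\<rceil> - 1 \<le> \<lceil>x\<rceil>" by fastforce
    have "\<lceil>x\<rceil> \<le> val T (r, j)" using x(1) reading_bounds(1)[OF V(1) j(2)] by fastforce
    with x(2) j(3) have m: "val T (r, j) = \<lceil>v\<rceil> - 1" by simp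
    note word = word_row_keep_reverse[OF V(1) j(2) _ _ m V(3)]
    have good: "good ?T"
      by (rule good_swap_entries) (use V(1) True j in auto)
    moreover have "admissible ?T (Row r) ?w"
    proof (rule admissible_rowI[OF good assms(2), of j])
      fix q assume "j \<le> q" "(r, q) \<in> dom ?T"
      then show "\<lceil>?w\<rceil> \<le> val ?T (r, q)" using val_row_mono[OF V(1) j(2), of q] m dom by simp
    qed (use j below m dom in auto)
    ultimately have "valid (?T, Row r, ?w)" using word True by (simp add: valid_def)
    moreover have "step (?T, Row r, ?w) (swap_entries ?T (r, j) (r, Suc j), Row (Suc r), like ?w (\<lceil>?w\<rceil> + 1))"
      by (rule step.row_keep) (use True j m dom in auto)
    moreover have "swap_entries ?T (r, j) (r, Suc j) = T"
      by (rule swap_entries_swap_entries[OF V(1) j(2)]) (use True in auto)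
    ultimately show ?thesis using V(4) by (intro exI[of _ ?T] exI[of _ ?w]) (simp add: like_ceiling)
  next
    case False
    let ?T = "T((r, j) \<mapsto> v)"
    let ?w = "entry T (r, j)"
    have dom: "dom ?T = dom T" using j(2) by auto
    have right: "\<lceil>v\<rceil> < val T (r, q)" if q: "j < q" "(r, q) \<in> dom T" for q
    proof -
      have d: "(r, Suc j) \<in> dom T" using g(9)[OF q(2), of r "Suc j"] q(1) j(1) assms(2) by simp
      then have "\<lceil>v\<rceil> < val T (r, Suc j)" using False max[OF _ d] by auto
      then show ?thesis using val_row_mono[OF V(1) d q(2)] q(1) by simp
    qed
    have up: "\<lceil>v\<rceil> < val T (k, j)" if k: "r < k" "(k, j) \<in> dom T" for k
    proof -
      have d: "(Suc r, j) \<in> dom T" using g(9)[OF k(2), of "Suc r" j] k(1) j(1) by simp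
      \<comment> \<open>Equality would make \<open>row_next\<close> place
        \<open>\<lceil>v\<rceil> + 1\<close> at \<open>(Suc r, Suc j)\<close>. The entry below that
        box is then squeezed to \<open>\<lceil>v\<rceil>\<close>, which is the other case.\<close>
      have "val T (Suc r, j) \<noteq> \<lceil>v\<rceil>"
      proof
        assume e: "val T (Suc r, j) = \<lceil>v\<rceil>"
        note n = row_next[OF V(1,3) d e]
        have "(r, Suc j) \<in> dom T" using g(9)[OF n(1), of r "Suc j"] assms(2) j(1) by simp
        moreover from g(6)[OF this n(1)] n(2) max[OF _ this] have "val T (r, Suc j) = \<lceil>v\<rceil>" by simp
        ultimately show False using False by simp
      qed
      with j(4)[OF d] show ?thesis using val_column_mono[OF V(1) d k(2)] k(1) by simp
    qed
    have good: "good ?T"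
    proof (rule good_replace[OF V(1) j(2) V(4)])
      fix q assume "(r, q) \<in> dom T" "q < j"
      then show "val T (r, q) < \<lceil>v\<rceil>" using g(5)[OF _ j(2), of q] j(3) by simp
    next
      fix k assume "(k, j) \<in> dom T" "k < r"
      then show "val T (k, j) < \<lceil>v\<rceil>" using g(6)[OF _ j(2), of k] j(3) by simp
    qed (use j(1) right up in auto)
    moreover have "admissible ?T (Row r) ?w"
    proof (rule admissible_rowI[OF good assms(2), of j])
      fix q assume "j \<le> q" "(r, q) \<in> dom ?T"
      then show "\<lceil>?w\<rceil> \<le> val ?T (r, q)" using val_row_mono[OF V(1) j(2), of q] j(3) dom by auto
    qed (use j below dom in auto)
    moreover have left: "val ?T (r, q) < \<lceil>?w\<rceil>" if "q < j" "(r, q) \<in> dom ?T" for q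
      using g(5)[OF _ j(2), of q] that dom by auto
    moreover have jT: "(r, j) \<in> dom ?T" "?T((r, j) \<mapsto> ?w) = T" "entry ?T (r, j) = v" using j(2) by auto
    ultimately have "valid (?T, Row r, ?w)"
      using word_row_replace[OF good jT(1), of ?w] V(3) j(3) by (simp add: valid_def)
    moreover have "step (?T, Row r, ?w) (?T((r, j) \<mapsto> ?w), Row (Suc r), entry ?T (r, j))"
      by (rule step.row_replace) (use jT left j in auto)
    ultimately show ?thesis unfolding jT by blast
  qed
qed

text \<open>If the corner \<open>(s, Suc s)\<close> holds \<open>v\<close>, a pair of unprimed
  entries was kept and the tableau was the same before. Otherwise the diagonal entry was
  overwritten: the earlier letter has the value that now stands on the diagonal and the prime of
  \<open>v\<close>.\<close>

lemma ex_step_to_column_from_row: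
  assumes "valid (T, Column (Suc s), v)" "(s, s) \<in> dom T" "val T (s, s) < \<lceil>v\<rceil>"
    and corner: "(s, Suc s) \<in> dom T \<Longrightarrow> \<lceil>v\<rceil> \<le> val T (s, Suc s)"
    and unprimed: "(s, Suc s) \<in> dom T \<Longrightarrow> val T (s, Suc s) = \<lceil>v\<rceil> \<Longrightarrow> entry T (s, Suc s) \<in> \<int>"
  shows "\<exists>T' w. valid (T', Row s, w) \<and> step (T', Row s, w) (T, Column (Suc s), v)"
proof -
  note V = validD[OF assms(1)]
  note g = goodD[OF V(1)]
  have s: "1 \<le> s" using g(7)[OF assms(2)] .
  have below: "(k, s) \<in> dom T \<and> val T (k, s) < val T (s, s)" if "s = Suc k" "1 \<le> k" for k
    using g(9)[OF assms(2), of k s] g(6)[OF _ assms(2), of k] that by simp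
  show ?thesis
  proof (cases "(s, Suc s) \<in> dom T \<and> val T (s, Suc s) = \<lceil>v\<rceil>")
    case True
    let ?w = "like v (\<lceil>v\<rceil> - 1)"
    have M: "entry T (s, Suc s) \<in> \<int>" using unprimed True by simp
    note word = word_row_diagonal_keep_reverse[OF V(1) assms(2) _ _ M V(3)]
    have m: "val T (s, s) = \<lceil>v\<rceil> - 1" using word True by simp
    have "admissible T (Row s) ?w"
    proof (rule admissible_rowI[OF V(1) s order.refl])
      fix q assume "s \<le> q" "(s, q) \<in> dom T"
      then show "\<lceil>?w\<rceil> \<le> val T (s, q)" using val_row_mono[OF V(1) assms(2), of q] m by simp
    qed (use below m in auto)
    then have "valid (T, Row s, ?w)" using word True V(1) by (simp add: valid_def)
    moreover have "step (T, Row s, ?w) (swap_entries T (s, s) (s, Suc s), Column (Suc s), like ?w (\<lceil>?w\<rceil> + 1))"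
      by (rule step.row_diagonal_keep) (use True assms(2) m in auto)
    moreover have "swap_entries T (s, s) (s, Suc s) = T"
      by (rule swap_entries_unprimed[OF V(1) assms(2) _ g(4)[OF assms(2)]]) (use True M in auto)
    ultimately show ?thesis using V(4) by (intro exI[of _ T] exI[of _ ?w]) (simp add: like_ceiling)
  next
    case False
    let ?T = "T((s, s) \<mapsto> of_int \<lceil>v\<rceil>)"
    let ?w = "like v (val T (s, s))"
    have dom: "dom ?T = dom T" using assms(2) by auto
    have e: "of_int (val T (s, s)) = entry T (s, s)" using Ints_eq_of_int_ceiling g(4)[OF assms(2)] by blast
    have good: "good ?T"
    proof (rule good_replace[OF V(1) assms(2)])
      fix q assume q: "(s, q) \<in> dom T" "s < q"
      have d: "(s, Suc s) \<in> dom T" using g(9)[OF q(1), of s "Suc s"] q(2) s by simp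
      then have "\<lceil>v\<rceil> < val T (s, Suc s)" using False corner by auto
      then show "\<lceil>of_int \<lceil>v\<rceil> :: rat\<rceil> < val T (s, q)" using val_row_mono[OF V(1) d q(1)] q(2) by simp
    next
      fix q assume "(s, q) \<in> dom T" "q < s"
      then show "val T (s, q) < \<lceil>of_int \<lceil>v\<rceil> :: rat\<rceil>" using g(8)[of s q] by simp
    next
      fix k assume "(k, s) \<in> dom T" "k < s"
      then show "val T (k, s) < \<lceil>of_int \<lceil>v\<rceil> :: rat\<rceil>" using g(6)[OF _ assms(2), of k] assms(3) by simp
    next
      fix k assume "(k, s) \<in> dom T" "s < k"
      then show "\<lceil>of_int \<lceil>v\<rceil> :: rat\<rceil> < val T (k, s)" using g(8)[of k s] by simp
    qed auto
    moreover have "admissible ?T (Row s) ?w"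
    proof (rule admissible_rowI[OF good s order.refl])
      fix q assume "s \<le> q" "(s, q) \<in> dom ?T"
      then show "\<lceil>?w\<rceil> \<le> val ?T (s, q)" using val_row_mono[OF V(1) assms(2), of q] assms(3) dom by auto
    qed (use below dom in auto)
    moreover have T: "?T((s, s) \<mapsto> of_int \<lceil>?w\<rceil>) = T" using assms(2) e by auto
    moreover have sT: "(s, s) \<in> dom ?T" "\<lceil>?w\<rceil> < val ?T (s, s)" "like ?w (val ?T (s, s)) = v"
      using assms(2,3) V(4) by (simp_all add: like_ceiling)
    moreover have "state_word ?T (Row s) ?w \<in> W \<longleftrightarrow>
        state_word (?T((s, s) \<mapsto> of_int \<lceil>?w\<rceil>)) (Column (Suc s)) (like ?w (val ?T (s, s))) \<in> W"
      by (rule word_row_diagonal[OF good sT(1,2)]) (simp, simp only: T V(1))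
    then have "state_word ?T (Row s) ?w \<in> W" using V(3) by (simp only: T sT(3))
    ultimately have "valid (?T, Row s, ?w)" by (simp add: valid_def)
    moreover have "step (?T, Row s, ?w) (?T((s, s) \<mapsto> of_int \<lceil>?w\<rceil>), Column (Suc s), like ?w (val ?T (s, s)))"
      by (rule step.row_diagonal[OF sT(1,2)])
    ultimately show ?thesis unfolding T sT(3) by blast
  qed
qed

lemma ex_step_to_column_from_column:
  assumes "valid (T, Column (Suc s), v)" "1 \<le> i" "i < s" "(i, s) \<in> dom T" "val T (i, s) < \<lceil>v\<rceil>"
    and corner: "(i, Suc s) \<in> dom T \<Longrightarrow> \<lceil>v\<rceil> \<le> val T (i, Suc s)"
    and max: "\<And>k. i < k \<Longrightarrow> (k, s) \<in> dom T \<Longrightarrow> \<lceil>v\<rceil> \<le> val T (k, s)"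
  shows "\<exists>T' w. valid (T', Column s, w) \<and> step (T', Column s, w) (T, Column (Suc s), v)"
proof -
  note V = validD[OF assms(1)]
  note g = goodD[OF V(1)]
  obtain l where l: "s = Suc l" "i \<le> l" using assms(3) by (cases s) auto
  have left: "(i, l) \<in> dom T" "val T (i, l) < val T (i, s)"
    using g(9)[OF assms(4), of i l] g(5)[OF _ assms(4), of l] assms(2) l by simp_all
  show ?thesis
  proof (cases "(Suc i, s) \<in> dom T \<and> val T (Suc i, s) = \<lceil>v\<rceil>")
    case True
    let ?T = "swap_entries T (i, s) (Suc i, s)"
    let ?w = "like v (\<lceil>v\<rceil> - 1)"
    have dom: "dom ?T = dom T" using True assms(4) by simp
    have "(column_reading T (columns_left T s) @ column_reading T (column_up T s (Suc i))) @ entry T (Suc i, s) #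
        (entry T (i, s) # column_reading T (column_down T s i)) @ v # column_reading T (columns_right T s) \<in> W"
      using V(3) column_reading_less_Suc[OF g(2) assms(4)] column_reading_up[OF g(2)] True by simp
    from repeat_gap[OF this] True obtain x where
      x: "x \<in> set (entry T (i, s) # column_reading T (column_down T s i))" "\<lceil>v\<rceil> - 1 \<le> \<lceil>x\<rceil>" by fastforce
    have "\<lceil>x\<rceil> \<le> val T (i, s)" using x(1) reading_bounds(3)[OF V(1) assms(4)] by fastforce
    with x(2) assms(5) have m: "val T (i, s) = \<lceil>v\<rceil> - 1" by simp
    note word = word_column_keep_reverse[OF V(1) assms(4) _ _ m V(3)]
    have good: "good ?T"
      by (rule good_swap_entries) (use V(1) True assms word in auto)
    moreover have "admissible ?T (Column s) ?w"
    proof (rule admissible_columnI[OF good l(1) assms(2) l(2)])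
      fix k assume "i \<le> k" "(k, s) \<in> dom ?T"
      then show "\<lceil>?w\<rceil> \<le> val ?T (k, s)" using val_column_mono[OF V(1) assms(4), of k] m dom by simp
    next
      \<comment> \<open>Only \<open>l = i\<close> is possible. Then the box above the corner is the
        diagonal box \<open>(s, s)\<close>, and the corner takes over its unprimed status.\<close>
      assume ls: "(l, s) \<in> dom ?T" "val ?T (l, s) = \<lceil>?w\<rceil>"
      have "l = i"
      proof (rule ccontr)
        assume "l \<noteq> i"
        then have "val T (i, s) < val T (l, s)" using g(6)[OF assms(4), of l] ls(1) l(2) dom by simp
        with ls(2) m show False by simp
      qed
      then have "entry T (Suc i, s) \<in> \<int>" using True g(4) l(1) by simp
      then show "entry ?T (l, s) \<in> \<int>" using \<open>l = i\<close> by (simp add: entry_swap_entries)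
    qed (use left m dom in auto)
    ultimately have "valid (?T, Column s, ?w)" using word True by (simp add: valid_def)
    moreover have "step (?T, Column s, ?w) (swap_entries ?T (i, s) (Suc i, s), Column (Suc s), like ?w (\<lceil>?w\<rceil> + 1))"
      by (rule step.column_keep) (use True assms(4) m dom in auto)
    moreover have "swap_entries ?T (i, s) (Suc i, s) = T"
      by (rule swap_entries_swap_entries[OF V(1) assms(4)]) (use True in auto)
    ultimately show ?thesis using V(4) by (intro exI[of _ ?T] exI[of _ ?w]) (simp add: like_ceiling)
  next
    case False
    let ?T = "T((i, s) \<mapsto> v)"
    let ?w = "entry T (i, s)"
    have dom: "dom ?T = dom T" using assms(4) by auto
    have up: "\<lceil>v\<rceil> < val T (k, s)" if k: "i < k" "(k, s) \<in> dom T" for k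
    proof -
      have d: "(Suc i, s) \<in> dom T" using g(9)[OF k(2), of "Suc i" s] k(1) assms(3) by simp
      then have "\<lceil>v\<rceil> < val T (Suc i, s)" using False max[OF _ d] by auto
      then show ?thesis using val_column_mono[OF V(1) d k(2)] k(1) by simp
    qed
    have right: "\<lceil>v\<rceil> < val T (i, q)" if q: "s < q" "(i, q) \<in> dom T" for q
    proof -
      have d: "(i, Suc s) \<in> dom T" using g(9)[OF q(2), of i "Suc s"] q(1) assms(2,3) by simp
      have "val T (i, Suc s) \<noteq> \<lceil>v\<rceil>"
      proof
        assume e: "val T (i, Suc s) = \<lceil>v\<rceil>"
        note n = column_next[OF V(1,3) d e]
        have "(Suc i, s) \<in> dom T" using g(9)[OF n(1), of "Suc i" s] assms(3) by simp
        moreover from g(5)[OF this n(1)] n(2) max[OF _ this] have "val T (Suc i, s) = \<lceil>v\<rceil>" by simp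
        ultimately show False using False by simp
      qed
      with corner[OF d] show ?thesis using val_row_mono[OF V(1) d q(2)] q(1) by simp
    qed
    have good: "good ?T"
    proof (rule good_replace[OF V(1) assms(4) V(4)])
      fix q assume "(i, q) \<in> dom T" "q < s"
      then show "val T (i, q) < \<lceil>v\<rceil>" using g(5)[OF _ assms(4), of q] assms(5) by simp
    next
      fix k assume "(k, s) \<in> dom T" "k < i"
      then show "val T (k, s) < \<lceil>v\<rceil>" using g(6)[OF _ assms(4), of k] assms(5) by simp
    qed (use assms(3) right up in auto)
    moreover have "admissible ?T (Column s) ?w"
    proof (rule admissible_columnI[OF good l(1) assms(2) l(2)])
      fix k assume "i \<le> k" "(k, s) \<in> dom ?T"
      then show "\<lceil>?w\<rceil> \<le> val ?T (k, s)" using val_column_mono[OF V(1) assms(4), of k] assms(5) dom by auto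
    next
      assume ls: "(l, s) \<in> dom ?T" "val ?T (l, s) = \<lceil>?w\<rceil>"
      have False
      proof (cases "l = i")
        case True
        with ls(2) assms(5) show False by simp
      next
        case False
        then show False using g(6)[OF assms(4), of l] ls l(2) dom by simp
      qed
      then show "entry ?T (l, s) \<in> \<int>" ..
    qed (use left l dom in auto)
    moreover have down: "val ?T (k, s) < \<lceil>?w\<rceil>" if "k < i" "(k, s) \<in> dom ?T" for k
      using g(6)[OF _ assms(4), of k] that dom by auto
    moreover have iT: "(i, s) \<in> dom ?T" "?T((i, s) \<mapsto> ?w) = T" "entry ?T (i, s) = v" using assms(4) by auto
    ultimately have "valid (?T, Column s, ?w)"
      using word_column_replace[OF good iT(1), of ?w] V(3) assms(5) by (simp add: valid_def)
    moreover have "step (?T, Column s, ?w) (?T((i, s) \<mapsto> ?w), Column (Suc s), entry ?T (i, s))"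
      by (rule step.column_replace) (use iT down assms(5) in auto)
    ultimately show ?thesis unfolding iT by blast
  qed
qed

text \<open>Backward steps lead from row \<open>r + 1\<close> to row \<open>r\<close>, and from
  column \<open>s + 1\<close> to column \<open>s\<close> or to row \<open>s\<close>, so the index
  falls and the chain can only stop at row 1.\<close>

lemma ex_initial:
  assumes "valid (T, seg, v)"
  shows "\<exists>T' w. valid (T', Row 1, w) \<and> step\<^sup>*\<^sup>* (T', Row 1, w) (T, seg, v)"
  using assms
proof (induction "case seg of Row r \<Rightarrow> r | Column c \<Rightarrow> 2 * c" arbitrary: T seg v rule: less_induct)
  case less
  have IH: ?case if "valid (T', seg', w)" "step (T', seg', w) (T, seg, v)"
    "(case seg' of Row r \<Rightarrow> r | Column c \<Rightarrow> 2 * c) < (case seg of Row r \<Rightarrow> r | Column c \<Rightarrow> 2 * c)" for T' seg' w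
    using less.hyps[OF that(3,1)] that(2) by (meson rtranclp.rtrancl_into_rtrancl)
  note V = validD[OF less.prems]
  show ?case
  proof (cases seg)
    case (Row r)
    then have "1 \<le> r" using V(2) by simp
    show ?thesis
    proof (cases "r = 1")
      case False
      then obtain k where "r = Suc k" "1 \<le> k" using \<open>1 \<le> r\<close> by (cases r) auto
      then show ?thesis using ex_step_to_row[of T k v] less.prems IH Row by fastforce
    qed (use less.prems Row in blast)
  next
    case (Column c)
    then obtain s i where i: "c = Suc s" "1 \<le> i" "i \<le> s" "(i, s) \<in> dom T" "val T (i, s) < \<lceil>v\<rceil>"
      "(i, c) \<in> dom T \<Longrightarrow> \<lceil>v\<rceil> \<le> val T (i, c)" "\<And>k. i < k \<Longrightarrow> (k, s) \<in> dom T \<Longrightarrow> \<lceil>v\<rceil> \<le> val T (k, s)"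
      "(s, c) \<in> dom T \<Longrightarrow> val T (s, c) = \<lceil>v\<rceil> \<Longrightarrow> entry T (s, c) \<in> \<int>"
      using V(2) by auto
    show ?thesis
    proof (cases "i = s")
      case True
      then obtain T' w where "valid (T', Row s, w)" "step (T', Row s, w) (T, Column (Suc s), v)"
        using ex_step_to_column_from_row[of T s v] less.prems Column i by auto
      then show ?thesis using IH[of T' "Row s" w] Column i(1) by simp
    next
      case False
      then obtain T' w where "valid (T', Column s, w)" "step (T', Column s, w) (T, Column (Suc s), v)"
        using ex_step_to_column_from_column[of T s v i] less.prems Column i by auto
      then show ?thesis using IH[of T' "Column s" w] Column i(1) by simp
    qed
  qed
qed

section \<open>Termination of the insertion\<close>

definition final :: "tableau \<times> segment \<times> rat \<Rightarrow> bool" where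
  "final s \<longleftrightarrow> (case s of (T, seg, w) \<Rightarrow> \<forall>b \<in> boxes seg \<inter> dom T. val T b < \<lceil>w\<rceil>)"

lemma final_or_step:
  assumes "valid (T, seg, w)"
  shows "final (T, seg, w) \<or> (\<exists>t. step (T, seg, w) t)"
proof (cases seg)
  case (Row r)
  note V = validD[OF assms]
  show ?thesis
  proof (cases "\<exists>q. (r, q) \<in> dom T \<and> \<lceil>w\<rceil> \<le> val T (r, q)")
    case True
    define p where "p = (LEAST q. (r, q) \<in> dom T \<and> \<lceil>w\<rceil> \<le> val T (r, q))"
    have p: "(r, p) \<in> dom T" "\<lceil>w\<rceil> \<le> val T (r, p)" using LeastI_ex[OF True] by (simp_all add: p_def)
    have less: "val T (r, q) < \<lceil>w\<rceil>" if "q < p" "(r, q) \<in> dom T" for q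
      using not_less_Least[OF that(1)[unfolded p_def]] that(2) by simp
    have "r \<le> p" using goodD(8)[OF V(1) p(1)] .
    show ?thesis
    proof (cases "val T (r, p) = \<lceil>w\<rceil>")
      case True
      then show ?thesis
        using row_next[OF V(1) _ p(1) True] V(3) Row p(1) \<open>r \<le> p\<close> step.row_keep[of r p T w]
          step.row_diagonal_keep[of r T w] by (cases "r = p") auto
    next
      case False
      then show ?thesis
        using Row p less \<open>r \<le> p\<close> step.row_replace[of r p T w] step.row_diagonal[of r T w]
        by (cases "r = p") auto
    qed
  qed (use Row in \<open>force simp: final_def\<close>)
next
  case (Column c)
  note V = validD[OF assms]
  show ?thesis
  proof (cases "\<exists>k. (k, c) \<in> dom T \<and> \<lceil>w\<rceil> \<le> val T (k, c)")
    case True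
    define p where "p = (LEAST k. (k, c) \<in> dom T \<and> \<lceil>w\<rceil> \<le> val T (k, c))"
    have p: "(p, c) \<in> dom T" "\<lceil>w\<rceil> \<le> val T (p, c)" using LeastI_ex[OF True] by (simp_all add: p_def)
    have less: "val T (k, c) < \<lceil>w\<rceil>" if "k < p" "(k, c) \<in> dom T" for k
      using not_less_Least[OF that(1)[unfolded p_def]] that(2) by simp
    show ?thesis
    proof (cases "val T (p, c) = \<lceil>w\<rceil>")
      case True
      then show ?thesis
        using column_next[OF V(1) _ p(1) True] V(3) Column p(1) step.column_keep[of p c T w] by auto
    next
      case False
      then show ?thesis
        using Column p less step.column_replace[of p c T w] by auto
    qed
  qed (use Column in \<open>force simp: final_def\<close>)
qed

lemma step_dom:
  assumes "step (T, seg, w) (T', seg', w')"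
  shows "dom T' = dom T"
  using assms by (cases rule: step.cases) (simp_all add: insert_absorb)

lemma step_segment:
  assumes "step (T, seg, w) (T', seg', w')"
  shows "case seg of Row r \<Rightarrow> (\<exists>q. (r, q) \<in> dom T) \<and> (seg' = Row (Suc r) \<or> seg' = Column (Suc r))
    | Column c \<Rightarrow> (\<exists>k. (k, c) \<in> dom T) \<and> seg' = Column (Suc c)"
  using assms by (cases rule: step.cases) fastforce+

lemma ex_final:
  assumes "valid (T, seg, w)"
  shows "\<exists>t. step\<^sup>*\<^sup>* (T, seg, w) t \<and> final t"
proof -
  \<comment> \<open>A step starts in a segment that contains boxes, so its index is at most
    \<open>N\<close>. The larger offset for rows makes the measure drop at the turn to columns as
    well.\<close>
  have "finite (fst ` dom T \<union> snd ` dom T)" using validD(5)[OF assms] by simp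
  then obtain N where N: "\<forall>x \<in> fst ` dom T \<union> snd ` dom T. x \<le> N" using finite_nat_set_iff_bounded_le by blast
  then have "(i, j) \<in> dom T \<Longrightarrow> i \<le> N \<and> j \<le> N" for i j by (metis UnI1 UnI2 fst_conv image_eqI snd_conv)
  with assms show ?thesis
  proof (induction "case seg of Row r \<Rightarrow> 2 * N + 4 - r | Column c \<Rightarrow> N + 2 - c" arbitrary: T seg w rule: less_induct)
    case less
    show ?case
    proof (cases "final (T, seg, w)")
      case False
      then obtain T' seg' w' where t: "step (T, seg, w) (T', seg', w')"
        using final_or_step[OF less.prems(1)] by (metis prod_cases3)
      have "(case seg' of Row r \<Rightarrow> 2 * N + 4 - r | Column c \<Rightarrow> N + 2 - c)
          < (case seg of Row r \<Rightarrow> 2 * N + 4 - r | Column c \<Rightarrow> N + 2 - c)"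
        using step_segment[OF t] less.prems(2) by (cases seg) fastforce+
      from less.hyps[OF this valid_step[OF t less.prems(1)]] show ?thesis
        using less.prems(2) t step_dom[OF t] by (metis converse_rtranclp_into_rtranclp)
    qed blast
  qed
qed

end

section \<open>The algorithm follows the steps\<close>

lemma arg_min_on_eqI:
  fixes f :: "'a \<Rightarrow> 'b :: linorder"
  assumes "b \<in> S" "\<And>b'. b' \<in> S \<Longrightarrow> b' \<noteq> b \<Longrightarrow> f b < f b'"
  shows "arg_min_on f S = b"
  unfolding arg_min_on_def arg_min_def is_arg_min_def
proof (rule some_equality)
  show "b \<in> S \<and> \<not> (\<exists>y. y \<in> S \<and> f y < f b)" using assms by fastforce
  show "x = b" if "x \<in> S \<and> \<not> (\<exists>y. y \<in> S \<and> f y < f x)" for x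
    using assms that by blast
qed

lemma less_of_ceiling_less: "\<lceil>x\<rceil> < \<lceil>y\<rceil> \<Longrightarrow> x < (y :: rat)"
  using ceiling_mono[of y x] by linarith

text \<open>No entry of the segment has the integer of \<open>w\<close>, so the two minima of the
  algorithm coincide.\<close>

lemma insert_into_replace:
  assumes "b \<in> boxes seg \<inter> dom T" "\<lceil>w\<rceil> < val T b"
    and "\<And>b'. b' \<in> boxes seg \<inter> dom T \<Longrightarrow> b' \<noteq> b \<Longrightarrow> val T b' < \<lceil>w\<rceil> \<or> val T b < val T b'"
  shows "insert_into T seg w =
    (if \<not> diagonal b then insert_into (T(b \<mapsto> w)) (next_segment seg) (entry T b)
     else insert_into (T(b \<mapsto> of_int \<lceil>w\<rceil>)) (next_column seg) (if w \<in> \<int> then entry T b else primed (val T b)))"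
proof -
  have less: "entry T b < entry T a" if "a \<in> boxes seg \<inter> dom T" "a \<noteq> b" "\<lceil>w\<rceil> \<le> val T a" for a
    using assms(3)[OF that(1,2)] that(3) by (intro less_of_ceiling_less) linarith
  have "arg_min_on (entry T) {b \<in> boxes seg \<inter> dom T. \<lceil>w\<rceil> \<le> val T b} = b"
    by (rule arg_min_on_eqI) (use assms(1,2) less in simp_all)
  moreover have "arg_min_on (entry T) {b \<in> boxes seg \<inter> dom T. \<lceil>w\<rceil> < val T b} = b"
    by (rule arg_min_on_eqI) (use assms(1,2) less in simp_all)
  moreover have "\<exists>b \<in> boxes seg \<inter> dom T. \<lceil>w\<rceil> < val T b" using assms by blast
  ultimately show ?thesis by (subst insert_into.simps) (simp add: Let_def)
qed

lemma switch_primes_eq: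
  assumes "x \<in> half_ints" "y \<in> half_ints"
  shows "switch_primes x y = (like y \<lceil>x\<rceil>, like x \<lceil>y\<rceil>)"
  using assms by (auto simp: switch_primes_def like_def reverse_prime_def half_ints_iff Ints_eq_of_int_ceiling)

lemma plus_1_eq_like: "w \<in> half_ints \<Longrightarrow> w + 1 = like w (\<lceil>w\<rceil> + 1)"
  by (auto simp: half_ints_iff like_def Ints_eq_of_int_ceiling) (simp add: primed_def)

lemma insert_into_keep:
  assumes "b \<in> boxes seg \<inter> dom T" "b' \<in> boxes seg \<inter> dom T" "val T b = \<lceil>w\<rceil>" "val T b' = \<lceil>w\<rceil> + 1"
    and "\<And>a. a \<in> boxes seg \<inter> dom T \<Longrightarrow> a \<noteq> b \<Longrightarrow> a \<noteq> b' \<Longrightarrow> val T a < \<lceil>w\<rceil> \<or> \<lceil>w\<rceil> + 1 < val T a"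
    and "entry T b \<in> half_ints" "entry T b' \<in> half_ints" "w \<in> half_ints"
  shows "insert_into T seg w = insert_into (swap_entries T b b')
    (if diagonal b then next_column seg else next_segment seg) (like w (\<lceil>w\<rceil> + 1))"
proof -
  have ne: "b \<noteq> b'" using assms(3,4) by auto
  have 1: "arg_min_on (entry T) {b \<in> boxes seg \<inter> dom T. \<lceil>w\<rceil> \<le> val T b} = b"
  proof (rule arg_min_on_eqI)
    fix a assume a: "a \<in> {b \<in> boxes seg \<inter> dom T. \<lceil>w\<rceil> \<le> val T b}" "a \<noteq> b"
    then have "val T b < val T a" using assms(3,4) assms(5)[of a] by (cases "a = b'") auto
    then show "entry T b < entry T a" by (rule less_of_ceiling_less)
  qed (use assms(1,3) in simp)
  have 2: "arg_min_on (entry T) {b \<in> boxes seg \<inter> dom T. \<lceil>w\<rceil> < val T b} = b'"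
  proof (rule arg_min_on_eqI)
    fix a assume a: "a \<in> {b \<in> boxes seg \<inter> dom T. \<lceil>w\<rceil> < val T b}" "a \<noteq> b'"
    then have "val T b' < val T a" using assms(3,4) assms(5)[of a] by (cases "a = b") auto
    then show "entry T b' < entry T a" by (rule less_of_ceiling_less)
  qed (use assms(2,4) in simp)
  have "\<exists>b \<in> boxes seg \<inter> dom T. \<lceil>w\<rceil> < val T b" using assms(2,4) by force
  with 1 2 ne show ?thesis
    by (subst insert_into.simps)
      (simp add: Let_def switch_primes_eq[OF assms(6,7)] swap_entries_def flip: plus_1_eq_like[OF assms(8)])
qed

lemma row_cases:
  assumes "good T" "(r, p) \<in> dom T" "b \<in> boxes (Row r) \<inter> dom T" "b \<noteq> (r, p)"
  obtains q where "b = (r, q)" "(r, q) \<in> dom T" "q < p" "val T (r, q) < val T (r, p)"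
  | q where "b = (r, q)" "(r, q) \<in> dom T" "p < q" "val T (r, p) < val T (r, q)"
proof -
  obtain q where q: "b = (r, q)" "(r, q) \<in> dom T" "q \<noteq> p" using assms(3,4) by auto
  then consider "q < p" | "p < q" by linarith
  then show thesis
    by cases (use q that goodD(5)[OF assms(1)] assms(2) in blast)+
qed

lemma column_cases:
  assumes "good T" "(p, c) \<in> dom T" "b \<in> boxes (Column c) \<inter> dom T" "b \<noteq> (p, c)"
  obtains k where "b = (k, c)" "(k, c) \<in> dom T" "k < p" "val T (k, c) < val T (p, c)"
  | k where "b = (k, c)" "(k, c) \<in> dom T" "p < k" "val T (p, c) < val T (k, c)"
proof -
  obtain k where k: "b = (k, c)" "(k, c) \<in> dom T" "k \<noteq> p" using assms(3,4) by auto
  then consider "k < p" | "p < k" by linarith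
  then show thesis
    by cases (use k that goodD(6)[OF assms(1)] assms(2) in blast)+
qed

lemma good_in_boxes:
  assumes "good T" "(r, c) \<in> dom T"
  shows "(r, c) \<in> boxes (Row r) \<inter> dom T" "(r, c) \<in> boxes (Column c) \<inter> dom T"
  using assms goodD(7,8)[OF assms] by simp_all

context word_class
begin

lemma insert_into_step:
  assumes "step (T, seg, w) (T', seg', w')" "valid (T, seg, w)"
  shows "insert_into T seg w = insert_into T' seg' w'"
proof -
  note V = validD[OF assms(2)]
  note g = goodD[OF V(1)]
  show ?thesis
    using assms(1)
  proof (cases rule: step.cases)
    case (row_replace r p)
    have "insert_into T (Row r) w = insert_into (T((r, p) \<mapsto> w)) (next_segment (Row r)) (entry T (r, p))"
    proof (subst insert_into_replace[of "(r, p)"])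
      show "(r, p) \<in> boxes (Row r) \<inter> dom T" "\<lceil>w\<rceil> < val T (r, p)"
        using row_replace good_in_boxes V(1) by blast+
      show "val T b < \<lceil>w\<rceil> \<or> val T (r, p) < val T b" if "b \<in> boxes (Row r) \<inter> dom T" "b \<noteq> (r, p)" for b
        using V(1) \<open>(r, p) \<in> dom T\<close> that by (rule row_cases) (use row_replace in auto)
    qed (use row_replace in \<open>simp add: diagonal_def\<close>)
    with row_replace show ?thesis by simp
  next
    case (row_diagonal r)
    have e: "of_int (val T (r, r)) = entry T (r, r)" using Ints_eq_of_int_ceiling g(4) row_diagonal by blast
    have "insert_into T (Row r) w = insert_into (T((r, r) \<mapsto> of_int \<lceil>w\<rceil>)) (next_column (Row r)) (like w (val T (r, r)))"
    proof (subst insert_into_replace[of "(r, r)"])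
      show "(r, r) \<in> boxes (Row r) \<inter> dom T" "\<lceil>w\<rceil> < val T (r, r)"
        using row_diagonal good_in_boxes V(1) by blast+
      show "val T b < \<lceil>w\<rceil> \<or> val T (r, r) < val T b" if "b \<in> boxes (Row r) \<inter> dom T" "b \<noteq> (r, r)" for b
        using V(1) \<open>(r, r) \<in> dom T\<close> that by (rule row_cases) (use that in auto)
    qed (simp add: diagonal_def like_def e)
    with row_diagonal show ?thesis by simp
  next
    case (row_keep r p)
    have "insert_into T (Row r) w = insert_into (swap_entries T (r, p) (r, Suc p)) (next_segment (Row r)) (like w (\<lceil>w\<rceil> + 1))"
    proof (subst insert_into_keep[of "(r, p)" _ _ "(r, Suc p)"])
      show "(r, p) \<in> boxes (Row r) \<inter> dom T" "(r, Suc p) \<in> boxes (Row r) \<inter> dom T"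
        using row_keep good_in_boxes V(1) by blast+
      show "val T b < \<lceil>w\<rceil> \<or> \<lceil>w\<rceil> + 1 < val T b"
        if b: "b \<in> boxes (Row r) \<inter> dom T" "b \<noteq> (r, p)" "b \<noteq> (r, Suc p)" for b
        using V(1) \<open>(r, Suc p) \<in> dom T\<close> b(1,3)
      proof (rule row_cases)
        fix q assume "b = (r, q)" "(r, q) \<in> dom T" "q < Suc p"
        then show ?thesis using g(5)[of r q p] row_keep b(2) by auto
      qed (use row_keep in auto)
    qed (use row_keep g(3) V(4) in \<open>simp_all add: diagonal_def\<close>)
    with row_keep show ?thesis by simp
  next
    case (row_diagonal_keep r)
    have "insert_into T (Row r) w = insert_into (swap_entries T (r, r) (r, Suc r)) (next_column (Row r)) (like w (\<lceil>w\<rceil> + 1))"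
    proof (subst insert_into_keep[of "(r, r)" _ _ "(r, Suc r)"])
      show "(r, r) \<in> boxes (Row r) \<inter> dom T" "(r, Suc r) \<in> boxes (Row r) \<inter> dom T"
        using row_diagonal_keep good_in_boxes V(1) by blast+
      show "val T b < \<lceil>w\<rceil> \<or> \<lceil>w\<rceil> + 1 < val T b"
        if b: "b \<in> boxes (Row r) \<inter> dom T" "b \<noteq> (r, r)" "b \<noteq> (r, Suc r)" for b
        using V(1) \<open>(r, Suc r) \<in> dom T\<close> b(1,3)
      proof (rule row_cases)
        fix q assume "b = (r, q)" "(r, q) \<in> dom T" "q < Suc r"
        then show ?thesis using g(8)[of r q] b(2) by simp
      qed (use row_diagonal_keep in auto)
    qed (use row_diagonal_keep g(3) V(4) in \<open>simp_all add: diagonal_def\<close>)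
    with row_diagonal_keep show ?thesis by simp
  next
    case (column_replace p c)
    have "p \<noteq> c" using column_state_landing[of T c w p] assms(2) column_replace by (metis not_less_eq_eq order_refl)
    have "insert_into T (Column c) w = insert_into (T((p, c) \<mapsto> w)) (next_segment (Column c)) (entry T (p, c))"
    proof (subst insert_into_replace[of "(p, c)"])
      show "(p, c) \<in> boxes (Column c) \<inter> dom T" "\<lceil>w\<rceil> < val T (p, c)"
        using column_replace good_in_boxes V(1) by blast+
      show "val T b < \<lceil>w\<rceil> \<or> val T (p, c) < val T b" if "b \<in> boxes (Column c) \<inter> dom T" "b \<noteq> (p, c)" for b
        using V(1) \<open>(p, c) \<in> dom T\<close> that by (rule column_cases) (use column_replace in auto)
    qed (use \<open>p \<noteq> c\<close> in \<open>simp add: diagonal_def\<close>)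
    with column_replace show ?thesis by simp
  next
    case (column_keep p c)
    have "insert_into T (Column c) w = insert_into (swap_entries T (p, c) (Suc p, c)) (next_segment (Column c)) (like w (\<lceil>w\<rceil> + 1))"
    proof (subst insert_into_keep[of "(p, c)" _ _ "(Suc p, c)"])
      show "(p, c) \<in> boxes (Column c) \<inter> dom T" "(Suc p, c) \<in> boxes (Column c) \<inter> dom T"
        using column_keep good_in_boxes V(1) by blast+
      show "val T b < \<lceil>w\<rceil> \<or> \<lceil>w\<rceil> + 1 < val T b"
        if b: "b \<in> boxes (Column c) \<inter> dom T" "b \<noteq> (p, c)" "b \<noteq> (Suc p, c)" for b
        using V(1) \<open>(Suc p, c) \<in> dom T\<close> b(1,3)
      proof (rule column_cases)
        fix k assume "b = (k, c)" "(k, c) \<in> dom T" "k < Suc p"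
        then show ?thesis using g(6)[of k c p] column_keep b(2) by auto
      qed (use column_keep in auto)
    qed (use column_keep g(3) V(4) in \<open>simp_all add: diagonal_def\<close>)
    with column_keep show ?thesis by simp
  qed
qed

lemma insert_into_steps:
  assumes "step\<^sup>*\<^sup>* (T, seg, w) (T', seg', w')" "valid (T, seg, w)"
  shows "valid (T', seg', w') \<and> dom T' = dom T \<and> insert_into T seg w = insert_into T' seg' w'"
  using assms(1)
proof (induction "(T', seg', w')" arbitrary: T' seg' w' rule: rtranclp_induct)
  case (step t)
  obtain T1 seg1 w1 where t: "t = (T1, seg1, w1)" by (cases t)
  with step(3)[OF t] step(2) show ?case
    using insert_into_step[of T1 seg1 w1 T' seg' w'] valid_step step_dom by metis
qed (use assms(2) in auto)

text \<open>Predecessors among valid states are unique by \<open>unstep_step\<close>, so two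
  backward chains from \<open>t\<close> are comparable. Neither is longer, because a state at row 1
  has no predecessor.\<close>

lemma steps_from_initial_unique:
  assumes "valid (T1, Row 1, w1)" "valid (T2, Row 1, w2)" "step\<^sup>*\<^sup>* (T1, Row 1, w1) t" "step\<^sup>*\<^sup>* (T2, Row 1, w2) t"
  shows "(T1, Row 1, w1) = (T2, Row 1, w2)"
proof -
  \<comment> \<open>Restricted to valid sources, since these are the ones that \<open>unstep\<close>
    is known to recover.\<close>
  define R where "R = {(s, t). valid s \<and> step s t}"
  have v: "valid t" if "step\<^sup>*\<^sup>* s t" "valid s" for s t
    using that by (induction rule: rtranclp_induct) (auto intro: valid_step)
  have R: "(s, t) \<in> R\<^sup>*" if "step\<^sup>*\<^sup>* s t" "valid s" for s t
    using that
  proof (induction rule: rtranclp_induct)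
    case (step t u)
    then show ?case using v[OF step(1)] by (auto simp: R_def intro: rtrancl_into_rtrancl)
  qed simp
  have init: "s = (T, Row 1, w)" if sR: "(s, (T, Row 1, w)) \<in> R\<^sup>*" for s T w
    using sR
  proof (cases rule: rtranclE)
    case (step y)
    obtain T' seg' w' where y: "y = (T', seg', w')" by (cases y)
    then have y: "step (T', seg', w') (T, Row 1, w)" "valid (T', seg', w')" using step(2) by (auto simp: R_def)
    then show ?thesis using step_segment[OF y(1)] validD(2)[OF y(2)] by (cases seg') auto
  qed
  have "single_valued (R\<inverse>)"
  proof (rule single_valuedI)
    fix x y z assume "(x, y) \<in> R\<inverse>" "(x, z) \<in> R\<inverse>"
    then have "unstep x = y" "unstep x = z" by (simp_all add: R_def unstep_step)
    then show "y = z" by simp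
  qed
  moreover have "(t, (T1, Row 1, w1)) \<in> (R\<inverse>)\<^sup>*" "(t, (T2, Row 1, w2)) \<in> (R\<inverse>)\<^sup>*"
    using R[OF assms(3,1)] R[OF assms(4,2)] by (simp_all add: rtrancl_converse)
  ultimately have "((T1, Row 1, w1), (T2, Row 1, w2)) \<in> (R\<inverse>)\<^sup>* \<or> ((T2, Row 1, w2), (T1, Row 1, w1)) \<in> (R\<inverse>)\<^sup>*"
    by (rule single_valued_confluent)
  then show ?thesis
    using init[of "(T2, Row 1, w2)" T1 w1] init[of "(T1, Row 1, w1)" T2 w2] by (auto simp: rtrancl_converse)
qed

end

section \<open>The end of the insertion\<close>

lemma good_remove:
  assumes "good T" "shape (dom T - {b})"
  shows "good (T(b := None))"
  unfolding good_def no_primed_diagonal_def diagonal_def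
proof (intro conjI allI impI ballI)
  show "shape (dom (T(b := None)))" using assms(2) by simp
next
  fix c assume "c \<in> dom (T(b := None))"
  then have "c \<in> dom T" "c \<noteq> b" by auto
  then show "entry (T(b := None)) c \<in> half_ints" using goodD(3)[OF assms(1), of c] by simp
next
  fix c assume "c \<in> dom (T(b := None))" "fst c = snd c"
  moreover from this obtain i where "c = (i, i)" by (cases c) simp
  ultimately have "(i, i) \<in> dom T" "c = (i, i)" "c \<noteq> b" by auto
  then show "entry (T(b := None)) c \<in> \<int>" using goodD(4)[OF assms(1), of i] by simp
next
  fix i j k assume "(i, j) \<in> dom (T(b := None))" "(i, k) \<in> dom (T(b := None))" "j < k"
  then have "(i, j) \<in> dom T" "(i, k) \<in> dom T" "(i, j) \<noteq> b" "(i, k) \<noteq> b" "j < k" by auto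
  then show "val (T(b := None)) (i, j) < val (T(b := None)) (i, k)" using goodD(5)[OF assms(1), of i j k] by simp
next
  fix i j k assume "(i, j) \<in> dom (T(b := None))" "(k, j) \<in> dom (T(b := None))" "i < k"
  then have "(i, j) \<in> dom T" "(k, j) \<in> dom T" "(i, j) \<noteq> b" "(k, j) \<noteq> b" "i < k" by auto
  then show "val (T(b := None)) (i, j) < val (T(b := None)) (k, j)" using goodD(6)[OF assms(1), of i j k] by simp
qed

lemma shape_insert:
  assumes "shape D" "1 \<le> i" "i \<le> j"
    and "\<And>k l. 1 \<le> k \<Longrightarrow> k \<le> i \<Longrightarrow> k \<le> l \<Longrightarrow> l \<le> j \<Longrightarrow> (k, l) \<noteq> (i, j) \<Longrightarrow> (k, l) \<in> D"
  shows "shape (insert (i, j) D)"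
  unfolding shape_def
proof (intro conjI allI impI)
  show "finite (insert (i, j) D)" using shapeD(1)[OF assms(1)] by simp
next
  fix a b assume "(a, b) \<in> insert (i, j) D"
  then show "1 \<le> a" "a \<le> b" using shapeD(2,3)[OF assms(1)] assms(2,3) by auto
next
  fix a b k l assume *: "(a, b) \<in> insert (i, j) D" "1 \<le> k" "k \<le> a" "k \<le> l" "l \<le> b"
  show "(k, l) \<in> insert (i, j) D"
  proof (cases "(a, b) \<in> D")
    case True
    then show ?thesis using shapeD(4)[OF assms(1) True *(2-5)] by simp
  next
    case False
    then show ?thesis using * assms(4)[of k l] by auto
  qed
qed

text \<open>A box added at the end of row \<open>r\<close> is read after that row and before the
  lower ones, just where the state word keeps its letter.\<close>

lemma row_reading_insert:
  assumes "finite (dom T)" "(r, p) \<notin> dom T" "\<And>q. (r, q) \<in> dom T \<Longrightarrow> q < p"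
  shows "row_reading (T((r, p) \<mapsto> x)) (insert (r, p) (dom T)) = state_word T (Row r) x"
proof -
  have "row_boxes (insert (r, p) (dom T)) = row_boxes {b \<in> dom T. r \<le> fst b} @ (r, p) # row_boxes (rows_below T r)"
    using assms(1,2) assms(3)[OF domI] by (intro row.listing_insert_between)
      (auto simp: box_set_defs row_before_def intro: le_neq_implies_less)
  then have "row_reading (T((r, p) \<mapsto> x)) (insert (r, p) (dom T)) =
      row_reading (T((r, p) \<mapsto> x)) {b \<in> dom T. r \<le> fst b} @ x # row_reading (T((r, p) \<mapsto> x)) (rows_below T r)"
    by (simp add: row_reading_def)
  then show ?thesis using assms(1,2) by simp
qed

lemma column_reading_insert:
  assumes "finite (dom T)" "(p, c) \<notin> dom T" "\<And>k. (k, c) \<in> dom T \<Longrightarrow> k < p"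
  shows "column_reading (T((p, c) \<mapsto> x)) (insert (p, c) (dom T)) = state_word T (Column c) x"
proof -
  have "column_boxes (insert (p, c) (dom T)) = column_boxes (columns_left T c) @ (p, c) # column_boxes {b \<in> dom T. c \<le> snd b}"
    using assms(1,2) assms(3)[OF domI] by (intro column.listing_insert_between)
      (auto simp: box_set_defs column_before_def intro: le_neq_implies_less)
  then have "column_reading (T((p, c) \<mapsto> x)) (insert (p, c) (dom T)) =
      column_reading (T((p, c) \<mapsto> x)) (columns_left T c) @ x # column_reading (T((p, c) \<mapsto> x)) {b \<in> dom T. c \<le> snd b}"
    by (simp add: column_reading_def)
  then show ?thesis using assms(1,2) by simp
qed

lemma insert_into_final:
  assumes "\<forall>b \<in> boxes seg \<inter> dom T. val T b < \<lceil>w\<rceil>"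
  shows "insert_into T seg w = place T seg w"
proof -
  have "\<not> (\<exists>b \<in> boxes seg \<inter> dom T. \<lceil>w\<rceil> < val T b)" using assms by force
  then show ?thesis by (subst insert_into.simps) simp
qed

lemma row_end:
  assumes "good T" "1 \<le> r"
  obtains p where "r \<le> p" "first_unoccupied T (Row r) = (r, p)" "(r, p) \<notin> dom T" "\<And>q. (r, q) \<in> dom T \<longleftrightarrow> r \<le> q \<and> q < p"
proof -
  let ?P = "\<lambda>y. (r, y) \<in> boxes (Row r) - dom T"
  obtain y where "\<forall>x \<in> snd ` dom T. x < y"
    using goodD(2)[OF assms(1)] finite_nat_set_iff_bounded by blast
  then have "?P (max r y)" by force
  then have P: "?P (LEAST y. ?P y)" by (rule LeastI)
  define p where "p = (LEAST y. ?P y)"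
  have p: "r \<le> p" "(r, p) \<notin> dom T" using P by (auto simp: p_def)
  have "(r, q) \<in> dom T \<longleftrightarrow> r \<le> q \<and> q < p" for q
  proof
    assume q: "(r, q) \<in> dom T"
    have "q < p"
    proof (rule ccontr)
      assume "\<not> q < p"
      then have "(r, p) \<in> dom T" using goodD(9)[OF assms(1) q, of r p] assms(2) p(1) by simp
      with p(2) show False by simp
    qed
    then show "r \<le> q \<and> q < p" using goodD(8)[OF assms(1) q] by simp
  next
    assume "r \<le> q \<and> q < p"
    then show "(r, q) \<in> dom T" using not_less_Least[of q ?P] by (auto simp: p_def)
  qed
  moreover have "first_unoccupied T (Row r) = (r, p)" by (simp add: p_def)
  ultimately show thesis using that p by blast
qed

context word_class
begin

text \<open>The boxes that must lie below the new one come from \<open>row_landing\<close>. A new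
  diagonal box is the first to be read, so its prime may be removed inside the class, and the ending
  preserves the information.\<close>

lemma final_row:
  assumes "valid (T, Row r, w)" "final (T, Row r, w)" "1 \<le> r"
    and p: "r \<le> p" "first_unoccupied T (Row r) = (r, p)" "(r, p) \<notin> dom T" "\<And>q. (r, q) \<in> dom T \<longleftrightarrow> r \<le> q \<and> q < p"
    and T': "T' = T((r, p) \<mapsto> (if p = r then of_int \<lceil>w\<rceil> else w))"
  shows "good T'" "row_word T' \<in> W"
    "insert_into T (Row r) w = (T', (r, p), if p = r \<and> w \<notin> \<int> then Column_Insertion else Row_Insertion)"
proof -
  note V = validD[OF assms(1)]
  note g = goodD[OF V(1)]
  have less: "val T b < \<lceil>w\<rceil>" if "b \<in> boxes (Row r) \<inter> dom T" for b using assms(2) that by (simp add: final_def)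
  have row: "(r, q) \<in> dom T \<and> val T (r, q) < \<lceil>w\<rceil>" if "r \<le> q" "q < p" for q
    using p(4)[of q] that less[of "(r, q)"] by simp
  define x where "x = (if p = r then of_int \<lceil>w\<rceil> else w)"
  have cx: "\<lceil>x\<rceil> = \<lceil>w\<rceil>" "x \<in> half_ints" "r = p \<Longrightarrow> x \<in> \<int>" using V(4) by (simp_all add: x_def)
  have below: "(k, p) \<in> dom T" if k: "1 \<le> k" "k < r" for k
  proof -
    obtain s where s: "r = Suc s" "1 \<le> s" "k \<le> s" using k by (cases r) auto
    have "(s, p) \<in> dom T" using row_landing[OF V(1), of s w p] V(2) s p(1) row by simp
    then show ?thesis using g(9)[OF _ k(1) s(3), of p p] k p(1) by simp
  qed
  have shape: "shape (insert (r, p) (dom T))"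
  proof (rule shape_insert[OF g(1) assms(3) p(1)])
    fix k l assume kl: "1 \<le> k" "k \<le> r" "k \<le> l" "l \<le> p" "(k, l) \<noteq> (r, p)"
    show "(k, l) \<in> dom T"
    proof (cases "k = r")
      case True
      then show ?thesis using kl p(4)[of l] by simp
    next
      case False
      then show ?thesis using g(9)[OF below[of k], of k l] kl by simp
    qed
  qed
  show good: "good T'"
    unfolding T' x_def[symmetric]
  proof (rule good_upd[OF V(1) shape cx(2,3)])
    fix q assume "(r, q) \<in> dom T" "q < p"
    then show "val T (r, q) < \<lceil>x\<rceil>" using row p(4)[of q] cx by simp
  next
    fix q assume "(r, q) \<in> dom T" "p < q"
    then show "\<lceil>x\<rceil> < val T (r, q)" using p(4)[of q] by simp
  next
    fix k assume "(k, p) \<in> dom T" "k < r"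
    then show "val T (k, p) < \<lceil>x\<rceil>" using row_landing_below[OF V(1,2) p(1)] row cx(1) by simp
  next
    fix k assume k: "(k, p) \<in> dom T" "r < k"
    have "(r, p) \<in> dom T" using g(9)[OF k(1), of r p] k(2) assms(3) p(1) by simp
    then show "\<lceil>x\<rceil> < val T (k, p)" using p(3) by simp
  qed auto
  have "row_word T' = state_word T (Row r) x"
    using row_reading_insert[OF g(2) p(3), of x] p(4) row_word_row_reading[OF good] by (simp add: T' x_def)
  also have "\<dots> \<in> W"
  proof (cases "p = r")
    case True
    have none: "{b \<in> dom T. r \<le> fst b} = {}"
    proof (rule ccontr)
      assume "{b \<in> dom T. r \<le> fst b} \<noteq> {}"
      then obtain i j where ij: "(i, j) \<in> dom T" "r \<le> i" by auto
      then have "(r, r) \<in> dom T" using g(9)[OF ij(1), of r r] g(8)[OF ij(1)] assms(3) by simp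
      with p(3) True show False by simp
    qed
    have e: "state_word T (Row r) y = y # row_reading T (rows_below T r)" for y
      unfolding state_word.simps none by simp
    show ?thesis using V(3) unfolding e by (rule toggle_first) (rule cx)+
  next
    case False
    then show ?thesis using V(3) by (simp add: x_def)
  qed
  finally show "row_word T' \<in> W" .
  show "insert_into T (Row r) w = (T', (r, p), if p = r \<and> w \<notin> \<int> then Column_Insertion else Row_Insertion)"
    using insert_into_final[of "Row r" T w] assms(2) p(2)
    by (auto simp: final_def place_def T' diagonal_def Let_def simp del: first_unoccupied.simps boxes.simps)
qed

text \<open>By \<open>column_landing\<close> the new box lies off the diagonal. The state word
  becomes the column reading of the new tableau, which commutations turn into its row word.\<close>

lemma final_column:
  assumes "valid (T, Column c, w)" "final (T, Column c, w)"
  obtains p where "1 \<le> p" "p < c" "(p, c) \<notin> dom T" "\<And>k. (k, c) \<in> dom T \<longleftrightarrow> 1 \<le> k \<and> k < p"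
    "good (T((p, c) \<mapsto> w))" "row_word (T((p, c) \<mapsto> w)) \<in> W"
    "insert_into T (Column c) w = (T((p, c) \<mapsto> w), (p, c), Column_Insertion)"
proof -
  note V = validD[OF assms(1)]
  note g = goodD[OF V(1)]
  obtain s where s: "c = Suc s" using V(2) by auto
  have less: "val T b < \<lceil>w\<rceil>" if "b \<in> boxes (Column c) \<inter> dom T" for b using assms(2) that by (simp add: final_def)
  let ?P = "\<lambda>x. 1 \<le> x \<and> (x, c) \<notin> dom T"
  have "?P (Suc c)" using g(8)[of "Suc c" c] by auto
  then have P: "?P (LEAST x. ?P x)" by (rule LeastI)
  define p where "p = (LEAST x. ?P x)"
  have p: "1 \<le> p" "(p, c) \<notin> dom T" using P by (simp_all add: p_def)
  have in_dom: "(k, c) \<in> dom T \<longleftrightarrow> 1 \<le> k \<and> k < p" for k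
  proof
    assume k: "(k, c) \<in> dom T"
    have "k < p"
    proof (rule ccontr)
      assume "\<not> k < p"
      then have "(p, c) \<in> dom T" using g(9)[OF k p(1), of c] g(8)[OF k] by simp
      with p(2) show False by simp
    qed
    then show "1 \<le> k \<and> k < p" using g(7)[OF k] by simp
  next
    assume "1 \<le> k \<and> k < p"
    then show "(k, c) \<in> dom T" using not_less_Least[of k ?P] by (auto simp: p_def)
  qed
  have col: "(k, c) \<in> dom T \<and> val T (k, c) < \<lceil>w\<rceil>" if "1 \<le> k" "k < p" for k
    using in_dom[of k] that less[of "(k, c)"] g(8)[of k c] by simp
  have left: "p \<le> s \<and> (p, s) \<in> dom T \<and> val T (p, s) < \<lceil>w\<rceil>"
    using column_landing[OF V(1), of s w p] V(2) p(1) col s by simp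
  have shape: "shape (insert (p, c) (dom T))"
  proof (rule shape_insert[OF g(1) p(1)])
    fix k l assume kl: "1 \<le> k" "k \<le> p" "k \<le> l" "l \<le> c" "(k, l) \<noteq> (p, c)"
    show "(k, l) \<in> dom T"
    proof (cases "l = c")
      case True
      then show ?thesis using kl in_dom[of k] by simp
    next
      case False
      then show ?thesis using g(9)[of p s k l] left kl s by simp
    qed
  qed (use left s in simp)
  let ?T = "T((p, c) \<mapsto> w)"
  have good: "good ?T"
  proof (rule good_upd[OF V(1) shape V(4)])
    fix q assume q: "(p, q) \<in> dom T" "q < c"
    then show "val T (p, q) < \<lceil>w\<rceil>" using val_row_mono[OF V(1) q(1), of s] left s by simp
  next
    fix q assume q: "(p, q) \<in> dom T" "c < q"
    have "(p, c) \<in> dom T" using g(9)[OF q(1) p(1), of c] q(2) left s by simp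
    then show "\<lceil>w\<rceil> < val T (p, q)" using p(2) by simp
  next
    fix k assume "(k, c) \<in> dom T" "k < p"
    then show "val T (k, c) < \<lceil>w\<rceil>" using col in_dom[of k] by simp
  next
    fix k assume "(k, c) \<in> dom T" "p < k"
    then show "\<lceil>w\<rceil> < val T (k, c)" using in_dom[of k] by simp
  qed (use left s in simp)
  have "column_reading ?T (insert (p, c) (dom T)) \<in> W"
    using column_reading_insert[OF g(2) p(2), of w] in_dom V(3) by simp
  then have "row_word ?T \<in> W"
    using row_column_reading_iff[OF good] row_word_row_reading[OF good] by simp
  moreover have "(LEAST x. (x, c) \<in> boxes (Column c) - dom T) = p"
  proof (rule Least_equality)
    show "(p, c) \<in> boxes (Column c) - dom T" using p left s by simp
    show "p \<le> y" if "(y, c) \<in> boxes (Column c) - dom T" for y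
      using that Least_le[of ?P y] by (simp add: p_def)
  qed
  then have "first_unoccupied T (Column c) = (p, c)" by simp
  then have "insert_into T (Column c) w = (?T, (p, c), Column_Insertion)"
    using insert_into_final[of "Column c" T w] assms(2) left s
    by (simp add: final_def place_def diagonal_def Let_def del: first_unoccupied.simps boxes.simps)
  ultimately show thesis using that[of p] p in_dom good left s by simp
qed

text \<open>A new diagonal box always comes from a row, so there the ending is free to record the
  lost prime; elsewhere it tells rows from columns.\<close>

definition unplace :: "tableau \<times> box \<times> ending \<Rightarrow> tableau \<times> segment \<times> rat" where
  "unplace t = (case t of (T, b, e) \<Rightarrow> (T(b := None),
     (if diagonal b \<or> e = Row_Insertion then Row (fst b) else Column (snd b)),
     (if diagonal b \<and> e = Column_Insertion then primed (val T b) else entry T b)))"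

lemma unplace_insert_into:
  assumes "valid (T, seg, w)" "final (T, seg, w)" "insert_into T seg w = (T', b, e)"
  shows "good T'" "row_word T' \<in> W" "b \<notin> dom T" "dom T' = insert b (dom T)" "unplace (T', b, e) = (T, seg, w)"
proof -
  note V = validD[OF assms(1)]
  have "good T' \<and> row_word T' \<in> W \<and> b \<notin> dom T \<and> dom T' = insert b (dom T) \<and> unplace (T', b, e) = (T, seg, w)"
  proof (cases seg)
    case (Row r)
    then have r: "1 \<le> r" using V(2) by simp
    from row_end[OF V(1) r] obtain p where
      p: "r \<le> p" "first_unoccupied T (Row r) = (r, p)" "(r, p) \<notin> dom T" "\<And>q. (r, q) \<in> dom T \<longleftrightarrow> r \<le> q \<and> q < p"
      by metis
    note f = final_row[OF assms(1,2)[unfolded Row] r p refl]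
    have "(T', b, e) = (T((r, p) \<mapsto> (if p = r then of_int \<lceil>w\<rceil> else w)), (r, p),
        if p = r \<and> w \<notin> \<int> then Column_Insertion else Row_Insertion)"
      using f(3) assms(3) unfolding Row by simp
    then have eq: "T' = T((r, p) \<mapsto> (if p = r then of_int \<lceil>w\<rceil> else w))" "b = (r, p)"
        "e = (if p = r \<and> w \<notin> \<int> then Column_Insertion else Row_Insertion)"
      unfolding prod.inject by blast+
    have n: "T(b := None) = T" using p(3) eq by (auto simp: fun_eq_iff)
    show ?thesis using f(1,2) p V(4) n Row unfolding eq
      by (auto simp: unplace_def diagonal_def half_ints_iff fun_upd_idem_iff elim: Ints_cases)
  next
    case (Column c)
    from final_column[OF assms(1,2)[unfolded Column]] obtain p where
      p: "1 \<le> p" "p < c" "(p, c) \<notin> dom T" "good (T((p, c) \<mapsto> w))" "row_word (T((p, c) \<mapsto> w)) \<in> W"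
      "insert_into T (Column c) w = (T((p, c) \<mapsto> w), (p, c), Column_Insertion)"
      by metis
    have eq: "T' = T((p, c) \<mapsto> w)" "b = (p, c)" "e = Column_Insertion"
      using p(6) assms(3) Column by auto
    have n: "T(b := None) = T" using p(3) eq by (auto simp: fun_eq_iff)
    show ?thesis using p n Column unfolding eq by (auto simp: unplace_def diagonal_def)
  qed
  then show "good T'" "row_word T' \<in> W" "b \<notin> dom T" "dom T' = insert b (dom T)" "unplace (T', b, e) = (T, seg, w)"
    by blast+
qed


text \<open>Every removable box admits both endings. Off the diagonal they select between the row
  and the column of the box. On the diagonal they select whether the letter gets a prime, which is
  possible because it is the first letter of the state word.\<close>

lemma final_unplace:
  assumes "good T'" "row_word T' \<in> W" "b \<in> dom T'" "shape (dom T' - {b})"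
  obtains T seg w where "valid (T, seg, w)" "final (T, seg, w)" "insert_into T seg w = (T', b, e)"
proof -
  note g' = goodD[OF assms(1)]
  obtain i j where b: "b = (i, j)" by (cases b)
  have ij: "(i, j) \<in> dom T'" "1 \<le> i" "i \<le> j" using assms(3) g'(7,8) b by blast+
  define T where "T = T'(b := None)"
  have dom: "dom T = dom T' - {(i, j)}" by (auto simp: T_def b)
  have val: "val T a = val T' a" if "a \<in> dom T" for a
    using that by (auto simp: T_def)
  have good: "good T" unfolding T_def by (rule good_remove[OF assms(1,4)])
  note g = goodD[OF good]
  have row: "(i, q) \<in> dom T \<longleftrightarrow> i \<le> q \<and> q < j" for q
  proof
    assume q: "(i, q) \<in> dom T"
    have "q < j"
    proof (rule ccontr)
      assume "\<not> q < j"
      then have "(i, j) \<in> dom T" using g(9)[OF q ij(2), of j] ij by simp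
      then show False using dom by simp
    qed
    then show "i \<le> q \<and> q < j" using g(8)[OF q] by simp
  next
    assume "i \<le> q \<and> q < j"
    then show "(i, q) \<in> dom T" using g'(9)[OF ij(1,2), of q] dom by simp
  qed
  have column: "(k, j) \<in> dom T \<longleftrightarrow> 1 \<le> k \<and> k < i" for k
  proof
    assume k: "(k, j) \<in> dom T"
    have "k < i"
    proof (rule ccontr)
      assume "\<not> k < i"
      then have "(i, j) \<in> dom T" using g(9)[OF k ij(2), of j] ij by simp
      then show False using dom by simp
    qed
    then show "1 \<le> k \<and> k < i" using g(7)[OF k] by simp
  next
    assume "1 \<le> k \<and> k < i"
    then show "(k, j) \<in> dom T" using g'(9)[OF ij(1), of k j] dom ij by simp
  qed
  have not_in: "(i, j) \<notin> dom T" and dom': "dom T' = insert (i, j) (dom T)" using dom ij(1) by auto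
  show thesis
  proof (cases "i = j \<or> e = Row_Insertion")
    case True
    define w where "w = (if i = j \<and> e = Column_Insertion then primed (val T' (i, j)) else entry T' (i, j))"
    have cw: "\<lceil>w\<rceil> = val T' (i, j)" "w \<in> half_ints"
      using g'(3)[OF ij(1)] by (auto simp: w_def half_ints_iff)
    have T': "T' = T((i, j) \<mapsto> (if j = i then of_int \<lceil>w\<rceil> else w))"
    proof -
      have "entry T' (i, j) = (if j = i then of_int \<lceil>w\<rceil> else w)"
      proof (cases "j = i")
        case True
        then show ?thesis using Ints_eq_of_int_ceiling[OF g'(4)[of i]] ij(1) cw(1) by metis
      qed (simp add: w_def)
      then show ?thesis using ij(1) by (auto simp: T_def b)
    qed
    have e: "e = (if j = i \<and> w \<notin> \<int> then Column_Insertion else Row_Insertion)"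
    proof (cases "i = j")
      case True
      then show ?thesis using g'(4)[of i] ij(1) by (cases e) (simp_all add: w_def)
    qed (use True in simp)
    have "admissible T (Row i) w"
    proof (rule admissible_rowI[OF good ij(2,3)])
      fix s assume s: "i = Suc s" "1 \<le> s"
      then have "(s, j) \<in> dom T" using column[of s] by simp
      then show "(s, j) \<in> dom T \<and> val T (s, j) < \<lceil>w\<rceil>"
        using g'(6)[OF _ ij(1), of s] val[of "(s, j)"] dom s cw by simp
    qed (use row in simp)
    moreover have "state_word T (Row i) w \<in> W"
    proof -
      have "row_word T' = state_word T (Row i) (if j = i then of_int \<lceil>w\<rceil> else w)"
        using row_reading_insert[OF g(2) not_in, of "if j = i then of_int \<lceil>w\<rceil> else w"] row
          row_word_row_reading[OF assms(1)] dom' T' by simp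
      then have *: "state_word T (Row i) (if j = i then of_int \<lceil>w\<rceil> else w) \<in> W" using assms(2) by simp
      show ?thesis
      proof (cases "j = i")
        case True
        have none: "{b \<in> dom T. i \<le> fst b} = {}"
        proof (rule ccontr)
          assume "{b \<in> dom T. i \<le> fst b} \<noteq> {}"
          then obtain k l where kl: "(k, l) \<in> dom T" "i \<le> k" by auto
          then have "(i, i) \<in> dom T" using g(9)[OF kl(1), of i i] g(8)[OF kl(1)] ij by simp
          with not_in True show False by simp
        qed
        have e: "state_word T (Row i) y = y # row_reading T (rows_below T i)" for y
          unfolding state_word.simps none by simp
        show ?thesis using * True cw(2) unfolding e by (auto intro: toggle_first)
      qed (use * in simp)
    qed
    ultimately have v: "valid (T, Row i, w)" using good by (simp add: valid_def)
    moreover have f: "final (T, Row i, w)"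
      unfolding final_def prod.case
    proof
      fix a assume "a \<in> boxes (Row i) \<inter> dom T"
      then obtain q where "a = (i, q)" "(i, q) \<in> dom T" by auto
      then show "val T a < \<lceil>w\<rceil>" using row[of q] g'(5)[OF _ ij(1), of q] val[of a] dom cw by simp
    qed
    moreover have "insert_into T (Row i) w = (T', b, e)"
    proof -
      obtain p where p: "i \<le> p" "first_unoccupied T (Row i) = (i, p)" "(i, p) \<notin> dom T"
        "\<And>q. (i, q) \<in> dom T \<longleftrightarrow> i \<le> q \<and> q < p"
        using row_end[OF good ij(2)] by metis
      have "p = j" using p(1) row[of p] row[of j] p(4)[of p] p(4)[of j] ij(3) by auto
      then show ?thesis using final_row(3)[OF v f ij(2) p refl] T' b e by simp
    qed
    ultimately show ?thesis using that by blast
  next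
    case False
    then have lt: "i < j" and e: "e = Column_Insertion" using ij(3) by (simp, cases e, simp_all)
    then obtain s where s: "j = Suc s" "i \<le> s" by (cases j) auto
    define w where "w = entry T' (i, j)"
    have T': "T' = T((i, j) \<mapsto> w)" using ij(1) by (auto simp: T_def b w_def)
    have "admissible T (Column j) w"
    proof (rule admissible_columnI[OF good s(1) ij(2) s(2)])
      have "(i, s) \<in> dom T" using row[of s] s by simp
      then show "(i, s) \<in> dom T" "val T (i, s) < \<lceil>w\<rceil>"
        using g'(5)[OF _ ij(1), of s] val[of "(i, s)"] dom s by (simp_all add: w_def)
    qed (use column s in auto)
    moreover have "state_word T (Column j) w \<in> W"
      using column_reading_insert[OF g(2) not_in, of w] column assms(2) row_column_reading_iff[OF assms(1)]
        row_word_row_reading[OF assms(1)] dom' T' by simp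
    ultimately have v: "valid (T, Column j, w)" using good by (simp add: valid_def)
    moreover have f: "final (T, Column j, w)"
      unfolding final_def prod.case
    proof
      fix a assume "a \<in> boxes (Column j) \<inter> dom T"
      then obtain k where "a = (k, j)" "(k, j) \<in> dom T" by auto
      then show "val T a < \<lceil>w\<rceil>" using column[of k] g'(6)[OF _ ij(1), of k] val[of a] dom by (simp add: w_def)
    qed
    moreover have "insert_into T (Column j) w = (T', b, e)"
    proof -
      obtain p where p: "1 \<le> p" "(p, j) \<notin> dom T" "\<And>k. (k, j) \<in> dom T \<longleftrightarrow> 1 \<le> k \<and> k < p"
        "insert_into T (Column j) w = (T((p, j) \<mapsto> w), (p, j), Column_Insertion)"
        using final_column[OF v f] by metis
      have "p = i" using p(1) column[of p] column[of i] p(3)[of p] p(3)[of i] ij(2) by auto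
      then show ?thesis using p(4) T' b e by simp
    qed
    ultimately show ?thesis using that by blast
  qed
qed

section \<open>A whole insertion and its inverse\<close>

lemma state_word_initial:
  assumes "good T"
  shows "state_word T (Row 1) u = row_word T @ [u]"
proof -
  have "1 \<le> fst b" if "b \<in> dom T" for b
    using goodD(7)[OF assms, of "fst b" "snd b"] that by simp
  then have "{b \<in> dom T. 1 \<le> fst b} = dom T" "rows_below T 1 = {}"
    by (blast, fastforce simp: rows_below_def)
  then show ?thesis by (simp add: row_word_row_reading[OF assms] del: One_nat_def)
qed

lemma valid_initial_iff: "valid (T, Row 1, u) \<longleftrightarrow> good T \<and> row_word T @ [u] \<in> W"
  using state_word_initial[of T u] by (auto simp: valid_def simp del: state_word.simps)

lemma O_insert_good:
  assumes "good T" "row_word T @ [u] \<in> W" "O_insert T u = (T', b, e)"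
  shows "good T'" "row_word T' \<in> W" "b \<notin> dom T" "dom T' = insert b (dom T)"
proof -
  have v: "valid (T, Row 1, u)" using assms valid_initial_iff by simp
  obtain T1 seg1 w1 where s: "step\<^sup>*\<^sup>* (T, Row 1, u) (T1, seg1, w1)" "final (T1, seg1, w1)"
    using ex_final[OF v] by (metis prod_cases3)
  note r = insert_into_steps[OF s(1) v]
  then have "insert_into T1 seg1 w1 = (T', b, e)" using assms(3) by (simp add: O_insert_def)
  from unplace_insert_into[OF _ s(2) this] r
  show "good T'" "row_word T' \<in> W" "b \<notin> dom T" "dom T' = insert b (dom T)" by simp_all
qed

text \<open>The result determines the final state through \<open>unplace\<close>, and the final
  state determines its start by \<open>steps_from_initial_unique\<close>.\<close>

lemma O_insert_inject:
  assumes "good T1" "row_word T1 @ [u1] \<in> W" "good T2" "row_word T2 @ [u2] \<in> W" "O_insert T1 u1 = O_insert T2 u2"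
  shows "T1 = T2" "u1 = u2"
proof -
  have v1: "valid (T1, Row 1, u1)" and v2: "valid (T2, Row 1, u2)" using assms valid_initial_iff by simp_all
  obtain S1 seg1 w1 where s1: "step\<^sup>*\<^sup>* (T1, Row 1, u1) (S1, seg1, w1)" "final (S1, seg1, w1)"
    using ex_final[OF v1] by (metis prod_cases3)
  obtain S2 seg2 w2 where s2: "step\<^sup>*\<^sup>* (T2, Row 1, u2) (S2, seg2, w2)" "final (S2, seg2, w2)"
    using ex_final[OF v2] by (metis prod_cases3)
  obtain T b e where r: "O_insert T1 u1 = (T, b, e)" by (metis prod_cases3)
  note r1 = insert_into_steps[OF s1(1) v1] and r2 = insert_into_steps[OF s2(1) v2]
  have "insert_into S1 seg1 w1 = (T, b, e)" "insert_into S2 seg2 w2 = (T, b, e)"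
    using r1 r2 r assms(5) by (simp_all add: O_insert_def)
  with unplace_insert_into(5)[OF _ s1(2)] unplace_insert_into(5)[OF _ s2(2)] r1 r2
  have "(S1, seg1, w1) = (S2, seg2, w2)" by metis
  with steps_from_initial_unique[OF v1 v2 s1(1)] s2(1) show "T1 = T2" "u1 = u2" by simp_all
qed

lemma O_insert_surj:
  assumes "good T'" "row_word T' \<in> W" "b \<in> dom T'" "shape (dom T' - {b})"
  obtains T u where "good T" "row_word T @ [u] \<in> W" "O_insert T u = (T', b, e)"
proof -
  obtain S seg w where s: "valid (S, seg, w)" "insert_into S seg w = (T', b, e)"
    using final_unplace[OF assms] by metis
  obtain T u where t: "valid (T, Row 1, u)" "step\<^sup>*\<^sup>* (T, Row 1, u) (S, seg, w)"
    using ex_initial[OF s(1)] by blast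
  then have "O_insert T u = (T', b, e)" using insert_into_steps[OF t(2,1)] s(2) by (simp add: O_insert_def)
  then show thesis using that t(1) valid_initial_iff by blast
qed

end

section \<open>Tableaux that increase only as half-integers\<close>

context word_class
begin

text \<open>A column might increase only as \<open>x' < x\<close>. Braid relations move such a coincidence to the left
  along its two rows, and at the diagonal the word is not reduced.\<close>

lemma good_if_increasing:
  assumes T: "shape (dom T)" "\<forall>b \<in> dom T. entry T b \<in> half_ints" "no_primed_diagonal T" "increasing_tableau T"
    and W: "row_word T \<in> W"
  shows "good T"
proof -
  note sh = shapeD[OF T(1)]
  have word: "row_reading T (dom T) \<in> W" using W row_word_eq[OF sh(1)] by (simp add: row_reading_def)
  have dec: "row_reading T (dom T) = row_reading T {b \<in> dom T. r \<le> fst b} @ row_reading T (rows_below T r)" for r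
  proof -
    have "row_boxes ({b \<in> dom T. r \<le> fst b} \<union> rows_below T r) = row_boxes {b \<in> dom T. r \<le> fst b} @ row_boxes (rows_below T r)"
      by (rule row.listing_Un) (use sh(1) in \<open>auto simp: box_set_defs row_before_def\<close>)
    moreover have "{b \<in> dom T. r \<le> fst b} \<union> rows_below T r = dom T" by (auto simp: box_set_defs)
    ultimately show ?thesis by (simp add: row_reading_def)
  qed
  have row_le: "val T (i, j) \<le> val T (i, k)" if "(i, j) \<in> dom T" "(i, k) \<in> dom T" "j \<le> k" for i j k
  proof (cases "j = k")
    case False
    then have "entry T (i, j) < entry T (i, k)" using T(4) that unfolding increasing_tableau_def by (metis le_neq_implies_less)
    then show ?thesis by (intro ceiling_mono less_imp_le)
  qed simp
  have col_le: "val T (i, j) \<le> val T (k, j)" if "(i, j) \<in> dom T" "(k, j) \<in> dom T" "i \<le> k" for i j k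
  proof (cases "i = k")
    case False
    then have "entry T (i, j) < entry T (k, j)" using T(4) that unfolding increasing_tableau_def by (metis le_neq_implies_less)
    then show ?thesis by (intro ceiling_mono less_imp_le)
  qed simp
  have row_less: "val T (i, j) < val T (i, k)" if ij: "(i, j) \<in> dom T" "(i, k) \<in> dom T" "j < k" for i j k
  proof -
    have s: "(i, Suc j) \<in> dom T" using sh(4)[OF ij(2), of i "Suc j"] sh(2,3)[OF ij(1)] ij(3) by simp
    have "val T (i, j) \<noteq> val T (i, Suc j)"
    proof
      assume "val T (i, j) = val T (i, Suc j)"
      moreover have "(row_reading T (rows_above T i) @ row_reading T (row_left T i j)) @ entry T (i, j) #
          entry T (i, Suc j) # row_reading T (row_right T i (Suc j)) @ row_reading T (rows_below T i) \<in> W"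
        using word unfolding dec[of i] row_reading_at_least[OF sh(1) ij(1)] row_reading_right[OF sh(1) s] by simp
      ultimately show False using no_repeat by blast
    qed
    then show ?thesis using row_le[OF ij(1) s] row_le[OF s ij(2)] ij(3) by simp
  qed
  define bad where "bad r j \<longleftrightarrow> (r, j) \<in> dom T \<and> (Suc r, j) \<in> dom T \<and> val T (r, j) = val T (Suc r, j)" for r j
  have "\<not> bad r j" for r j
  proof
    assume "bad r j"
    \<comment> \<open>Maximality of \<open>r\<close> excludes coincidences higher up. Maximality of
      \<open>j\<close> within row \<open>r\<close> makes the letters to the right of
      \<open>(Suc r, j)\<close> larger by at least two.\<close>
    then have "\<exists>r. (\<exists>j. bad r j) \<and> (\<forall>r'. (\<exists>j. bad r' j) \<longrightarrow> r' \<le> r)"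
    proof (intro Nat.ex_has_greatest_nat allI impI)
      fix r' assume "\<exists>j. bad r' j"
      then have "r' \<in> fst ` dom T" by (force simp: bad_def)
      then show "r' \<le> Max (fst ` dom T)" using sh(1) by simp
    qed blast
    then obtain r j0 where r: "bad r j0" "\<And>r' j. bad r' j \<Longrightarrow> r' \<le> r" by blast
    have "\<exists>j. bad r j \<and> (\<forall>j'. bad r j' \<longrightarrow> j' \<le> j)"
    proof (intro Nat.ex_has_greatest_nat allI impI)
      show "bad r j0" by (rule r(1))
      fix j' assume "bad r j'"
      then have "j' \<in> snd ` dom T" by (force simp: bad_def)
      then show "j' \<le> Max (snd ` dom T)" using sh(1) by simp
    qed
    then obtain j where j: "bad r j" "\<And>j'. bad r j' \<Longrightarrow> j' \<le> j" by blast
    define A where "A = row_reading T (rows_above T (Suc r))"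
    define p where "p = row_reading T \<circ> row_left T (Suc r)"
    define L where "L = row_reading T \<circ> row_left T r"
    have bad_bounds: "1 \<le> r" "Suc r \<le> k" if "bad r k" for k
      using that sh(2)[of r k] sh(3)[of "Suc r" k] by (auto simp: bad_def)
    have L_less: "\<forall>x \<in> set (L k). \<lceil>x\<rceil> < val T (r, k)" if "(r, k) \<in> dom T" for k
      using that sh(1) row_less by (auto simp: L_def box_set_defs)
    \<comment> \<open>The moving coincidence: two letters equal to the entry at
      \<open>(r, k)\<close>, separated only by the part of row \<open>r\<close> to the left of
      column \<open>k\<close>.\<close>
    define chain where "chain k \<longleftrightarrow> (\<exists>x y Z. \<lceil>x\<rceil> = val T (r, k) \<and> \<lceil>y\<rceil> = val T (r, k) \<and> A @ p k @ x # L k @ y # Z \<in> W)" for k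
    have base: "chain j"
    proof -
      have d: "(r, j) \<in> dom T" "(Suc r, j) \<in> dom T" "val T (Suc r, j) = val T (r, j)" using j(1) by (simp_all add: bad_def)
      define q where "q = row_reading T (row_right T (Suc r) j)"
      define Z where "Z = row_reading T (row_right T r j) @ row_reading T (rows_below T r)"
      have *: "A @ p j @ entry T (Suc r, j) # q @ L j @ entry T (r, j) # Z \<in> W"
        using word unfolding dec[of "Suc r"] row_reading_at_least[OF sh(1) d(2)] row_reading_less_Suc[OF sh(1) d(1)]
        by (simp add: A_def p_def q_def L_def Z_def)
      have far: "val T (r, j) + 2 \<le> \<lceil>x\<rceil>" if "x \<in> set q" for x
      proof -
        have "x \<in> entry T ` row_right T (Suc r) j" using that sh(1) by (simp add: q_def)
        then obtain k where k: "(Suc r, k) \<in> dom T" "j < k" "x = entry T (Suc r, k)"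
          unfolding row_right_def by force
        have k': "(r, k) \<in> dom T" using sh(4)[OF k(1), of r k] bad_bounds[OF j(1)] k(2) by simp
        then have "\<not> bad r k" using j(2)[of k] k(2) by auto
        then have "val T (r, k) < val T (Suc r, k)" using k k' col_le[OF k' k(1)] by (simp add: bad_def)
        then show ?thesis using row_less[OF d(1) k' k(2)] k(3) by simp
      qed
      have "A @ p j @ entry T (Suc r, j) # L j @ q @ entry T (r, j) # Z \<in> W"
      proof -
        have swap: "u @ q @ M @ v \<in> W \<longleftrightarrow> u @ M @ q @ v \<in> W" if "set M \<subseteq> set (L j)" for u v M
          using that
        proof (induction M arbitrary: u)
          case (Cons m M)
          have "\<forall>x \<in> set q. 2 \<le> \<bar>\<lceil>m\<rceil> - \<lceil>x\<rceil>\<bar>"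
            using far L_less[OF d(1)] Cons.prems by fastforce
          then have "u @ q @ m # M @ v \<in> W \<longleftrightarrow> u @ m # q @ M @ v \<in> W" using move_right[of q m u "M @ v"] by simp
          also have "\<dots> \<longleftrightarrow> u @ m # M @ q @ v \<in> W" using Cons.IH[of "u @ [m]"] Cons.prems by simp
          finally show ?case by simp
        qed simp
        show ?thesis using * swap[of "L j" "A @ p j @ [entry T (Suc r, j)]" "entry T (r, j) # Z"] by simp
      qed
      moreover have "\<forall>x \<in> set q. 2 \<le> \<bar>val T (r, j) - \<lceil>x\<rceil>\<bar>" using far by fastforce
      ultimately have "A @ p j @ entry T (Suc r, j) # L j @ entry T (r, j) # q @ Z \<in> W"
        using move_right[of q "entry T (r, j)" "A @ p j @ entry T (Suc r, j) # L j" Z] by simp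
      then show ?thesis using d(3) unfolding chain_def by blast
    qed
    \<comment> \<open>\<open>repeat_gap\<close> asks for a near letter between the two equal ones,
      and the left neighbour in row \<open>r\<close> is the largest candidate.\<close>
    have prev: "(r, k) \<in> dom T \<and> val T (r, k) = val T (r, Suc k) - 1" if c: "bad r (Suc k)" "chain (Suc k)" for k
    proof -
      obtain x y Z where xyZ: "\<lceil>x\<rceil> = val T (r, Suc k)" "\<lceil>y\<rceil> = val T (r, Suc k)" "A @ p (Suc k) @ x # L (Suc k) @ y # Z \<in> W"
        using c(2) by (auto simp: chain_def)
      have d: "(r, Suc k) \<in> dom T" using c(1) by (simp add: bad_def)
      have k: "(r, k) \<in> dom T" using sh(4)[OF d, of r k] bad_bounds[OF c(1)] by simp
      have "\<exists>z \<in> set (L (Suc k)). \<bar>\<lceil>z\<rceil> - \<lceil>x\<rceil>\<bar> \<le> 1"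
        using repeat_gap[of "A @ p (Suc k)" x "L (Suc k)" y Z] xyZ by simp
      moreover have "L (Suc k) = L k @ [entry T (r, k)]"
        using row_reading_left[OF sh(1) k] by (simp add: L_def)
      ultimately have "val T (r, Suc k) - 1 \<le> val T (r, k)"
        using xyZ(1) L_less[OF k] by fastforce
      then show ?thesis using k row_less[OF k d] by simp
    qed
    have left: "bad r (Suc r)" "chain (Suc r)"
    proof -
      have "Suc r \<le> j" using bad_bounds j(1) by blast
      then have "bad r (Suc r) \<and> chain (Suc r)"
      proof (induction rule: inc_induct)
        case base
        then show ?case using \<open>chain j\<close> j(1) by simp
      next
        case (step k)
        then have IH: "bad r (Suc k)" "chain (Suc k)" by simp_all
        obtain x y Z where xyZ: "\<lceil>x\<rceil> = val T (r, Suc k)" "\<lceil>y\<rceil> = val T (r, Suc k)" "A @ p (Suc k) @ x # L (Suc k) @ y # Z \<in> W"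
          using IH(2) by (auto simp: chain_def)
        have d: "(r, Suc k) \<in> dom T" "(Suc r, Suc k) \<in> dom T" "val T (Suc r, Suc k) = val T (r, Suc k)"
          using IH(1) by (simp_all add: bad_def)
        have k: "(r, k) \<in> dom T" "val T (r, k) = val T (r, Suc k) - 1" using prev[OF IH] by simp_all
        have k': "(Suc r, k) \<in> dom T" using sh(4)[OF d(2), of "Suc r" k] step(1) by simp
        have eq: "val T (Suc r, k) = val T (r, k)"
          using col_le[OF k(1) k'] row_less[OF k' d(2)] d(3) k(2) by simp
        have pL: "p (Suc k) = p k @ [entry T (Suc r, k)]" "L (Suc k) = L k @ [entry T (r, k)]"
          using row_reading_left[OF sh(1) k(1)] row_reading_left[OF sh(1) k'] by (simp_all add: p_def L_def)
        have far: "\<forall>z \<in> set (L k). 2 \<le> \<bar>\<lceil>x\<rceil> - \<lceil>z\<rceil>\<bar>" using L_less[OF k(1)] xyZ(1) k(2) by fastforce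
        \<comment> \<open>The braid replaces the pair around \<open>(r, k)\<close> by two letters
          equal to that entry. The first of them also equals the entry at \<open>(Suc r, k)\<close>,
          so the coincidence has moved one column to the left.\<close>
        have "(A @ p k @ entry T (Suc r, k) # L k) @ x # entry T (r, k) # y # Z \<in> W"
          using xyZ(3) move_right[OF far, of "A @ p k @ [entry T (Suc r, k)]" "entry T (r, k) # y # Z"] by (simp add: pL)
        from braid[OF this] xyZ k(2)
        have "A @ p k @ entry T (Suc r, k) # L k @ like y (val T (r, k)) # of_int \<lceil>x\<rceil> # like x (val T (r, k)) # Z \<in> W" by simp
        then have "chain k" unfolding chain_def using eq ceiling_like by blast
        then show ?case using k k' eq by (simp add: bad_def)
      qed
      then show "bad r (Suc r)" "chain (Suc r)" by simp_all
    qed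
    have d: "(r, Suc r) \<in> dom T" "(Suc r, Suc r) \<in> dom T" "val T (Suc r, Suc r) = val T (r, Suc r)"
      using left(1) by (simp_all add: bad_def)
    have k: "(r, r) \<in> dom T" "val T (r, r) = val T (r, Suc r) - 1" using prev[OF left] by simp_all
    obtain x y Z where xyZ: "\<lceil>x\<rceil> = val T (r, Suc r)" "\<lceil>y\<rceil> = val T (r, Suc r)" "A @ p (Suc r) @ x # L (Suc r) @ y # Z \<in> W"
      using left(2) by (auto simp: chain_def)
    \<comment> \<open>The motion ends at column \<open>r + 1\<close>: row \<open>r + 1\<close> has
      nothing further left, and row \<open>r\<close> contributes only its diagonal entry. Once
      \<open>A\<close> is moved away, the word starts with a pattern that
      \<open>first_pair_gap\<close> excludes.\<close>
    have "row_left T (Suc r) (Suc r) = {}" "row_left T r r = {}" using sh(3) by (force simp: box_set_defs)+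
    then have e: "p (Suc r) = []" "L (Suc r) = [entry T (r, r)]"
      using row_reading_left[OF sh(1) k(1)] by (simp_all add: p_def L_def)
    have far: "val T (r, Suc r) + 2 \<le> \<lceil>z\<rceil>" if "z \<in> set A" for z
    proof -
      have "z \<in> entry T ` rows_above T (Suc r)" using that sh(1) by (simp add: A_def)
      then obtain i l where il: "(i, l) \<in> dom T" "Suc r < i" "z = entry T (i, l)"
        unfolding rows_above_def by force
      have l: "i \<le> l" using sh(3)[OF il(1)] .
      have 1: "(Suc r, l) \<in> dom T" and 2: "(Suc (Suc r), l) \<in> dom T"
        using sh(4)[OF il(1), of "Suc r" l] sh(4)[OF il(1), of "Suc (Suc r)" l] il(2) l by simp_all
      have "val T (Suc r, Suc r) < val T (Suc r, l)" using row_less[OF d(2) 1] il(2) l by simp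
      moreover have "\<not> bad (Suc r) l" using r(2)[of "Suc r" l] by auto
      then have "val T (Suc r, l) < val T (Suc (Suc r), l)" using col_le[OF 1 2] 1 2 by (simp add: bad_def)
      moreover have "val T (Suc (Suc r), l) \<le> val T (i, l)" using col_le[OF 2 il(1)] il(2) by simp
      ultimately show ?thesis using d(3) il(3) by simp
    qed
    have f: "\<forall>z \<in> set A. 2 \<le> \<bar>\<lceil>x\<rceil> - \<lceil>z\<rceil>\<bar>" "\<forall>z \<in> set A. 2 \<le> \<bar>val T (r, r) - \<lceil>z\<rceil>\<bar>" "\<forall>z \<in> set A. 2 \<le> \<bar>\<lceil>y\<rceil> - \<lceil>z\<rceil>\<bar>"
      using far xyZ(1,2) k(2) by fastforce+
    have "A @ x # entry T (r, r) # y # Z \<in> W" using xyZ(3) e by simp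
    then have "x # A @ entry T (r, r) # y # Z \<in> W" using move_right[OF f(1), of "[]"] by simp
    then have "x # entry T (r, r) # A @ y # Z \<in> W" using move_right[OF f(2), of "[x]"] by simp
    then have "x # entry T (r, r) # y # A @ Z \<in> W" using move_right[OF f(3), of "[x, entry T (r, r)]"] by simp
    then show False by (rule first_pair_gap) (use xyZ in simp)
  qed
  then have col_less: "val T (i, j) < val T (k, j)" if ij: "(i, j) \<in> dom T" "(k, j) \<in> dom T" "i < k" for i j k
  proof -
    have s: "(Suc i, j) \<in> dom T" using sh(4)[OF ij(2), of "Suc i" j] sh(2,3)[OF ij(1)] sh(3)[OF ij(2)] ij(3) by simp
    then have "val T (i, j) \<noteq> val T (Suc i, j)" using \<open>\<And>r j. \<not> bad r j\<close> ij(1) by (auto simp: bad_def)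
    then show ?thesis using col_le[OF ij(1) s] col_le[OF s ij(2)] ij(3) by simp
  qed
  show ?thesis unfolding good_def using T row_less col_less by blast
qed

end

section \<open>Standard tableaux\<close>

definition label :: "nat \<Rightarrow> ending \<Rightarrow> rat" where
  "label n e = (case e of Row_Insertion \<Rightarrow> of_nat n | Column_Insertion \<Rightarrow> primed (int n))"

lemma ceiling_label [simp]: "\<lceil>label n e\<rceil> = int n"
  by (cases e) (simp_all add: label_def)

lemma label_half_ints [simp]: "label n e \<in> half_ints"
  by (cases e) (simp_all add: label_def half_ints_def)

lemma label_inject: "label n e = label n e' \<Longrightarrow> e = e'"
  by (cases e; cases e') (simp_all add: label_def primed_def)

lemma half_int_eq_label: "x \<in> half_ints \<Longrightarrow> \<lceil>x\<rceil> = int n \<Longrightarrow> \<exists>e. x = label n e"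
  by (metis Ints_eq_of_int_ceiling ending.simps(3,4) half_ints_iff label_def of_int_of_nat_eq)

text \<open>Even the primed label, \<open>n + 1/2\<close>, exceeds \<open>n\<close>.\<close>

lemma less_label:
  assumes "\<lceil>x\<rceil> \<le> int n"
  shows "x < label (Suc n) e"
proof -
  have "x \<le> of_int (int n)" using assms by (simp add: ceiling_le_iff)
  then show ?thesis by (cases e) (simp_all add: label_def primed_def)
qed

lemma ran_subset_iff: "ran T \<subseteq> S \<longleftrightarrow> (\<forall>b \<in> dom T. entry T b \<in> S)"
  by (force simp: ran_def)

text \<open>By counting: as many boxes as values to be shown, so no value is repeated and none lies
  outside the range.\<close>

lemma standard_values:
  assumes "standard_tableau Q" "finite (dom Q)"
  shows "bij_betw (val Q) (dom Q) {1..int (card (dom Q))}"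
proof -
  have sub: "{1..int (card (dom Q))} \<subseteq> val Q ` dom Q"
  proof
    fix k assume k: "k \<in> {1..int (card (dom Q))}"
    then have "nat k \<in> {1..card (dom Q)}" by auto
    then have "of_nat (nat k) \<in> ran Q \<or> primed (int (nat k)) \<in> ran Q"
      using assms(1) unfolding standard_tableau_def by blast
    then obtain b x where "Q b = Some x" "\<lceil>x\<rceil> = k" using k by (auto simp: ran_def)
    then show "k \<in> val Q ` dom Q" by force
  qed
  moreover have "card (val Q ` dom Q) \<le> card {1..int (card (dom Q))}"
    using card_image_le[OF assms(2)] by simp
  ultimately have eq: "{1..int (card (dom Q))} = val Q ` dom Q"
    using assms(2) by (intro card_seteq) simp_all
  then have "inj_on (val Q) (dom Q)"
    using assms(2) by (intro eq_card_imp_inj_on) (simp_all flip: eq)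
  then show ?thesis using eq by (simp add: bij_betw_def)
qed

lemma standard_insert:
  assumes "standard_tableau Q" "shape (dom Q)" "b \<notin> dom Q" "shape (insert b (dom Q))" "card (dom Q) = n"
  shows "standard_tableau (Q(b \<mapsto> label (Suc n) e))"
proof -
  obtain i j where b: "b = (i, j)" by (cases b)
  have fin: "finite (dom Q)" using assms(2) by (rule shapeD)
  have bound: "entry Q a < label (Suc n) e" if "a \<in> dom Q" for a
  proof -
    have "val Q a \<in> {1..int (card (dom Q))}"
      using bij_betw_apply[OF standard_values[OF assms(1) fin] that] .
    then show ?thesis using assms(5) by (intro less_label) simp
  qed
  have ij: "1 \<le> i" "i \<le> j" using shapeD(2,3)[OF assms(4), of i j] b by simp_all
  have right: "q < j" if "(i, q) \<in> dom Q" for q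
    using shapeD(4)[OF assms(2) that ij(1) order.refl ij(2)] assms(3) b by force
  have up: "k < i" if "(k, j) \<in> dom Q" for k
    using shapeD(4)[OF assms(2) that ij(1) _ ij(2) order.refl] assms(3) b by force
  let ?Q = "Q(b \<mapsto> label (Suc n) e)"
  have inc: "\<And>i j k. (i, j) \<in> dom Q \<Longrightarrow> (i, k) \<in> dom Q \<Longrightarrow> j < k \<Longrightarrow> entry Q (i, j) < entry Q (i, k)"
    "\<And>i j k. (i, j) \<in> dom Q \<Longrightarrow> (k, j) \<in> dom Q \<Longrightarrow> i < k \<Longrightarrow> entry Q (i, j) < entry Q (k, j)"
    using assms(1) unfolding standard_tableau_def increasing_tableau_def by blast+
  have "increasing_tableau ?Q"
    unfolding increasing_tableau_def
  proof (intro conjI allI impI)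
    fix a c d assume *: "(a, c) \<in> dom ?Q \<and> (a, d) \<in> dom ?Q \<and> c < d"
    show "entry ?Q (a, c) < entry ?Q (a, d)"
    proof (cases "(a, c) = b")
      case True
      then have "(a, d) \<in> dom Q" using * by auto
      then show ?thesis using right[of d] True b * by simp
    next
      case False
      then have "(a, c) \<in> dom Q" using * by simp
      then show ?thesis using False bound[of "(a, c)"] inc(1)[of a c d] * by (cases "(a, d) = b") simp_all
    qed
  next
    fix a c d assume *: "(a, d) \<in> dom ?Q \<and> (c, d) \<in> dom ?Q \<and> a < c"
    show "entry ?Q (a, d) < entry ?Q (c, d)"
    proof (cases "(a, d) = b")
      case True
      then have "(c, d) \<in> dom Q" using * by auto
      then show ?thesis using up[of c] True b * by simp
    next
      case False
      then have "(a, d) \<in> dom Q" using * by simp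
      then show ?thesis using False bound[of "(a, d)"] inc(2)[of a d c] * by (cases "(c, d) = b") simp_all
    qed
  qed
  moreover have "of_nat k \<in> ran ?Q \<or> primed (int k) \<in> ran ?Q" if k: "k \<in> {1..card (dom ?Q)}" for k
  proof -
    have ran: "ran ?Q = insert (label (Suc n) e) (ran Q)" using assms(3) by (auto simp: ran_map_upd)
    have "card (dom ?Q) = Suc n" using assms(3,5) fin by simp
    show ?thesis
    proof (cases "k = Suc n")
      case True
      then show ?thesis unfolding ran by (cases e) (simp_all add: label_def)
    next
      case False
      then have "k \<in> {1..card (dom Q)}" using k assms(5) \<open>card (dom ?Q) = Suc n\<close> by simp
      then show ?thesis using assms(1) unfolding ran standard_tableau_def by blast
    qed
  qed
  ultimately show ?thesis by (simp add: standard_tableau_def)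
qed

lemma standard_remove:
  assumes "standard_tableau Q" "shape (dom Q)" "ran Q \<subseteq> half_ints" "card (dom Q) = Suc n"
  obtains b e where "b \<in> dom Q" "entry Q b = label (Suc n) e" "shape (dom Q - {b})" "standard_tableau (Q(b := None))"
proof -
  have fin: "finite (dom Q)" using assms(2) by (rule shapeD)
  note bij = standard_values[OF assms(1) fin, unfolded assms(4)]
  have inc: "\<And>i j k. (i, j) \<in> dom Q \<Longrightarrow> (i, k) \<in> dom Q \<Longrightarrow> j < k \<Longrightarrow> entry Q (i, j) < entry Q (i, k)"
    "\<And>i j k. (i, j) \<in> dom Q \<Longrightarrow> (k, j) \<in> dom Q \<Longrightarrow> i < k \<Longrightarrow> entry Q (i, j) < entry Q (k, j)"
    using assms(1) unfolding standard_tableau_def increasing_tableau_def by blast+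
  have "int (Suc n) \<in> val Q ` dom Q" using bij by (simp add: bij_betw_def)
  then obtain b where "int (Suc n) = val Q b" "b \<in> dom Q" by (rule imageE)
  then have b: "b \<in> dom Q" "val Q b = int (Suc n)" by simp_all
  then obtain e where e: "entry Q b = label (Suc n) e"
    using half_int_eq_label assms(3) ran_subset_iff by metis
  have less: "val Q a \<le> int n" if "a \<in> dom Q" "a \<noteq> b" for a
  proof -
    have "val Q a \<noteq> int (Suc n)" using bij that b unfolding bij_betw_def by (metis inj_on_contraD)
    moreover have "val Q a \<in> {1..int (Suc n)}" using bij that(1) unfolding bij_betw_def by blast
    ultimately show ?thesis by simp
  qed
  have "shape (dom Q - {b})"
    unfolding shape_def
  proof (intro conjI allI impI)
    fix i j k l assume *: "(i, j) \<in> dom Q - {b}" "1 \<le> k" "k \<le> i" "k \<le> l" "l \<le> j"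
    then have ij: "(i, j) \<in> dom Q" by simp
    have kl: "(k, l) \<in> dom Q" using shapeD(4)[OF assms(2) ij] * by simp
    have "(k, l) \<noteq> b"
    proof
      assume eq: "(k, l) = b"
      then have ne: "(k, l) \<noteq> (i, j)" using * by auto
      have "i \<le> j" using shapeD(3)[OF assms(2) ij] .
      \<comment> \<open>Entries increase along row \<open>k\<close> to column \<open>j\<close> and
        then up to row \<open>i\<close>, so the largest entry cannot sit at
        \<open>(k, l)\<close>.\<close>
      then have kj: "(k, j) \<in> dom Q" using shapeD(4)[OF assms(2) ij, of k j] * by simp
      have "entry Q (k, l) \<le> entry Q (k, j)" using inc(1)[OF kl kj] * by (cases "l = j") auto
      also have "\<dots> \<le> entry Q (i, j)" using inc(2)[OF kj ij] * by (cases "k = i") auto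
      also have "\<dots> < label (Suc n) e" using less[OF ij] * by (intro less_label) simp
      finally show False using e eq by simp
    qed
    with kl show "(k, l) \<in> dom Q - {b}" by simp
  qed (use fin shapeD(2,3)[OF assms(2)] in auto)
  moreover have "standard_tableau (Q(b := None))"
    unfolding standard_tableau_def
  proof (intro conjI ballI)
    show "increasing_tableau (Q(b := None))"
      unfolding increasing_tableau_def
    proof (intro conjI allI impI)
      fix i j k assume *: "(i, j) \<in> dom (Q(b := None)) \<and> (i, k) \<in> dom (Q(b := None)) \<and> j < k"
      then have "(i, j) \<in> dom Q" "(i, k) \<in> dom Q" "(i, j) \<noteq> b" "(i, k) \<noteq> b" by auto
      then show "entry (Q(b := None)) (i, j) < entry (Q(b := None)) (i, k)" using inc(1)[of i j k] * by simp
    next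
      fix i j k assume *: "(i, j) \<in> dom (Q(b := None)) \<and> (k, j) \<in> dom (Q(b := None)) \<and> i < k"
      then have "(i, j) \<in> dom Q" "(k, j) \<in> dom Q" "(i, j) \<noteq> b" "(k, j) \<noteq> b" by auto
      then show "entry (Q(b := None)) (i, j) < entry (Q(b := None)) (k, j)" using inc(2)[of i j k] * by simp
    qed
  next
    fix k assume "k \<in> {1..card (dom (Q(b := None)))}"
    then have k: "k \<in> {1..n}" using b(1) assms(4) fin by simp
    then have "k \<in> {1..card (dom Q)}" using assms(4) by simp
    then have "of_nat k \<in> ran Q \<or> primed (int k) \<in> ran Q" using assms(1) unfolding standard_tableau_def by blast
    moreover have "x \<in> ran (Q(b := None))" if x: "x \<in> ran Q" "\<lceil>x\<rceil> = int k" for x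
    proof -
      obtain a where "Q a = Some x" using x(1) by (auto simp: ran_def)
      moreover from this have "a \<noteq> b" using x(2) b(2) k by auto
      ultimately have "(Q(b := None)) a = Some x" by simp
      then show ?thesis by (rule ranI)
    qed
    ultimately show "of_nat k \<in> ran (Q(b := None)) \<or> primed (int k) \<in> ran (Q(b := None))" by fastforce
  qed
  ultimately show thesis using that b(1) e by blast
qed

section \<open>The correspondence\<close>

lemma P_EG_snoc: "P_EG (a @ [u]) = fst (O_insert (P_EG a) u)"
  by (simp add: P_EG_def)

lemma Q_EG_upto_append: "m \<le> length a \<Longrightarrow> Q_EG_upto (a @ c) m = Q_EG_upto a m"
  by (induction m) (simp_all add: nth_append)

lemma Q_EG_snoc:
  assumes "O_insert (P_EG a) u = (T, b, e)"
  shows "Q_EG (a @ [u]) = (Q_EG a)(b \<mapsto> label (Suc (length a)) e)"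
  using assms by (simp add: Q_EG_def Q_EG_upto_append label_def)

lemma good_increasing:
  assumes "good T"
  shows "increasing_tableau T"
  unfolding increasing_tableau_def
  using goodD(5,6)[OF assms] by (blast intro: less_of_ceiling_less)

lemma good_empty: "good Map.empty"
  by (simp add: good_def shape_def no_primed_diagonal_def)

text \<open>A prefix is a word for another involution, so \<open>z\<close> varies in the induction.
  Replacing the prefix by the row word of its tableau, a word for the same involution, makes the
  results on one insertion applicable.\<close>

lemma EG_invariant:
  assumes "a \<in> R_inv_plus z"
  shows "good (P_EG a) \<and> row_word (P_EG a) \<in> R_inv_plus z \<and> dom (Q_EG a) = dom (P_EG a) \<and>
    card (dom (P_EG a)) = length a \<and> standard_tableau (Q_EG a) \<and> ran (Q_EG a) \<subseteq> half_ints"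
  using assms
proof (induction a arbitrary: z rule: rev_induct)
  case Nil
  then show ?case
    by (simp add: P_EG_def Q_EG_def good_empty row_word_def standard_tableau_def increasing_tableau_def)
next
  case (snoc u a)
  interpret word_class "R_inv_plus z" by (rule word_class_R_inv_plus)
  note a = R_inv_plus_butlast[OF snoc.prems]
  note IH = snoc.IH[OF a]
  have w: "row_word (P_EG a) @ [u] \<in> R_inv_plus z"
    using R_inv_plus_snoc_cong[OF a _ snoc.prems] IH by blast
  obtain T b e where O: "O_insert (P_EG a) u = (T, b, e)" by (metis prod_cases3)
  note g = O_insert_good[OF _ w O]
  have P: "P_EG (a @ [u]) = T" by (simp add: P_EG_snoc O)
  have fin: "finite (dom (P_EG a))" using IH goodD(2) by blast
  have "standard_tableau ((Q_EG a)(b \<mapsto> label (Suc (length a)) e))"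
    using IH g goodD(1)[of T] goodD(1)[of "P_EG a"] by (intro standard_insert) simp_all
  moreover have "ran ((Q_EG a)(b \<mapsto> label (Suc (length a)) e)) \<subseteq> half_ints"
    using IH by (simp add: ran_subset_iff)
  moreover have "dom ((Q_EG a)(b \<mapsto> label (Suc (length a)) e)) = dom T" using IH g(4) by simp
  moreover have "card (dom T) = length (a @ [u])" using IH g(3,4) fin by simp
  ultimately show ?case
    unfolding P Q_EG_snoc[OF O] using IH g(1,2) by blast
qed

text \<open>The last box and its ending are visible in \<open>Q\<close> as the entry with the
  largest ceiling, and \<open>O_insert_inject\<close> then undoes the last insertion. The
  involutions are kept separate because those of the two prefixes are not known to agree until their
  tableaux do.\<close>

lemma EG_inject:
  assumes "a \<in> R_inv_plus z" "a' \<in> R_inv_plus z'" "P_EG a = P_EG a'" "Q_EG a = Q_EG a'"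
  shows "a = a'"
  using assms
proof (induction a arbitrary: z z' a' rule: rev_induct)
  case Nil
  have "card (dom (P_EG [])) = 0" using EG_invariant[OF Nil(1)] by (simp only: list.size)
  moreover have "length a' = card (dom (P_EG []))" using EG_invariant[OF Nil(2)] by (simp only: Nil(3))
  ultimately show ?case by simp
next
  case (snoc u a)
  note inv = EG_invariant[OF snoc.prems(1)] and inv' = EG_invariant[OF snoc.prems(2)]
  have "card (dom (P_EG (a @ [u]))) = length (a @ [u])" "card (dom (P_EG a')) = length a'"
    using inv inv' by blast+
  then have len: "length a' = Suc (length a)" using snoc.prems(3) by simp
  then obtain c u' where a': "a' = c @ [u']" by (cases a' rule: rev_cases) auto
  have "row_word (P_EG a') \<in> R_inv_plus z" "row_word (P_EG a') \<in> R_inv_plus z'"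
    using inv inv' snoc.prems(3) by simp_all
  then have z: "z' = z" by (simp add: R_inv_plus_iff R_inv_def)
  interpret word_class "R_inv_plus z" by (rule word_class_R_inv_plus)
  have c: "c @ [u'] \<in> R_inv_plus z" using snoc.prems(2) a' z by simp
  note b1 = R_inv_plus_butlast[OF snoc.prems(1)] and b2 = R_inv_plus_butlast[OF c]
  note i1 = EG_invariant[OF b1] and i2 = EG_invariant[OF b2]
  have w1: "row_word (P_EG a) @ [u] \<in> R_inv_plus z"
    using R_inv_plus_snoc_cong[OF b1 _ snoc.prems(1)] i1 by blast
  have w2: "row_word (P_EG c) @ [u'] \<in> R_inv_plus z"
    using R_inv_plus_snoc_cong[OF b2 _ c] i2 by blast
  obtain T b e where O: "O_insert (P_EG a) u = (T, b, e)" by (metis prod_cases3)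
  obtain T' b' e' where O': "O_insert (P_EG c) u' = (T', b', e')" by (metis prod_cases3)
  note g = O_insert_good[OF _ w1 O] and g' = O_insert_good[OF _ w2 O']
  have lc: "length c = length a" using len a' by simp
  let ?n = "length a"
  have Q: "(Q_EG a)(b \<mapsto> label (Suc ?n) e) = (Q_EG c)(b' \<mapsto> label (Suc ?n) e')"
    using snoc.prems(4) unfolding a' Q_EG_snoc[OF O] Q_EG_snoc[OF O'] lc .
  have nb: "b \<notin> dom (Q_EG a)" "b' \<notin> dom (Q_EG c)" using i1 i2 g g' by simp_all
  \<comment> \<open>The labels in \<open>Q_EG c\<close> stop at \<open>length a\<close>, so a label
    with the next integer marks the last box on both sides.\<close>
  have "val (Q_EG c) x \<noteq> int (Suc ?n)" if x: "x \<in> dom (Q_EG c)" for x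
  proof -
    have "val (Q_EG c) x \<in> {1..int (card (dom (Q_EG c)))}"
      using i2 goodD(2)[of "P_EG c"] by (intro bij_betw_apply[OF standard_values x]) simp_all
    then show ?thesis using i2 lc by simp
  qed
  moreover have "(if b = b' then Some (label (Suc ?n) e') else Q_EG c b) = Some (label (Suc ?n) e)"
    using fun_cong[OF Q, of b] by simp
  ultimately have b: "b' = b" and e: "label (Suc ?n) e = label (Suc ?n) e'"
    by (metis ceiling_label domI option.sel, metis ceiling_label domI option.sel)
  have e': "e' = e" using label_inject[OF e] by simp
  have "Q_EG a = Q_EG c"
    using fun_upd_eqD Q nb b by (metis domIff fun_upd_triv fun_upd_upd)
  moreover have "T = T'" using snoc.prems(3) O O' a' by (simp add: P_EG_snoc)
  then have "O_insert (P_EG a) u = O_insert (P_EG c) u'" using O O' b e' by simp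
  from O_insert_inject[OF _ w1 _ w2 this] i1 i2 have "P_EG a = P_EG c" "u = u'" by simp_all
  ultimately show ?case using snoc.IH[OF b1 b2] a' by simp
qed

text \<open>The largest label of \<open>Q\<close> names the box added last and its ending,
  \<open>O_insert_surj\<close> takes that box off \<open>P\<close>, and the induction treats the
  smaller pair with the involution of its own row word.\<close>

lemma EG_surj:
  assumes "good P" "row_word P \<in> R_inv_plus z" "dom Q = dom P" "standard_tableau Q" "ran Q \<subseteq> half_ints"
  shows "\<exists>a \<in> R_inv_plus z. P_EG a = P \<and> Q_EG a = Q"
  using assms
proof (induction "card (dom P)" arbitrary: P Q z)
  case 0
  then have "dom P = {}" using goodD(2)[of P] by simp
  then have "P = Map.empty" "Q = Map.empty" using 0 by auto
  moreover have "row_word Map.empty = []" by (simp add: row_word_def)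
  ultimately show ?case using 0 by (intro bexI[of _ "[]"]) (simp_all add: P_EG_def Q_EG_def)
next
  case (Suc n)
  interpret word_class "R_inv_plus z" by (rule word_class_R_inv_plus)
  have "shape (dom Q)" "card (dom Q) = Suc n" using Suc.hyps Suc.prems goodD(1) by simp_all
  then obtain b e where be: "b \<in> dom Q" "entry Q b = label (Suc n) e" "shape (dom Q - {b})" "standard_tableau (Q(b := None))"
    using standard_remove[OF Suc.prems(4) _ Suc.prems(5)] by metis
  then have "b \<in> dom P" "shape (dom P - {b})" using Suc.prems(3) by simp_all
  then obtain T u where T: "good T" "row_word T @ [u] \<in> R_inv_plus z" "O_insert T u = (P, b, e)"
    using O_insert_surj[OF Suc.prems(1,2)] by metis
  note g = O_insert_good[OF T]
  note w = R_inv_plus_butlast[OF T(2)]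
  have dom: "dom (Q(b := None)) = dom T" using g Suc.prems(3) by auto
  have "n = card (dom T)" using Suc.hyps(2) g goodD(2)[OF T(1)] by simp
  moreover have "ran (Q(b := None)) \<subseteq> half_ints" using Suc.prems(5) by (auto simp: ran_def)
  ultimately obtain a where a: "a \<in> R_inv_plus (inv_product (ceilings (row_word T)))" "P_EG a = T" "Q_EG a = Q(b := None)"
    using Suc.hyps(1)[OF _ T(1) w dom be(4)] by blast
  have "a @ [u] \<in> R_inv_plus z" using R_inv_plus_snoc_cong[OF w a(1) T(2)] .
  moreover have "P_EG (a @ [u]) = P" using a T by (simp add: P_EG_snoc)
  moreover have "length a = n" using EG_invariant[OF a(1)] a(2) \<open>n = card (dom T)\<close> by simp
  then have "Q_EG (a @ [u]) = Q"
    using Q_EG_snoc[of a u P b e] a T(3) be(1,2) by auto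
  ultimately show ?case by blast
qed

theorem theorem3p11:
  fixes z :: "int perm"
  assumes "z \<in> I_Z"
  shows "bij_betw (\<lambda>a. (P_EG a, Q_EG a))
           (R_inv_plus z)
           {(P, Q). (\<exists>lam. strict_partition lam \<and> shifted_tableau lam P \<and> shifted_tableau lam Q) \<and>
                    increasing_tableau P \<and> no_primed_diagonal P \<and>
                    standard_tableau Q \<and>
                    row_word P \<in> R_inv_plus z}"
proof -
  interpret word_class "R_inv_plus z" by (rule word_class_R_inv_plus)
  have "inj_on (\<lambda>a. (P_EG a, Q_EG a)) (R_inv_plus z)"
    by (rule inj_onI) (auto intro: EG_inject)
  \<comment> \<open>The target set in the terms of the proof: a common domain that is a
    \<open>shape\<close>, and \<open>good\<close> for \<open>P\<close>. Passing from increasing to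
    \<open>good\<close> relies on the row word.\<close>
  moreover have "(\<exists>lam. strict_partition lam \<and> shifted_tableau lam P \<and> shifted_tableau lam Q) \<and>
      increasing_tableau P \<and> no_primed_diagonal P \<and> standard_tableau Q \<and> row_word P \<in> R_inv_plus z \<longleftrightarrow>
      good P \<and> row_word P \<in> R_inv_plus z \<and> dom Q = dom P \<and> standard_tableau Q \<and> ran Q \<subseteq> half_ints" for P Q
  proof
    assume *: "(\<exists>lam. strict_partition lam \<and> shifted_tableau lam P \<and> shifted_tableau lam Q) \<and>
      increasing_tableau P \<and> no_primed_diagonal P \<and> standard_tableau Q \<and> row_word P \<in> R_inv_plus z"
    then obtain lam where lam: "strict_partition lam" "shifted_tableau lam P" "shifted_tableau lam Q" by blast
    then have "dom P = SD lam" "dom Q = SD lam" "ran Q \<subseteq> half_ints" "ran P \<subseteq> half_ints"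
      by (simp_all add: shifted_tableau_def)
    moreover from this have "shape (dom P)" using shape_SD[OF lam(1)] by simp
    moreover note ran_subset_iff[of P half_ints]
    ultimately have "good P" "dom Q = dom P" "ran Q \<subseteq> half_ints"
      using good_if_increasing[of P] * by simp_all
    with * show "good P \<and> row_word P \<in> R_inv_plus z \<and> dom Q = dom P \<and> standard_tableau Q \<and> ran Q \<subseteq> half_ints"
      by blast
  next
    assume *: "good P \<and> row_word P \<in> R_inv_plus z \<and> dom Q = dom P \<and> standard_tableau Q \<and> ran Q \<subseteq> half_ints"
    then obtain lam where "strict_partition lam" "dom P = SD lam" using ex_strict_partition goodD(1) by blast
    moreover have "ran P \<subseteq> half_ints" unfolding ran_subset_iff using * goodD(3)[of P] by simp
    ultimately show "(\<exists>lam. strict_partition lam \<and> shifted_tableau lam P \<and> shifted_tableau lam Q) \<and>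
      increasing_tableau P \<and> no_primed_diagonal P \<and> standard_tableau Q \<and> row_word P \<in> R_inv_plus z"
      using * good_increasing by (auto simp: shifted_tableau_def good_def)
  qed
  moreover have "(\<lambda>a. (P_EG a, Q_EG a)) ` R_inv_plus z =
      {(P, Q). good P \<and> row_word P \<in> R_inv_plus z \<and> dom Q = dom P \<and> standard_tableau Q \<and> ran Q \<subseteq> half_ints}"
    (is "?f ` _ = ?S")
  proof (intro equalityI subsetI)
    fix x assume "x \<in> ?f ` R_inv_plus z"
    then obtain a where "a \<in> R_inv_plus z" "x = ?f a" by blast
    then show "x \<in> ?S" using EG_invariant[of a z] by simp
  next
    fix x assume "x \<in> ?S"
    then obtain P Q where x: "x = (P, Q)" and
      "good P" "row_word P \<in> R_inv_plus z" "dom Q = dom P" "standard_tableau Q" "ran Q \<subseteq> half_ints"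
      by blast
    from EG_surj[OF this(2-)] obtain a where "a \<in> R_inv_plus z" "P_EG a = P" "Q_EG a = Q" by blast
    with x show "x \<in> ?f ` R_inv_plus z" by blast
  qed
  ultimately show ?thesis by (simp add: bij_betw_def)
qed

end
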